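(* Let $(R,\mathfrak{m},K)$ be a local Artinian commutative ring, let $n\ge1$, and let $C\subseteq R^n$ be an $R$-code. Let $(S,\mathfrak{n},L)$ be a flat $R$-algebra that is a zero-dimensional Noetherian (i.e. Artinian) local ring, and let $\theta=\lambda_S(S/\mathfrak{m}S)$. Then, for every $0\le i\le n$, $$g^{C\otimes_R S}_i(z)=g^C_i(z^\theta),$$ where $C\otimes_R S\subseteq S^n$ is regarded as an $S$-code.
   Context: All rings are commutative with unity. $(R,\mathfrak{m},K)$ denotes a local Artinian ring with maximal ideal $\mathfrak{m}$ and residue field $K$; similarly for $(S,\mathfrak{n},L)$. An $R$-code of length $n$ is an $R$-submodule $C\subseteq R^n$. By flatness, $C\otimes_R S$ is identified with its image in $R^n\otimes_R S=S^n$. $\lambda_R$ (resp. $\lambda_S$) denotes length of $R$-modules (resp. $S$-modules). Let $[n]=\{1,\dots,n\}$ and $\operatorname{supp}(v)=\{i : v_i\ne 0\}$. For a code $D$ of length $n$ over a local Artinian ring $Q$ and $\mathcal{A}\subseteq[n]$, $D(\mathcal{A})=\{v\in D : \operatorname{supp}(v)\subseteq\mathcal{A}\}$, and for $0\le i\le n$ the $i$-th weight polynomial is $$g^D_i(z)=\sum_{a=0}^{i}\ \sum_{\mathcal{A}\subseteq[n],\,|\mathcal{A}|=a}(-1)^{i-a}\binom{n-a}{i-a}z^{\lambda_Q(D(\mathcal{A}))}.$$ *)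

theory Defs
  imports
    "HOL-Computational_Algebra.Polynomial"
    "HOL-Library.Extended_Nat"
    "HOL-Algebra.Free_Abelian_Groups"
    "HOL-Algebra.QuotRing"
    "HOL-Algebra.Module"
begin

section \<open>Local Artinian rings and length\<close>

locale local_ring = cring R for R (structure) +
  fixes \<mm> :: "'a set"
  assumes maximalideal_iff: "maximalideal I R \<longleftrightarrow> I = \<mm>"

locale local_artinian_ring = local_ring R \<mm> for R (structure) and \<mm> +
  assumes descending_chain:
    "\<lbrakk>\<And>k::nat. ideal (I k) R; \<And>k. I (Suc k) \<subseteq> I k\<rbrakk> \<Longrightarrow> \<exists>k. \<forall>l\<ge>k. I l = I k"

text \<open>The supremum of the lengths of all chains
  \<open>N 0 \<subset> N 1 \<subset> \<dots> \<subset> N l\<close> of submodules.\<close>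

definition module_length ::
    "('a, 'm) ring_scheme \<Rightarrow> ('a, 'b, 'c) module_scheme \<Rightarrow> enat" where
  "module_length R M =
    (SUP l \<in> {l. \<exists>N. (\<forall>i\<le>l. submodule (N i) R M) \<and> (\<forall>i<l. N i \<subset> N (Suc i))}. enat l)"

definition quotient_ring_module ::
    "('a, 'm) ring_scheme \<Rightarrow> 'a set \<Rightarrow> ('a, 'a set) module" where
  "quotient_ring_module S I =
    \<lparr>carrier = carrier (S Quot I), mult = mult (S Quot I), one = one (S Quot I),
     zero = zero (S Quot I), add = add (S Quot I),
     smult = (\<lambda>s X. (I +>\<^bsub>S\<^esub> s) \<otimes>\<^bsub>S Quot I\<^esub> X)\<rparr>"

definition extended_ideal :: "'a set \<Rightarrow> ('a, 'b, 'c) module_scheme \<Rightarrow> 'b set" where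
  "extended_ideal I S = Idl\<^bsub>S\<^esub> ((\<lambda>r. r \<odot>\<^bsub>S\<^esub> \<one>\<^bsub>S\<^esub>) ` I)"


section \<open>Tensor products and flatness\<close>

definition module_homs ::
    "('a, 'm) ring_scheme \<Rightarrow> ('a, 'b, 'c) module_scheme \<Rightarrow> ('a, 'd, 'e) module_scheme
      \<Rightarrow> ('b \<Rightarrow> 'd) set" where
  "module_homs R M N = {f \<in> carrier M \<rightarrow> carrier N.
     (\<forall>x\<in>carrier M. \<forall>y\<in>carrier M. f (x \<oplus>\<^bsub>M\<^esub> y) = f x \<oplus>\<^bsub>N\<^esub> f y) \<and>
     (\<forall>r\<in>carrier R. \<forall>x\<in>carrier M. f (r \<odot>\<^bsub>M\<^esub> x) = r \<odot>\<^bsub>N\<^esub> f x)}"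

definition tensor_relations ::
    "('a, 'm) ring_scheme \<Rightarrow> ('a, 'b, 'c) module_scheme \<Rightarrow> ('a, 'd, 'e) module_scheme
      \<Rightarrow> ('b \<times> 'd \<Rightarrow>\<^sub>0 int) set" where
  "tensor_relations R M N =
     {frag_of (x \<oplus>\<^bsub>M\<^esub> x', y) - frag_of (x, y) - frag_of (x', y) | x x' y.
        x \<in> carrier M \<and> x' \<in> carrier M \<and> y \<in> carrier N} \<union>
     {frag_of (x, y \<oplus>\<^bsub>N\<^esub> y') - frag_of (x, y) - frag_of (x, y') | x y y'.
        x \<in> carrier M \<and> y \<in> carrier N \<and> y' \<in> carrier N} \<union>
     {frag_of (r \<odot>\<^bsub>M\<^esub> x, y) - frag_of (x, r \<odot>\<^bsub>N\<^esub> y) | r x y.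
        r \<in> carrier R \<and> x \<in> carrier M \<and> y \<in> carrier N}"

definition tensor_kernel ::
    "('a, 'm) ring_scheme \<Rightarrow> ('a, 'b, 'c) module_scheme \<Rightarrow> ('a, 'd, 'e) module_scheme
      \<Rightarrow> ('b \<times> 'd \<Rightarrow>\<^sub>0 int) set" where
  "tensor_kernel R M N =
     generate (free_Abelian_group (carrier M \<times> carrier N)) (tensor_relations R M N)"

text \<open>The underlying abelian group of the tensor product over \<open>R\<close>, written multiplicatively.\<close>

definition tensor_product ::
    "('a, 'm) ring_scheme \<Rightarrow> ('a, 'b, 'c) module_scheme \<Rightarrow> ('a, 'd, 'e) module_scheme
      \<Rightarrow> ('b \<times> 'd \<Rightarrow>\<^sub>0 int) set monoid" where
  "tensor_product R M N =
     free_Abelian_group (carrier M \<times> carrier N) Mod tensor_kernel R M N"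

definition pure_tensor ::
    "('a, 'm) ring_scheme \<Rightarrow> ('a, 'b, 'c) module_scheme \<Rightarrow> ('a, 'd, 'e) module_scheme
      \<Rightarrow> 'b \<Rightarrow> 'd \<Rightarrow> ('b \<times> 'd \<Rightarrow>\<^sub>0 int) set" where
  "pure_tensor R M N x y =
     tensor_kernel R M N #>\<^bsub>free_Abelian_group (carrier M \<times> carrier N)\<^esub> frag_of (x, y)"

text \<open>The homomorphism from the tensor product to the commutative group \<open>A\<close> that an
  \<open>R\<close>-balanced biadditive map \<open>\<beta>\<close> induces: the \<open>\<int>\<close>-linear extension of \<open>\<beta>\<close> to the free
  abelian group is constant on each coset of the relations.\<close>

definition tensor_lift ::
    "('a, 'b, 'c) module_scheme \<Rightarrow> ('a, 'd, 'e) module_scheme \<Rightarrow> ('g, 'h) monoid_scheme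
      \<Rightarrow> ('b \<Rightarrow> 'd \<Rightarrow> 'g) \<Rightarrow> ('b \<times> 'd \<Rightarrow>\<^sub>0 int) set \<Rightarrow> 'g" where
  "tensor_lift M N A \<beta> X =
     the_elem ((\<lambda>c. gfinprod A (\<lambda>(x, y). \<beta> x y [^]\<^bsub>A\<^esub> Poly_Mapping.lookup c (x, y))
       (carrier M \<times> carrier N)) ` X)"

text \<open>Tensoring with \<open>S\<close> preserves injections \<open>M \<rightarrow> N\<close> of \<open>R\<close>-modules.
  HOL cannot quantify over all types inside a formula, so \<open>M\<close> and \<open>N\<close> have carriers in
  the type \<open>(nat \<Rightarrow> 'a) set\<close>.  This type has a copy of every countably generated \<open>R\<close>-module
  (as a set of cosets in the module of finitely supported sequences in \<open>R\<close>), in particular of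
  every finitely generated one, and preservation of injections between finitely generated
  modules already implies flatness.\<close>

definition flat_module ::
    "('a, 'm) ring_scheme \<Rightarrow> ('a, 'b, 'c) module_scheme \<Rightarrow> bool" where
  "flat_module R S \<longleftrightarrow> Module.module R S \<and>
     (\<forall>(M :: ('a, (nat \<Rightarrow> 'a) set) module) (N :: ('a, (nat \<Rightarrow> 'a) set) module).
       \<forall>f \<in> module_homs R M N.
         Module.module R M \<longrightarrow> Module.module R N \<longrightarrow> inj_on f (carrier M) \<longrightarrow>
         inj_on (tensor_lift M S (tensor_product R N S) (\<lambda>x s. pure_tensor R N S (f x) s))
           (carrier (tensor_product R M S)))"


section \<open>Codes and weight polynomials\<close>

text \<open>The module \<open>R\<^sup>n\<close>, its vectors indexed by \<open>{1..n}\<close>.  The fields \<open>mult\<close> and \<open>one\<close> play no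
  role in the module structure.\<close>

definition power_module :: "('a, 'm) ring_scheme \<Rightarrow> nat \<Rightarrow> ('a, nat \<Rightarrow> 'a) module" where
  "power_module R n =
    \<lparr>carrier = {1..n} \<rightarrow>\<^sub>E carrier R,
     mult = (\<lambda>v w. \<lambda>j\<in>{1..n}. v j \<otimes>\<^bsub>R\<^esub> w j), one = (\<lambda>j\<in>{1..n}. \<one>\<^bsub>R\<^esub>),
     zero = (\<lambda>j\<in>{1..n}. \<zero>\<^bsub>R\<^esub>), add = (\<lambda>v w. \<lambda>j\<in>{1..n}. v j \<oplus>\<^bsub>R\<^esub> w j),
     smult = (\<lambda>r v. \<lambda>j\<in>{1..n}. r \<otimes>\<^bsub>R\<^esub> v j)\<rparr>"

definition is_code :: "('a, 'm) ring_scheme \<Rightarrow> nat \<Rightarrow> (nat \<Rightarrow> 'a) set \<Rightarrow> bool" where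
  "is_code R n C \<longleftrightarrow> submodule C R (power_module R n)"

definition supp :: "('a, 'm) ring_scheme \<Rightarrow> nat \<Rightarrow> (nat \<Rightarrow> 'a) \<Rightarrow> nat set" where
  "supp R n v = {j \<in> {1..n}. v j \<noteq> \<zero>\<^bsub>R\<^esub>}"

definition supported_in ::
    "('a, 'm) ring_scheme \<Rightarrow> nat \<Rightarrow> (nat \<Rightarrow> 'a) set \<Rightarrow> nat set \<Rightarrow> (nat \<Rightarrow> 'a) set" where
  "supported_in R n D A = {v \<in> D. supp R n v \<subseteq> A}"

definition submod ::
    "('a, 'm) ring_scheme \<Rightarrow> nat \<Rightarrow> (nat \<Rightarrow> 'a) set \<Rightarrow> ('a, nat \<Rightarrow> 'a) module" where
  "submod R n D = (power_module R n)\<lparr>carrier := D\<rparr>"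

text \<open>Over a local Artinian ring, submodules of \<open>R\<^sup>n\<close> have finite length, so
  \<^const>\<open>the_enat\<close> is applied to finite values only.\<close>

definition weight_poly ::
    "('a, 'm) ring_scheme \<Rightarrow> nat \<Rightarrow> (nat \<Rightarrow> 'a) set \<Rightarrow> nat \<Rightarrow> int poly" where
  "weight_poly R n D i =
     (\<Sum>a = 0..i. \<Sum>A | A \<subseteq> {1..n} \<and> card A = a.
        monom ((- 1) ^ (i - a) * int ((n - a) choose (i - a)))
          (the_enat (module_length R (submod R n (supported_in R n D A)))))"

text \<open>The image of \<open>C \<otimes>\<^sub>R S\<close> in \<open>R\<^sup>n \<otimes>\<^sub>R S = S\<^sup>n\<close>, where \<open>c \<otimes> s\<close> corresponds to
  the vector with entries \<open>c j \<odot> s\<close>.\<close>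

definition extended_code ::
    "('a, 'm) ring_scheme \<Rightarrow> ('a, 'b, 'c) module_scheme \<Rightarrow> nat \<Rightarrow> (nat \<Rightarrow> 'a) set
      \<Rightarrow> (nat \<Rightarrow> 'b) set" where
  "extended_code R S n C =
     tensor_lift (submod R n C) S (add_monoid (power_module S n))
       (\<lambda>c s. \<lambda>j\<in>{1..n}. c j \<odot>\<^bsub>S\<^esub> s)
     ` carrier (tensor_product R (submod R n C) S)"

end

theory Submission
  imports Defs
begin

text \<open>
  Write \<open>\<lambda>\<close> for length and \<open>D S\<close> for the \<open>S\<close>-submodule of \<open>S\<^sup>n\<close> that a submodule \<open>D\<close> of \<open>R\<^sup>n\<close>
  generates.  The weight polynomials only record the lengths of the codes \<open>D(A)\<close>, so the theorem
  says that \<open>\<lambda>\<close> of \<open>(C \<otimes> S)(A)\<close> is \<open>\<theta>\<close> times \<open>\<lambda>\<close> of \<open>C(A)\<close>.  Under the identification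
  \<open>R\<^sup>n \<otimes> S = S\<^sup>n\<close> the code \<open>C \<otimes> S\<close> becomes \<open>C S\<close> (\<open>extended_code_eq_span\<close>), and two facts remain:
  \<open>(C S)(A) = C(A) S\<close> (\<open>supported_in_span\<close>), and \<open>\<lambda>(D S) = \<theta> \<lambda>(D)\<close> for every submodule \<open>D\<close> of
  \<open>R\<^sup>n\<close> (\<open>relative_length_span\<close>).

  Both rest on one consequence of flatness (\<open>span_lift\<close>): \<open>D \<otimes> S \<rightarrow> R\<^sup>n \<otimes> S = S\<^sup>n\<close> is injective, so
  \<open>D S\<close> has the universal property of the tensor product.  Every \<open>R\<close>-balanced map \<open>\<beta>\<close> from \<open>D \<times> S\<close>
  to a commutative group comes from a homomorphism \<open>h\<close> on \<open>D S\<close> with \<open>h (d s) = \<beta> d s\<close>.  Each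
  application consists in writing down a suitable \<open>\<beta>\<close>:

  \<^item> For the supports, let \<open>f\<close> erase the coordinates in \<open>A\<close>.  The map sending \<open>(f c, s)\<close> to the
    class of \<open>c s\<close> modulo \<open>C(A) S\<close> is well defined, since \<open>C(A)\<close> is the kernel of \<open>f\<close> on \<open>C\<close>.  So
    the class of \<open>v\<close> in \<open>C S / C(A) S\<close> depends only on \<open>f v\<close>, and a vector of \<open>C S\<close> that is
    supported in \<open>A\<close> has class \<open>0\<close>.

  \<^item> For the lengths, take \<open>D = N + R x\<close> with \<open>D / N\<close> simple, so that \<open>{r. r x \<in> N} = \<mm>\<close>.  The map
    sending \<open>(u + a x, s)\<close> with \<open>u \<in> N\<close> to the class of \<open>a s\<close> modulo \<open>\<mm> S\<close> shows that \<open>x s \<in> N S\<close>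
    forces \<open>s \<in> \<mm> S\<close>.  Hence \<open>D S / N S\<close> is isomorphic to \<open>S / \<mm> S\<close> and has length \<open>\<theta>\<close>, and the
    formula follows along a composition series of \<open>D\<close>.

  Length is handled through chains of submodules lying between two given ones, so that quotient
  modules rarely appear; it is additive by the modular law.  Finally, all these lengths must be
  finite, because the exponents of the polynomials are numbers.  This is the theorem that an Artinian
  ring has finite length (\<open>finite_length\<close>), here for local rings.
\<close>

section \<open>Length of modules\<close>

text \<open>Chains are taken in arbitrary families of sets, so that submodules and ideals in two different
  rings can be compared by maps between the families.\<close>

definition chain_of_length :: "'x set set \<Rightarrow> nat \<Rightarrow> bool" where
  "chain_of_length F l \<longleftrightarrow> (\<exists>N. (\<forall>i\<le>l. N i \<in> F) \<and> (\<forall>i<l. N i \<subset> N (Suc i)))"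

definition height :: "'x set set \<Rightarrow> enat" where
  "height F = (SUP l \<in> {l. chain_of_length F l}. enat l)"

lemma module_length_eq_height: "module_length R M = height {N. submodule N R M}"
  by (simp add: module_length_def height_def chain_of_length_def)

lemma chain_of_length_mono:
  assumes "chain_of_length F l" "k \<le> l"
  shows "chain_of_length F k"
  using assms unfolding chain_of_length_def by (meson le_trans less_le_trans)

text \<open>Truncating a chain gives all shorter ones, so a supremum of chain lengths that is at least \<open>k\<close>
  is witnessed by a chain of length exactly \<open>k\<close>.\<close>

lemma enat_le_height_iff:
  assumes "F \<noteq> {}"
  shows "enat k \<le> height F \<longleftrightarrow> chain_of_length F k"
proof
  assume "chain_of_length F k"
  then show "enat k \<le> height F"
    unfolding height_def by (intro SUP_upper) auto
next
  assume le: "enat k \<le> height F"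
  show "chain_of_length F k"
  proof (rule ccontr)
    assume no: "\<not> chain_of_length F k"
    have "chain_of_length F 0"
      using assms by (auto simp: chain_of_length_def)
    with no obtain j where j: "k = Suc j" by (cases k) auto
    have "enat l \<le> enat j" if "l \<in> {l. chain_of_length F l}" for l
    proof -
      have "\<not> k \<le> l" using chain_of_length_mono[of F l k] that no by blast
      then show ?thesis using j by simp
    qed
    then have "height F \<le> enat j"
      unfolding height_def by (rule SUP_least)
    from order_trans[OF le this] show False using j by simp
  qed
qed

lemma height_le_if_strict_mono:
  assumes "\<And>X. X \<in> F \<Longrightarrow> f X \<in> G"
    and "\<And>X Y. \<lbrakk>X \<in> F; Y \<in> F; X \<subset> Y\<rbrakk> \<Longrightarrow> f X \<subset> f Y"
  shows "height F \<le> height G"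
  unfolding height_def
proof (rule SUP_subset_mono)
  show "{l. chain_of_length F l} \<subseteq> {l. chain_of_length G l}"
  proof clarify
    fix l assume "chain_of_length F l"
    then obtain N where N: "\<forall>i\<le>l. N i \<in> F" "\<forall>i<l. N i \<subset> N (Suc i)"
      by (auto simp: chain_of_length_def)
    show "chain_of_length G l"
      unfolding chain_of_length_def
    proof (intro exI[of _ "\<lambda>i. f (N i)"] conjI allI impI)
      show "f (N i) \<in> G" if "i \<le> l" for i using that N assms(1) by simp
      show "f (N i) \<subset> f (N (Suc i))" if "i < l" for i using that N assms(2) by simp
    qed
  qed
qed simp

lemma height_mono: "F \<subseteq> G \<Longrightarrow> height F \<le> height G"
  by (rule height_le_if_strict_mono[where f = "\<lambda>X. X"]) auto

lemma height_singleton: "height {X} = 0"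
proof -
  have "height {X} \<le> 0"
    unfolding height_def
  proof (rule SUP_least)
    fix l assume "l \<in> {l. chain_of_length {X} l}"
    then obtain N where N: "\<forall>i\<le>l. N i \<in> {X}" "\<forall>i<l. N i \<subset> N (Suc i)"
      unfolding chain_of_length_def by blast
    have "l = 0"
    proof (rule ccontr)
      assume "l \<noteq> 0"
      then have "N 0 = X" "N (Suc 0) = X" "N 0 \<subset> N (Suc 0)"
        using N(1)[rule_format, of 0] N(1)[rule_format, of "Suc 0"] N(2)[rule_format, of 0] by simp_all
      then show False by simp
    qed
    then show "enat l \<le> 0" by (simp add: enat_0)
  qed
  then show ?thesis by simp
qed


text \<open>For \<open>A \<subseteq> B\<close> this is the length of \<open>B / A\<close>, by the correspondence between submodules of the
  quotient and intermediate submodules.\<close>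

definition relative_length ::
    "('a, 'm) ring_scheme \<Rightarrow> ('a, 'b, 'c) module_scheme \<Rightarrow> 'b set \<Rightarrow> 'b set \<Rightarrow> enat" where
  "relative_length R M A B = height {N. submodule N R M \<and> A \<subseteq> N \<and> N \<subseteq> B}"

context Module.module
begin

lemma submodule_iff:
  "submodule N R M \<longleftrightarrow> N \<subseteq> carrier M \<and> \<zero>\<^bsub>M\<^esub> \<in> N \<and>
     (\<forall>x\<in>N. \<forall>y\<in>N. x \<oplus>\<^bsub>M\<^esub> y \<in> N) \<and> (\<forall>r\<in>carrier R. \<forall>x\<in>N. r \<odot>\<^bsub>M\<^esub> x \<in> N)"
proof
  assume N: "submodule N R M"
  show "N \<subseteq> carrier M \<and> \<zero>\<^bsub>M\<^esub> \<in> N \<and>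
     (\<forall>x\<in>N. \<forall>y\<in>N. x \<oplus>\<^bsub>M\<^esub> y \<in> N) \<and> (\<forall>r\<in>carrier R. \<forall>x\<in>N. r \<odot>\<^bsub>M\<^esub> x \<in> N)"
    using submoduleE[OF N] subgroup.one_closed[OF submodule.axioms(1)[OF N]] by auto
next
  assume N: "N \<subseteq> carrier M \<and> \<zero>\<^bsub>M\<^esub> \<in> N \<and>
     (\<forall>x\<in>N. \<forall>y\<in>N. x \<oplus>\<^bsub>M\<^esub> y \<in> N) \<and> (\<forall>r\<in>carrier R. \<forall>x\<in>N. r \<odot>\<^bsub>M\<^esub> x \<in> N)"
  show "submodule N R M"
  proof (rule submoduleI)
    fix x assume "x \<in> N"
    then have "\<ominus>\<^bsub>M\<^esub> x = (\<ominus> \<one>) \<odot>\<^bsub>M\<^esub> x"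
      using N by (subst smult_l_minus) auto
    then show "\<ominus>\<^bsub>M\<^esub> x \<in> N" using N \<open>x \<in> N\<close> by auto
  qed (use N in auto)
qed

lemma submodule_minus_closed:
  assumes "submodule N R M" "x \<in> N" "y \<in> N"
  shows "x \<ominus>\<^bsub>M\<^esub> y \<in> N"
  using submoduleE[OF assms(1)] assms(2,3) by (simp add: a_minus_def)

lemma zero_submodule: "submodule {\<zero>\<^bsub>M\<^esub>} R M"
  by (auto simp: submodule_iff)

lemma submodule_Int: "\<lbrakk>submodule A R M; submodule B R M\<rbrakk> \<Longrightarrow> submodule (A \<inter> B) R M"
  by (auto simp: submodule_iff)

definition submodule_sum :: "'c set \<Rightarrow> 'c set \<Rightarrow> 'c set" where
  "submodule_sum A B = {a \<oplus>\<^bsub>M\<^esub> b |a b. a \<in> A \<and> b \<in> B}"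

lemma submodule_sumI: "\<lbrakk>a \<in> A; b \<in> B\<rbrakk> \<Longrightarrow> a \<oplus>\<^bsub>M\<^esub> b \<in> submodule_sum A B"
  by (auto simp: submodule_sum_def)

lemma submodule_submodule_sum:
  assumes A: "submodule A R M" and B: "submodule B R M"
  shows "submodule (submodule_sum A B) R M"
  unfolding submodule_iff
proof (intro conjI ballI)
  have c: "A \<subseteq> carrier M" "B \<subseteq> carrier M" "\<zero>\<^bsub>M\<^esub> \<in> A" "\<zero>\<^bsub>M\<^esub> \<in> B"
    using A B by (auto simp: submodule_iff)
  show "submodule_sum A B \<subseteq> carrier M" using c by (auto simp: submodule_sum_def)
  show "\<zero>\<^bsub>M\<^esub> \<in> submodule_sum A B" using submodule_sumI[OF c(3,4)] by simp
next
  fix x y assume "x \<in> submodule_sum A B" "y \<in> submodule_sum A B"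
  then obtain a b a' b' where
    *: "x = a \<oplus>\<^bsub>M\<^esub> b" "y = a' \<oplus>\<^bsub>M\<^esub> b'" "a \<in> A" "b \<in> B" "a' \<in> A" "b' \<in> B"
    by (auto simp: submodule_sum_def)
  then have "a \<in> carrier M" "a' \<in> carrier M" "b \<in> carrier M" "b' \<in> carrier M"
    using A B by (auto simp: submodule_iff)
  then have "x \<oplus>\<^bsub>M\<^esub> y = (a \<oplus>\<^bsub>M\<^esub> a') \<oplus>\<^bsub>M\<^esub> (b \<oplus>\<^bsub>M\<^esub> b')"
    using * by (simp add: M.a_ac)
  moreover have "a \<oplus>\<^bsub>M\<^esub> a' \<in> A" "b \<oplus>\<^bsub>M\<^esub> b' \<in> B" using * A B by (auto simp: submodule_iff)
  ultimately show "x \<oplus>\<^bsub>M\<^esub> y \<in> submodule_sum A B" by (auto intro: submodule_sumI)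
next
  fix r x assume r: "r \<in> carrier R" and "x \<in> submodule_sum A B"
  then obtain a b where *: "x = a \<oplus>\<^bsub>M\<^esub> b" "a \<in> A" "b \<in> B"
    by (auto simp: submodule_sum_def)
  then have "a \<in> carrier M" "b \<in> carrier M" using A B by (auto simp: submodule_iff)
  then have "r \<odot>\<^bsub>M\<^esub> x = r \<odot>\<^bsub>M\<^esub> a \<oplus>\<^bsub>M\<^esub> r \<odot>\<^bsub>M\<^esub> b"
    using * r by (simp add: smult_r_distr)
  moreover have "r \<odot>\<^bsub>M\<^esub> a \<in> A" "r \<odot>\<^bsub>M\<^esub> b \<in> B" using * r A B by (auto simp: submodule_iff)
  ultimately show "r \<odot>\<^bsub>M\<^esub> x \<in> submodule_sum A B" by (auto intro: submodule_sumI)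
qed

lemma submodule_sum_upper1:
  assumes "submodule A R M" "submodule B R M"
  shows "A \<subseteq> submodule_sum A B"
proof
  fix x assume "x \<in> A"
  then have "x \<oplus>\<^bsub>M\<^esub> \<zero>\<^bsub>M\<^esub> \<in> submodule_sum A B"
    using assms by (intro submodule_sumI) (auto simp: submodule_iff)
  then show "x \<in> submodule_sum A B" using \<open>x \<in> A\<close> assms by (auto simp: submodule_iff)
qed

lemma submodule_sum_upper2:
  assumes "submodule A R M" "submodule B R M"
  shows "B \<subseteq> submodule_sum A B"
proof
  fix x assume "x \<in> B"
  then have "\<zero>\<^bsub>M\<^esub> \<oplus>\<^bsub>M\<^esub> x \<in> submodule_sum A B"
    using assms by (intro submodule_sumI) (auto simp: submodule_iff)
  then show "x \<in> submodule_sum A B" using \<open>x \<in> B\<close> assms by (auto simp: submodule_iff)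
qed

lemma submodule_sum_least:
  assumes "submodule C R M" "A \<subseteq> C" "B \<subseteq> C"
  shows "submodule_sum A B \<subseteq> C"
  using assms submoduleE(5)[OF assms(1)] by (auto simp: submodule_sum_def)

text \<open>The modular law in the form in which it makes length additive: when \<open>X\<close> grows strictly to \<open>Y\<close>,
  then \<open>X \<inter> B\<close> or \<open>X + B\<close> must grow strictly as well.\<close>

lemma submodule_eqI:
  assumes X: "submodule X R M" and Y: "submodule Y R M" and B: "submodule B R M"
    and "X \<subseteq> Y" and Int: "Y \<inter> B \<subseteq> X \<inter> B" and sum: "submodule_sum Y B \<subseteq> submodule_sum X B"
  shows "X = Y"
proof
  show "Y \<subseteq> X"
  proof
    fix y assume y: "y \<in> Y"
    then have "y \<in> submodule_sum X B" using submodule_sum_upper1[OF Y B] sum by auto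
    then obtain x b where xb: "y = x \<oplus>\<^bsub>M\<^esub> b" "x \<in> X" "b \<in> B" by (auto simp: submodule_sum_def)
    have c: "x \<in> carrier M" "b \<in> carrier M" using xb X B by (auto simp: submodule_iff)
    have b: "b = y \<ominus>\<^bsub>M\<^esub> x" using xb c by (metis M.add.m_comm M.minus_eq M.add.inv_solve_right M.a_closed)
    have "b \<in> Y" unfolding b using submodule_minus_closed[OF Y y] xb \<open>X \<subseteq> Y\<close> by blast
    then have "b \<in> X" using Int xb by auto
    then show "y \<in> X" using xb X by (auto simp: submodule_iff)
  qed
qed fact

lemma relative_length_mono:
  assumes "A' \<subseteq> A" "B \<subseteq> B'"
  shows "relative_length R M A B \<le> relative_length R M A' B'"
  unfolding relative_length_def using assms by (intro height_mono) auto

lemma relative_length_refl: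
  assumes "submodule A R M"
  shows "relative_length R M A A = 0"
proof -
  have "{N. submodule N R M \<and> A \<subseteq> N \<and> N \<subseteq> A} = {A}" using assms by auto
  then show ?thesis by (simp add: relative_length_def height_singleton)
qed

lemma enat_le_relative_length_iff:
  assumes "submodule A R M" "A \<subseteq> B"
  shows "enat k \<le> relative_length R M A B \<longleftrightarrow>
    chain_of_length {N. submodule N R M \<and> A \<subseteq> N \<and> N \<subseteq> B} k"
  unfolding relative_length_def by (rule enat_le_height_iff) (use assms in auto)

text \<open>A longest chain from \<open>A\<close> to \<open>B\<close> followed by one from \<open>B\<close> to \<open>C\<close> is a chain from \<open>A\<close> to \<open>C\<close>.\<close>

lemma relative_length_superadditive:
  assumes A: "submodule A R M" and B: "submodule B R M" and "A \<subseteq> B" "B \<subseteq> C"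
  shows "relative_length R M A B + relative_length R M B C \<le> relative_length R M A C"
proof (cases "relative_length R M A C")
  case (enat m)
  have "relative_length R M A B \<le> enat m" "relative_length R M B C \<le> enat m"
    using relative_length_mono[of A A B C] relative_length_mono[of A B C C] assms(3,4)
    by (simp_all add: enat)
  then obtain k l where k: "relative_length R M A B = enat k" and l: "relative_length R M B C = enat l"
    by (meson enat_ile)
  have "chain_of_length {N. submodule N R M \<and> A \<subseteq> N \<and> N \<subseteq> B} k"
    using enat_le_relative_length_iff[OF A \<open>A \<subseteq> B\<close>, of k] k by simp
  then obtain N where N: "\<And>i. i \<le> k \<Longrightarrow> submodule (N i) R M \<and> A \<subseteq> N i \<and> N i \<subseteq> B"
      "\<And>i. i < k \<Longrightarrow> N i \<subset> N (Suc i)"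
    unfolding chain_of_length_def by auto
  have "chain_of_length {N. submodule N R M \<and> B \<subseteq> N \<and> N \<subseteq> C} l"
    using enat_le_relative_length_iff[OF B \<open>B \<subseteq> C\<close>, of l] l by simp
  then obtain P where P: "\<And>i. i \<le> l \<Longrightarrow> submodule (P i) R M \<and> B \<subseteq> P i \<and> P i \<subseteq> C"
      "\<And>i. i < l \<Longrightarrow> P i \<subset> P (Suc i)"
    unfolding chain_of_length_def by auto
  define Q where "Q i = (if i \<le> k then N i else P (i - k))" for i
  have "chain_of_length {N. submodule N R M \<and> A \<subseteq> N \<and> N \<subseteq> C} (k + l)"
    unfolding chain_of_length_def
  proof (intro exI[of _ Q] conjI allI impI)
    fix i assume "i \<le> k + l"
    then have "i - k \<le> l" by simp
    then show "Q i \<in> {N. submodule N R M \<and> A \<subseteq> N \<and> N \<subseteq> C}"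
      using N(1)[of i] P(1)[of "i - k"] assms(3,4) by (simp add: Q_def) blast
  next
    fix i assume i: "i < k + l"
    consider "i < k" | "i = k" | "i > k" by linarith
    then show "Q i \<subset> Q (Suc i)"
    proof cases
      case 1
      then show ?thesis using N(2)[of i] by (simp add: Q_def)
    next
      case 2
      then show ?thesis using N(1)[of k] P(1)[of 0] P(2)[of 0] i by (auto simp: Q_def)
    next
      case 3
      then show ?thesis using P(2)[of "i - k"] i by (simp add: Q_def Suc_diff_le)
    qed
  qed
  then show ?thesis
    using enat_le_relative_length_iff[OF A, of C "k + l"] assms(3,4) k l by simp
qed simp

lemma one_le_relative_length:
  assumes "submodule A R M" "submodule B R M" "A \<subset> B"
  shows "1 \<le> relative_length R M A B"
proof -
  have "chain_of_length {N. submodule N R M \<and> A \<subseteq> N \<and> N \<subseteq> B} 1"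
    unfolding chain_of_length_def
    by (rule exI[of _ "\<lambda>i. if i = 0 then A else B"]) (use assms in auto)
  then show ?thesis
    using enat_le_relative_length_iff[of A B 1] assms by (simp add: one_enat_def)
qed

lemma relative_length_strict_step:
  assumes A: "submodule A R M" and X: "submodule X R M" and Y: "submodule Y R M"
    and "A \<subseteq> X" "X \<subset> Y"
  shows "relative_length R M A X + 1 \<le> relative_length R M A Y"
proof -
  have "relative_length R M A X + 1 \<le> relative_length R M A X + relative_length R M X Y"
    using one_le_relative_length[OF X Y \<open>X \<subset> Y\<close>] by (simp add: add_left_mono)
  also have "\<dots> \<le> relative_length R M A Y"
    using relative_length_superadditive[OF A X \<open>A \<subseteq> X\<close>, of Y] \<open>X \<subset> Y\<close> by auto
  finally show ?thesis .
qed

text \<open>Along a chain from \<open>A\<close> to \<open>C\<close>, intersecting with \<open>B\<close> and adding \<open>B\<close> give two chains with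
  repetitions, one below and one above \<open>B\<close>.  By the modular law each step is strict in at least one
  of them.\<close>

lemma relative_length_subadditive:
  assumes A: "submodule A R M" and B: "submodule B R M" and C: "submodule C R M"
    and AB: "A \<subseteq> B" and BC: "B \<subseteq> C"
  shows "relative_length R M A C \<le> relative_length R M A B + relative_length R M B C"
  unfolding relative_length_def[of R M A C] height_def
proof (rule SUP_least)
  fix l assume "l \<in> {l. chain_of_length {N. submodule N R M \<and> A \<subseteq> N \<and> N \<subseteq> C} l}"
  then obtain N where N: "\<And>i. i \<le> l \<Longrightarrow> submodule (N i) R M \<and> A \<subseteq> N i \<and> N i \<subseteq> C"
      "\<And>i. i < l \<Longrightarrow> N i \<subset> N (Suc i)"
    unfolding chain_of_length_def by auto
  have "enat i \<le> relative_length R M A (N i \<inter> B) + relative_length R M B (submodule_sum (N i) B)"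
    if "i \<le> l" for i
    using that
  proof (induction i)
    case (Suc i)
    let ?X = "N i" and ?Y = "N (Suc i)"
    have X: "submodule ?X R M" and Y: "submodule ?Y R M" and XY: "?X \<subset> ?Y" and AX: "A \<subseteq> ?X"
      using N Suc.prems by auto
    let ?x = "relative_length R M A (?X \<inter> B)" and ?x' = "relative_length R M B (submodule_sum ?X B)"
    let ?y = "relative_length R M A (?Y \<inter> B)" and ?y' = "relative_length R M B (submodule_sum ?Y B)"
    have Int: "?X \<inter> B \<subseteq> ?Y \<inter> B" using XY by auto
    have sum: "submodule_sum ?X B \<subseteq> submodule_sum ?Y B" using XY by (auto simp: submodule_sum_def)
    have le: "?x \<le> ?y" "?x' \<le> ?y'"
      using Int sum by (auto intro!: relative_length_mono)
    have "?X \<inter> B \<subset> ?Y \<inter> B \<or> submodule_sum ?X B \<subset> submodule_sum ?Y B"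
      using submodule_eqI[OF X Y B] XY Int sum by blast
    then have "?x + 1 \<le> ?y \<or> ?x' + 1 \<le> ?y'"
    proof
      assume "?X \<inter> B \<subset> ?Y \<inter> B"
      then show ?thesis
        using relative_length_strict_step[OF A submodule_Int[OF X B] submodule_Int[OF Y B]] AX AB by auto
    next
      assume "submodule_sum ?X B \<subset> submodule_sum ?Y B"
      then show ?thesis
        using relative_length_strict_step[OF B submodule_submodule_sum[OF X B] submodule_submodule_sum[OF Y B]]
          submodule_sum_upper2[OF X B] by auto
    qed
    then have "?x + ?x' + 1 \<le> ?y + ?y'"
    proof
      assume "?x + 1 \<le> ?y"
      from add_mono[OF this le(2)] show ?thesis by (simp add: ac_simps)
    next
      assume "?x' + 1 \<le> ?y'"
      from add_mono[OF le(1) this] show ?thesis by (simp add: ac_simps)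
    qed
    moreover have "enat (Suc i) \<le> ?x + ?x' + 1"
      using add_right_mono[OF Suc.IH, of 1] Suc.prems by (simp add: one_enat_def)
    ultimately show ?case by (rule order_trans[rotated])
  qed (simp add: zero_enat_def[symmetric])
  from this[of l] have "enat l \<le> relative_length R M A (N l \<inter> B) + relative_length R M B (submodule_sum (N l) B)"
    by simp
  also have "\<dots> \<le> relative_length R M A B + relative_length R M B C"
    using submodule_sum_least[OF C, of "N l" B] N(1)[of l] BC
    by (intro add_mono relative_length_mono) auto
  finally show "enat l \<le> relative_length R M A B + relative_length R M B C" .
qed

lemma relative_length_add:
  assumes "submodule A R M" "submodule B R M" "submodule C R M" "A \<subseteq> B" "B \<subseteq> C"
  shows "relative_length R M A C = relative_length R M A B + relative_length R M B C"
  using assms by (intro antisym relative_length_subadditive relative_length_superadditive)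

lemma relative_length_le_1:
  assumes A: "submodule A R M" and "A \<subseteq> B"
    and cover: "\<And>N. \<lbrakk>submodule N R M; A \<subset> N; N \<subseteq> B\<rbrakk> \<Longrightarrow> B \<subseteq> N"
  shows "relative_length R M A B \<le> 1"
proof (rule ccontr)
  assume "\<not> ?thesis"
  then have "enat 2 \<le> relative_length R M A B"
    by (cases "relative_length R M A B") (simp_all add: one_enat_def)
  then obtain N :: "nat \<Rightarrow> 'c set" where N: "\<And>i. i \<le> 2 \<Longrightarrow> submodule (N i) R M \<and> A \<subseteq> N i \<and> N i \<subseteq> B"
      "\<And>i. i < 2 \<Longrightarrow> N i \<subset> N (Suc i)"
    using enat_le_relative_length_iff[OF A \<open>A \<subseteq> B\<close>, of 2] unfolding chain_of_length_def by auto
  have "N 0 \<subset> N 1" "N 1 \<subset> N 2" using N(2)[of 0] N(2)[of 1] by (auto simp: numeral_2_eq_2)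
  then show False using cover[of "N 1"] N(1)[of 0] N(1)[of 1] N(1)[of 2] by auto
qed

lemma submodule_of_submodule_iff:
  assumes "submodule D R M"
  shows "submodule N R (M\<lparr>carrier := D\<rparr>) \<longleftrightarrow> submodule N R M \<and> N \<subseteq> D"
proof -
  interpret D: Module.module R "M\<lparr>carrier := D\<rparr>"
    by (rule submodule.submodule_is_module[OF assms]) (rule module_axioms)
  show ?thesis using assms unfolding D.submodule_iff submodule_iff by auto
qed

lemma module_length_submodule:
  assumes "submodule D R M"
  shows "module_length R (M\<lparr>carrier := D\<rparr>) = relative_length R M {\<zero>\<^bsub>M\<^esub>} D"
proof -
  have "{N. submodule N R (M\<lparr>carrier := D\<rparr>)} = {N. submodule N R M \<and> {\<zero>\<^bsub>M\<^esub>} \<subseteq> N \<and> N \<subseteq> D}"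
    using submodule_of_submodule_iff[OF assms] by (auto simp: submodule_iff)
  then show ?thesis by (simp add: module_length_eq_height relative_length_def)
qed

end


section \<open>Artinian local rings have finite length\<close>

text \<open>A ring as a module over itself.  Its submodules are the ideals, so the length theory of modules
  applies to them.\<close>

definition regular_module :: "('a, 'm) ring_scheme \<Rightarrow> ('a, 'a) module" where
  "regular_module R =
    \<lparr>carrier = carrier R, mult = mult R, one = one R, zero = zero R, add = add R, smult = mult R\<rparr>"

lemma regular_module_simps [simp]:
  "carrier (regular_module R) = carrier R" "zero (regular_module R) = zero R"
  "add (regular_module R) = add R" "smult (regular_module R) = mult R"
  by (simp_all add: regular_module_def)

lemma regular_module_minus [simp]:
  "x \<ominus>\<^bsub>regular_module R\<^esub> y = x \<ominus>\<^bsub>R\<^esub> y"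
  by (simp add: a_minus_def a_inv_def m_inv_def)

lemma (in cring) regular_module: "Module.module R (regular_module R)"
proof (rule moduleI)
  show "abelian_group (regular_module R)"
    by (rule abelian_groupI) (auto simp: a_ac intro: bexI[of _ "\<ominus> _"] l_neg)
qed (auto simp: l_distr r_distr m_assoc is_cring)

lemma (in cring) ideal_iff:
  "ideal I R \<longleftrightarrow> I \<subseteq> carrier R \<and> \<zero> \<in> I \<and>
     (\<forall>x\<in>I. \<forall>y\<in>I. x \<oplus> y \<in> I) \<and> (\<forall>r\<in>carrier R. \<forall>x\<in>I. r \<otimes> x \<in> I)"
proof
  assume "ideal I R"
  then interpret ideal I R .
  show "I \<subseteq> carrier R \<and> \<zero> \<in> I \<and>
     (\<forall>x\<in>I. \<forall>y\<in>I. x \<oplus> y \<in> I) \<and> (\<forall>r\<in>carrier R. \<forall>x\<in>I. r \<otimes> x \<in> I)"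
    using a_subset I_l_closed by auto
next
  assume I: "I \<subseteq> carrier R \<and> \<zero> \<in> I \<and>
     (\<forall>x\<in>I. \<forall>y\<in>I. x \<oplus> y \<in> I) \<and> (\<forall>r\<in>carrier R. \<forall>x\<in>I. r \<otimes> x \<in> I)"
  show "ideal I R"
  proof (rule idealI)
    show "subgroup I (add_monoid R)"
    proof (rule add.subgroupI)
      fix x assume x: "x \<in> I"
      then have "\<ominus> x = (\<ominus> \<one>) \<otimes> x" using I by (simp add: l_minus subset_iff)
      then show "\<ominus> x \<in> I" using I x by simp
    qed (use I in auto)
  next
    fix a x assume a: "a \<in> I" and x: "x \<in> carrier R"
    then show "x \<otimes> a \<in> I" using I by auto
    then show "a \<otimes> x \<in> I" using a x I m_comm[of a x] by auto
  qed (rule ring_axioms)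
qed

lemma (in cring) submodule_regular_module_iff: "submodule I R (regular_module R) \<longleftrightarrow> ideal I R"
proof -
  interpret reg: Module.module R "regular_module R" by (rule regular_module)
  show ?thesis by (simp add: reg.submodule_iff ideal_iff)
qed


context local_artinian_ring
begin

lemma minimal_idealE:
  assumes "ideal I R" "P I"
  obtains J where "ideal J R" "P J" "\<And>J'. \<lbrakk>ideal J' R; J' \<subset> J\<rbrakk> \<Longrightarrow> \<not> P J'"
proof -
  have "wf {(J', J). ideal J' R \<and> ideal J R \<and> J' \<subset> J}" (is "wf ?r")
    unfolding wf_iff_no_infinite_down_chain
  proof
    assume "\<exists>f. \<forall>i. (f (Suc i), f i) \<in> ?r"
    then obtain f where "\<forall>i. (f (Suc i), f i) \<in> ?r" by blast
    then have f: "\<And>i. ideal (f i) R" "\<And>i. f (Suc i) \<subset> f i" by auto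
    have "\<exists>k. \<forall>l\<ge>k. f l = f k"
      by (rule descending_chain) (use f in auto)
    then obtain k where "f (Suc k) = f k" by (meson le_SucI order_refl)
    with f(2)[of k] show False by simp
  qed
  from this[unfolded wf_eq_minimal, rule_format, of I "{J. ideal J R \<and> P J}"] assms
  obtain J where "J \<in> {J. ideal J R \<and> P J}"
      "\<forall>J'. (J', J) \<in> ?r \<longrightarrow> J' \<notin> {J. ideal J R \<and> P J}" by blast
  then show thesis by (intro that) auto
qed

text \<open>The descending chain condition for the principal ideals \<open>(a\<^sup>k)\<close>.  It replaces the existence of
  an inverse: \<open>a t\<close> acts as the identity on the multiples of \<open>a\<^sup>k\<close>.\<close>

lemma power_stabilizes:
  assumes a: "a \<in> carrier R"
  obtains k t where "t \<in> carrier R" "a [^] (k::nat) = a [^] k \<otimes> (a \<otimes> t)"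
proof -
  define I where "I k = {a [^] k \<otimes> t |t. t \<in> carrier R}" for k :: nat
  have "ideal (I k) R" for k
    unfolding ideal_iff
  proof (intro conjI ballI)
    show "I k \<subseteq> carrier R" using a by (auto simp: I_def)
    show "\<zero> \<in> I k" using a by (auto simp: I_def intro!: exI[of _ \<zero>])
  next
    fix x y assume "x \<in> I k" "y \<in> I k"
    then show "x \<oplus> y \<in> I k" using a by (auto simp: I_def) (metis add.m_closed nat_pow_closed r_distr)
  next
    fix r x assume "r \<in> carrier R" "x \<in> I k"
    then show "r \<otimes> x \<in> I k" using a by (auto simp: I_def) (metis m_closed m_lcomm nat_pow_closed)
  qed
  moreover have "I (Suc k) \<subseteq> I k" for k
    using a by (auto simp: I_def) (metis m_assoc m_closed nat_pow_closed)
  ultimately have "\<exists>k. \<forall>l\<ge>k. I l = I k" by (rule descending_chain)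
  then obtain k where "I (Suc k) = I k" by (meson le_SucI order_refl)
  moreover have "a [^] k \<in> I k" using a by (auto simp: I_def intro!: exI[of _ \<one>])
  ultimately obtain t where "t \<in> carrier R" "a [^] k = a [^] Suc k \<otimes> t" by (auto simp: I_def)
  then show thesis using a by (intro that[of t k]) (auto simp: m_assoc)
qed

interpretation reg: Module.module R "regular_module R" by (rule regular_module)

abbreviation "rlen \<equiv> relative_length R (regular_module R)"

lemma mult_image_ideal:
  assumes a: "a \<in> carrier R" and I: "ideal I R"
  shows "ideal ((\<lambda>x. a \<otimes> x) ` I) R"
  unfolding ideal_iff
proof (intro conjI ballI)
  have c: "I \<subseteq> carrier R" "\<zero> \<in> I" "\<And>x y. \<lbrakk>x \<in> I; y \<in> I\<rbrakk> \<Longrightarrow> x \<oplus> y \<in> I"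
      "\<And>r x. \<lbrakk>r \<in> carrier R; x \<in> I\<rbrakk> \<Longrightarrow> r \<otimes> x \<in> I"
    using I by (auto simp: ideal_iff)
  show "(\<lambda>x. a \<otimes> x) ` I \<subseteq> carrier R" using a c by auto
  show "\<zero> \<in> (\<lambda>x. a \<otimes> x) ` I" using a c(2) by (auto intro!: image_eqI[of _ _ \<zero>])
  show "x \<oplus> y \<in> (\<lambda>x. a \<otimes> x) ` I" if xy: "x \<in> (\<lambda>x. a \<otimes> x) ` I" "y \<in> (\<lambda>x. a \<otimes> x) ` I" for x y
  proof -
    obtain x' y' where "x = a \<otimes> x'" "y = a \<otimes> y'" "x' \<in> I" "y' \<in> I" using xy by blast
    then show ?thesis using a c
      by (intro image_eqI[of _ _ "x' \<oplus> y'"]) (auto simp: r_distr subset_iff)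
  qed
  show "r \<otimes> x \<in> (\<lambda>x. a \<otimes> x) ` I" if r: "r \<in> carrier R" and x: "x \<in> (\<lambda>x. a \<otimes> x) ` I" for r x
  proof -
    obtain x' where "x = a \<otimes> x'" "x' \<in> I" using x by auto
    then show ?thesis using a c r
      by (intro image_eqI[of _ _ "r \<otimes> x'"]) (auto simp: m_lcomm subset_iff)
  qed
qed

lemma kernel_ideal:
  assumes a: "a \<in> carrier R" and I: "ideal I R"
  shows "ideal {x \<in> I. a \<otimes> x = \<zero>} R"
proof -
  have "a \<otimes> (r \<otimes> x) = \<zero>" if "x \<in> carrier R" "r \<in> carrier R" "a \<otimes> x = \<zero>" for r x
    using m_lcomm[OF a that(2,1)] that by simp
  then show ?thesis using a I by (auto simp: ideal_iff r_distr subset_iff)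
qed

text \<open>Multiplication by \<open>a\<close> embeds \<open>I\<close>, modulo its kernel, into \<open>a I\<close>: intermediate ideals are
  determined by their images.\<close>

lemma rlen_kernel_le:
  assumes a: "a \<in> carrier R" and I: "ideal I R"
  shows "rlen {x \<in> I. a \<otimes> x = \<zero>} I \<le> rlen {\<zero>} ((\<lambda>x. a \<otimes> x) ` I)"
  unfolding relative_length_def submodule_regular_module_iff
proof (rule height_le_if_strict_mono[where f = "\<lambda>X. (\<lambda>x. a \<otimes> x) ` X"])
  fix X assume "X \<in> {N. ideal N R \<and> {x \<in> I. a \<otimes> x = \<zero>} \<subseteq> N \<and> N \<subseteq> I}"
  then show "(\<lambda>x. a \<otimes> x) ` X \<in> {N. ideal N R \<and> {\<zero>} \<subseteq> N \<and> N \<subseteq> (\<lambda>x. a \<otimes> x) ` I}"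
    using mult_image_ideal[OF a] by (auto simp: ideal_iff)
next
  fix X Y
  assume "X \<in> {N. ideal N R \<and> {x \<in> I. a \<otimes> x = \<zero>} \<subseteq> N \<and> N \<subseteq> I}"
    and "Y \<in> {N. ideal N R \<and> {x \<in> I. a \<otimes> x = \<zero>} \<subseteq> N \<and> N \<subseteq> I}" and XY: "X \<subset> Y"
  then have X: "ideal X R" and Y: "ideal Y R" and KX: "{x \<in> I. a \<otimes> x = \<zero>} \<subseteq> X" and YI: "Y \<subseteq> I"
    by auto
  have sub: "I \<subseteq> carrier R" using I by (auto simp: ideal_iff)
  have "Y \<subseteq> X" if eq: "(\<lambda>x. a \<otimes> x) ` Y \<subseteq> (\<lambda>x. a \<otimes> x) ` X"
  proof
    fix y assume y: "y \<in> Y"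
    then obtain x where x: "x \<in> X" "a \<otimes> y = a \<otimes> x" using eq by auto
    have c: "x \<in> carrier R" "y \<in> carrier R" using x y XY YI sub by auto
    have "y \<ominus> x \<in> Y" using x y XY Y reg.submodule_minus_closed[of Y y x]
      by (simp add: submodule_regular_module_iff subset_iff psubset_eq)
    moreover have "a \<otimes> (y \<ominus> x) = \<zero>"
      using a c x by (simp add: a_minus_def r_distr r_minus r_neg)
    ultimately have "y \<ominus> x \<in> X" using KX YI by auto
    then have "(y \<ominus> x) \<oplus> x \<in> X" using x X by (auto simp: ideal_iff)
    then show "y \<in> X" using c by (simp add: a_minus_def a_assoc l_neg)
  qed
  then show "(\<lambda>x. a \<otimes> x) ` X \<subset> (\<lambda>x. a \<otimes> x) ` Y" using XY by auto
qed

text \<open>By Zorn's lemma: a chain of ideals that avoid \<open>x\<close> has a union that avoids \<open>x\<close>.\<close>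

lemma ideal_avoiding_maximal:
  assumes I: "ideal I R" and x: "x \<in> I" "x \<noteq> \<zero>"
  obtains N where "ideal N R" "N \<subseteq> I" "x \<notin> N"
    "\<And>N'. \<lbrakk>ideal N' R; N \<subset> N'; N' \<subseteq> I\<rbrakk> \<Longrightarrow> x \<in> N'"
proof -
  let ?A = "{N. ideal N R \<and> N \<subseteq> I \<and> x \<notin> N}"
  have "\<exists>N\<in>?A. \<forall>X\<in>?A. N \<subseteq> X \<longrightarrow> X = N"
  proof (rule subset_Zorn_nonempty)
    have "{\<zero>} \<in> ?A" using zeroideal I x by (auto simp: ideal_iff)
    then show "?A \<noteq> {}" by blast
  next
    fix \<C> assume ne: "\<C> \<noteq> {}" and "subset.chain ?A \<C>"
    then have C: "\<C> \<subseteq> ?A" and chain: "\<And>X Y. \<lbrakk>X \<in> \<C>; Y \<in> \<C>\<rbrakk> \<Longrightarrow> X \<subseteq> Y \<or> Y \<subseteq> X"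
      by (auto simp: subset_chain_def)
    have id: "ideal X R" "X \<subseteq> I" "x \<notin> X" if "X \<in> \<C>" for X using C that by auto
    have "ideal (\<Union>\<C>) R"
      unfolding ideal_iff
    proof (intro conjI ballI)
      show "\<Union>\<C> \<subseteq> carrier R" using id(2) I unfolding ideal_iff by blast
      show "\<zero> \<in> \<Union>\<C>" using ne id(1) unfolding ideal_iff by blast
    next
      fix u v assume "u \<in> \<Union>\<C>" "v \<in> \<Union>\<C>"
      then obtain X Y where "X \<in> \<C>" "Y \<in> \<C>" "u \<in> X" "v \<in> Y" by blast
      then obtain Z where "Z \<in> \<C>" "u \<in> Z" "v \<in> Z" using chain[of X Y] by blast
      then show "u \<oplus> v \<in> \<Union>\<C>" using id(1)[of Z] unfolding ideal_iff by blast
    next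
      fix r u assume "r \<in> carrier R" "u \<in> \<Union>\<C>"
      then show "r \<otimes> u \<in> \<Union>\<C>" using id(1) unfolding ideal_iff by blast
    qed
    then show "\<Union>\<C> \<in> ?A" using id by blast
  qed
  then obtain N where N: "N \<in> ?A" "\<forall>X\<in>?A. N \<subseteq> X \<longrightarrow> X = N" by blast
  show thesis
  proof (rule that)
    show "x \<in> N'" if "ideal N' R" "N \<subset> N'" "N' \<subseteq> I" for N' using N that by blast
  qed (use N in auto)
qed

lemma cyclic_sum_ideal:
  assumes N: "ideal N R" and y: "y \<in> carrier R"
  shows "ideal {u \<oplus> r \<otimes> y |u r. u \<in> N \<and> r \<in> carrier R} R" (is "ideal ?J R")
  unfolding ideal_iff
proof (intro conjI ballI)
  have c: "N \<subseteq> carrier R" "\<zero> \<in> N" "\<And>x y. \<lbrakk>x \<in> N; y \<in> N\<rbrakk> \<Longrightarrow> x \<oplus> y \<in> N"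
      "\<And>r x. \<lbrakk>r \<in> carrier R; x \<in> N\<rbrakk> \<Longrightarrow> r \<otimes> x \<in> N"
    using N by (auto simp: ideal_iff)
  show "?J \<subseteq> carrier R" using c y by auto
  have "\<zero> = \<zero> \<oplus> \<zero> \<otimes> y" using y by simp
  then show "\<zero> \<in> ?J" using c(2) by blast
  show "v \<oplus> w \<in> ?J" if vw: "v \<in> ?J" "w \<in> ?J" for v w
  proof -
    obtain u r u' r' where *: "v = u \<oplus> r \<otimes> y" "w = u' \<oplus> r' \<otimes> y" "u \<in> N" "u' \<in> N"
      "r \<in> carrier R" "r' \<in> carrier R" using vw by auto
    then have "u \<in> carrier R" "u' \<in> carrier R" using c by auto
    then have "v \<oplus> w = (u \<oplus> u') \<oplus> (r \<oplus> r') \<otimes> y" using * y by (simp add: l_distr a_ac)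
    moreover have "u \<oplus> u' \<in> N" "r \<oplus> r' \<in> carrier R" using * c by auto
    ultimately show ?thesis by blast
  qed
  show "s \<otimes> v \<in> ?J" if s: "s \<in> carrier R" and v: "v \<in> ?J" for s v
  proof -
    obtain u r where *: "v = u \<oplus> r \<otimes> y" "u \<in> N" "r \<in> carrier R" using v by auto
    then have "u \<in> carrier R" using c by auto
    then have "s \<otimes> v = s \<otimes> u \<oplus> (s \<otimes> r) \<otimes> y" using * y s by (simp add: r_distr m_assoc)
    moreover have "s \<otimes> u \<in> N" "s \<otimes> r \<in> carrier R" using * c s by auto
    ultimately show ?thesis by blast
  qed
qed

text \<open>Otherwise there is an ideal \<open>I\<close> that is minimal among those of infinite length.  For an element \<open>a\<close>
  either \<open>a I = I\<close>, or \<open>a I\<close> has finite length; then the kernel of \<open>a\<close> on \<open>I\<close> has infinite length,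
  so it is \<open>I\<close> and \<open>a I = 0\<close>.  Now choose \<open>x \<noteq> 0\<close> in \<open>I\<close> and an ideal \<open>N\<close> in \<open>I\<close> that is maximal
  among those without \<open>x\<close>.  The elements that do not kill \<open>I\<close> act on it invertibly, so \<open>I\<close> behaves
  like a vector space and \<open>I / N\<close> has length at most one.  But \<open>N\<close> has finite length by
  minimality, hence so has \<open>I\<close>.\<close>

theorem finite_length: "rlen {\<zero>} (carrier R) < \<infinity>"
proof (rule ccontr)
  assume "\<not> ?thesis"
  then have "rlen {\<zero>} (carrier R) = \<infinity>" by simp
  with oneideal obtain I where I: "ideal I R" and inf: "rlen {\<zero>} I = \<infinity>"
    and min: "\<And>J. \<lbrakk>ideal J R; J \<subset> I\<rbrakk> \<Longrightarrow> rlen {\<zero>} J \<noteq> \<infinity>"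
    by (rule minimal_idealE[where P = "\<lambda>I. rlen {\<zero>} I = \<infinity>"]) blast+
  have IR: "I \<subseteq> carrier R" and I0: "\<zero> \<in> I" using I by (auto simp: ideal_iff)
  have add: "rlen {\<zero>} I = rlen {\<zero>} J + rlen J I" if "ideal J R" "J \<subseteq> I" for J
    using reg.relative_length_add[of "{\<zero>}" J I] that I zeroideal
    by (auto simp: submodule_regular_module_iff ideal_iff)
  have dichotomy: "(\<lambda>x. a \<otimes> x) ` I = I \<or> (\<forall>x\<in>I. a \<otimes> x = \<zero>)" if a: "a \<in> carrier R" for a
  proof (rule disjCI)
    assume "\<not> (\<forall>x\<in>I. a \<otimes> x = \<zero>)"
    then have "{x \<in> I. a \<otimes> x = \<zero>} \<subset> I" by auto
    with min[OF kernel_ideal[OF a I]] have "rlen {\<zero>} {x \<in> I. a \<otimes> x = \<zero>} \<noteq> \<infinity>" by simp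
    then have "rlen {x \<in> I. a \<otimes> x = \<zero>} I = \<infinity>"
      using add[OF kernel_ideal[OF a I]] inf plus_eq_infty_iff_enat by force
    then have "rlen {\<zero>} ((\<lambda>x. a \<otimes> x) ` I) = \<infinity>" using rlen_kernel_le[OF a I] by simp
    moreover have "(\<lambda>x. a \<otimes> x) ` I \<subseteq> I" using I a by (auto simp: ideal_iff)
    ultimately show "(\<lambda>x. a \<otimes> x) ` I = I" using min[OF mult_image_ideal[OF a I]] by blast
  qed
  have "I \<noteq> {\<zero>}"
    using inf reg.relative_length_refl[of "{\<zero>}"] zeroideal by (auto simp: submodule_regular_module_iff)
  then obtain x where x: "x \<in> I" "x \<noteq> \<zero>" using I0 by auto
  obtain N where N: "ideal N R" "N \<subseteq> I" "x \<notin> N"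
    and max: "\<And>N'. \<lbrakk>ideal N' R; N \<subset> N'; N' \<subseteq> I\<rbrakk> \<Longrightarrow> x \<in> N'"
    using ideal_avoiding_maximal[OF I x] by blast
  have NR: "N \<subseteq> carrier R" and N0: "\<zero> \<in> N" using N by (auto simp: ideal_iff)
  have cover: "I \<subseteq> N'" if N': "ideal N' R" "N \<subset> N'" "N' \<subseteq> I" for N'
  proof
    fix y assume y: "y \<in> I"
    have yR: "y \<in> carrier R" using y IR by auto
    have xN': "x \<in> N'" by (rule max[OF N'])
    show "y \<in> N'"
    proof (cases "y \<in> N")
      case True then show ?thesis using N' by auto
    next
      case False
      let ?J = "{u \<oplus> r \<otimes> y |u r. u \<in> N \<and> r \<in> carrier R}"
      have "x \<in> ?J"
      proof (rule max)
        show "ideal ?J R" by (rule cyclic_sum_ideal[OF N(1) yR])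
        have "u \<in> ?J" if "u \<in> N" for u
        proof -
          have "u = u \<oplus> \<zero> \<otimes> y" using yR that NR by auto
          then show ?thesis using that by blast
        qed
        moreover have "y \<in> ?J"
        proof -
          have "y = \<zero> \<oplus> \<one> \<otimes> y" using yR by simp
          then show ?thesis using N0 by blast
        qed
        ultimately show "N \<subset> ?J" using False by blast
        show "?J \<subseteq> I" using N(2) I y by (auto simp: ideal_iff)
      qed
      \<comment> \<open>\<open>N + R y\<close> contains \<open>N\<close> properly, so it contains \<open>x\<close>; solving for \<open>y\<close> gives \<open>y \<in> N + R x\<close>.\<close>
      then obtain u r where ur: "x = u \<oplus> r \<otimes> y" "u \<in> N" "r \<in> carrier R" by auto
      have uR: "u \<in> carrier R" using ur NR by auto
      have "r \<otimes> y \<noteq> \<zero>" using ur N(3) uR by auto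
      then have rI: "(\<lambda>x. r \<otimes> x) ` I = I" using dichotomy[OF ur(3)] y by blast
      obtain k t where t: "t \<in> carrier R" and k: "r [^] (k::nat) = r [^] k \<otimes> (r \<otimes> t)"
        using power_stabilizes[OF ur(3)] by blast
      have "\<exists>z\<in>I. y = r [^] j \<otimes> z" for j :: nat
      proof (induction j)
        case 0 then show ?case using y yR by (intro bexI[of _ y]) auto
      next
        case (Suc j)
        then obtain z where z: "z \<in> I" "y = r [^] j \<otimes> z" by auto
        then obtain z' where "z' \<in> I" "z = r \<otimes> z'" using rI by blast
        then show ?case using z ur IR by (intro bexI[of _ z']) (auto simp: m_assoc)
      qed
      then obtain z where z: "z \<in> I" "y = r [^] k \<otimes> z" by blast
      have zR: "z \<in> carrier R" using z IR by auto
      have "y = r [^] k \<otimes> (r \<otimes> t) \<otimes> z" using z(2) k by metis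
      also have "\<dots> = t \<otimes> (r \<otimes> (r [^] k \<otimes> z))" using ur t zR by (simp add: m_ac)
      also have "\<dots> = t \<otimes> (r \<otimes> y)" using z by simp
      also have "r \<otimes> y = x \<oplus> \<ominus> u" using ur yR uR by (simp add: a_ac r_neg2 r_neg1)
      finally have "y = t \<otimes> (x \<oplus> \<ominus> u)" .
      moreover have "\<ominus> u \<in> N'"
        using additive_subgroup.a_inv_closed[OF ideal.axioms(1)[OF N'(1)], of u] N'(2) ur by auto
      ultimately show ?thesis using xN' N'(1) t by (auto simp: ideal_iff)
    qed
  qed
  have "rlen N I \<le> 1"
    by (rule reg.relative_length_le_1) (use N cover in \<open>auto simp: submodule_regular_module_iff\<close>)
  moreover have "rlen {\<zero>} N \<noteq> \<infinity>" using min[OF N(1)] N x by blast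
  ultimately show False
    using add[OF N(1,2)] inf plus_eq_infty_iff_enat[of "rlen {\<zero>} N" "rlen N I"] by auto
qed

end


lemma power_module_simps [simp]:
  "carrier (power_module R n) = {1..n} \<rightarrow>\<^sub>E carrier R"
  "zero (power_module R n) = (\<lambda>j\<in>{1..n}. \<zero>\<^bsub>R\<^esub>)"
  "v \<oplus>\<^bsub>power_module R n\<^esub> w = (\<lambda>j\<in>{1..n}. v j \<oplus>\<^bsub>R\<^esub> w j)"
  "r \<odot>\<^bsub>power_module R n\<^esub> v = (\<lambda>j\<in>{1..n}. r \<otimes>\<^bsub>R\<^esub> v j)"
  by (simp_all add: power_module_def)

lemma vector_eqI:
  assumes "v \<in> {1..n} \<rightarrow>\<^sub>E X" "w \<in> {1..n} \<rightarrow>\<^sub>E Y" "\<And>j. j \<in> {1..n} \<Longrightarrow> v j = w j"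
  shows "v = w"
  using assms by (intro PiE_ext) auto

lemma (in cring) power_module: "Module.module R (power_module R n)"
proof (rule moduleI)
  show "abelian_group (power_module R n)"
  proof (rule abelian_groupI)
    fix x assume x: "x \<in> carrier (power_module R n)"
    then have "(\<lambda>j\<in>{1..n}. \<ominus> x j) \<oplus>\<^bsub>power_module R n\<^esub> x = \<zero>\<^bsub>power_module R n\<^esub>"
      by (auto simp: fun_eq_iff PiE_iff l_neg)
    moreover have "(\<lambda>j\<in>{1..n}. \<ominus> x j) \<in> carrier (power_module R n)" using x by (auto simp: PiE_mem)
    ultimately show "\<exists>y\<in>carrier (power_module R n).
        y \<oplus>\<^bsub>power_module R n\<^esub> x = \<zero>\<^bsub>power_module R n\<^esub>" by blast
  qed (auto simp: PiE_iff fun_eq_iff restrict_def extensional_def a_assoc intro: a_comm)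
qed (auto simp: PiE_iff fun_eq_iff restrict_def extensional_def l_distr r_distr m_assoc is_cring)

lemma power_module_minus:
  fixes R (structure)
  assumes "cring R" "v \<in> carrier (power_module R n)" "w \<in> carrier (power_module R n)" "j \<in> {1..n}"
  shows "(v \<ominus>\<^bsub>power_module R n\<^esub> w) j = v j \<ominus>\<^bsub>R\<^esub> w j"
proof -
  interpret cring R by fact
  interpret P: Module.module R "power_module R n" by (rule power_module)
  let ?d = "v \<ominus>\<^bsub>power_module R n\<^esub> w"
  have d: "?d \<in> carrier (power_module R n)" using assms P.M.minus_closed by blast
  have dw: "?d \<oplus>\<^bsub>power_module R n\<^esub> w = v"
    using assms(2,3) by (metis P.M.add.inv_solve_right P.M.minus_eq d)
  have "v j = ?d j \<oplus> w j"
    using arg_cong[OF dw, of "\<lambda>u. u j"] assms(4) by simp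
  moreover have "?d j \<in> carrier R" "w j \<in> carrier R"
    using PiE_mem[of _ "{1..n}" "\<lambda>_. carrier R" j] d assms(3,4) by auto
  ultimately show ?thesis by (metis add.inv_solve_right minus_eq a_closed)
qed

context local_artinian_ring
begin

text \<open>The vectors that vanish beyond the coordinate \<open>k\<close> form a filtration of \<open>R\<^sup>n\<close>.  The coordinate
  \<open>k + 1\<close> maps each step injectively into \<open>R\<close>.\<close>

lemma finite_length_power_module:
  "relative_length R (power_module R n) {\<zero>\<^bsub>power_module R n\<^esub>} (carrier (power_module R n)) < \<infinity>"
proof -
  interpret P: Module.module R "power_module R n" by (rule power_module)
  let ?P = "power_module R n"
  define E where "E k = {v \<in> carrier ?P. \<forall>j\<in>{1..n}. j > k \<longrightarrow> v j = \<zero>}" for k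
  have E: "submodule (E k) R ?P" for k
    unfolding P.submodule_iff
  proof (intro conjI ballI)
    show "E k \<subseteq> carrier ?P" by (auto simp: E_def)
    show "\<zero>\<^bsub>?P\<^esub> \<in> E k" by (auto simp: E_def)
    show "x \<oplus>\<^bsub>?P\<^esub> y \<in> E k" if "x \<in> E k" "y \<in> E k" for x y
      using that P.M.add.m_closed[of x y] by (simp add: E_def)
    show "r \<odot>\<^bsub>?P\<^esub> x \<in> E k" if "r \<in> carrier R" "x \<in> E k" for r x
      using that P.smult_closed[of r x] by (simp add: E_def)
  qed
  have E0: "E 0 = {\<zero>\<^bsub>?P\<^esub>}"
  proof
    show "E 0 \<subseteq> {\<zero>\<^bsub>?P\<^esub>}"
    proof
      fix v assume "v \<in> E 0"
      then have "v = \<zero>\<^bsub>?P\<^esub>"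
        by (intro vector_eqI[of v n "carrier R" _ "carrier R"]) (auto simp: E_def)
      then show "v \<in> {\<zero>\<^bsub>?P\<^esub>}" by simp
    qed
  qed (auto simp: E_def)
  have step: "relative_length R ?P (E k) (E (Suc k)) < \<infinity>" if k: "Suc k \<le> n" for k
  proof -
    let ?p = "\<lambda>v. v (Suc k)"
    have j: "Suc k \<in> {1..n}" using k by simp
    have "relative_length R ?P (E k) (E (Suc k)) \<le> relative_length R (regular_module R) {\<zero>} (carrier R)"
      unfolding relative_length_def submodule_regular_module_iff
    proof (rule height_le_if_strict_mono[where f = "\<lambda>X. ?p ` X"])
      fix X assume "X \<in> {N. submodule N R ?P \<and> E k \<subseteq> N \<and> N \<subseteq> E (Suc k)}"
      then have X: "X \<subseteq> carrier ?P" "\<zero>\<^bsub>?P\<^esub> \<in> X"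
          "\<And>x y. \<lbrakk>x \<in> X; y \<in> X\<rbrakk> \<Longrightarrow> x \<oplus>\<^bsub>?P\<^esub> y \<in> X"
          "\<And>r x. \<lbrakk>r \<in> carrier R; x \<in> X\<rbrakk> \<Longrightarrow> r \<odot>\<^bsub>?P\<^esub> x \<in> X"
        unfolding P.submodule_iff by blast+
      have "ideal (?p ` X) R"
        unfolding ideal_iff
      proof (intro conjI ballI)
        have "v (Suc k) \<in> carrier R" if "v \<in> X" for v
        proof -
          have "v \<in> {1..n} \<rightarrow>\<^sub>E carrier R" using X(1) that by auto
          from PiE_mem[OF this j] show ?thesis .
        qed
        then show "?p ` X \<subseteq> carrier R" by blast
        have "\<zero> = ?p \<zero>\<^bsub>?P\<^esub>" using j by simp
        then show "\<zero> \<in> ?p ` X" using X(2) by (rule image_eqI)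
      next
        fix a b assume "a \<in> ?p ` X" "b \<in> ?p ` X"
        then obtain x y where *: "a = x (Suc k)" "b = y (Suc k)" "x \<in> X" "y \<in> X" by blast
        have "a \<oplus> b = ?p (x \<oplus>\<^bsub>?P\<^esub> y)" using *(1,2) j by simp
        then show "a \<oplus> b \<in> ?p ` X" using X(3)[OF *(3,4)] by (rule image_eqI)
      next
        fix r b assume r: "r \<in> carrier R" and "b \<in> ?p ` X"
        then obtain y where *: "b = y (Suc k)" "y \<in> X" by blast
        have "r \<otimes> b = ?p (r \<odot>\<^bsub>?P\<^esub> y)" using *(1) j by simp
        then show "r \<otimes> b \<in> ?p ` X" using X(4)[OF r *(2)] by (rule image_eqI)
      qed
      then show "?p ` X \<in> {N. ideal N R \<and> {\<zero>} \<subseteq> N \<and> N \<subseteq> carrier R}"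
        unfolding ideal_iff by blast
    next
      fix X Y
      assume "X \<in> {N. submodule N R ?P \<and> E k \<subseteq> N \<and> N \<subseteq> E (Suc k)}"
        and "Y \<in> {N. submodule N R ?P \<and> E k \<subseteq> N \<and> N \<subseteq> E (Suc k)}" and XY: "X \<subset> Y"
      then have X: "submodule X R ?P" and Y: "submodule Y R ?P" and EX: "E k \<subseteq> X"
        and YE: "Y \<subseteq> E (Suc k)" by auto
      have "Y \<subseteq> X" if eq: "?p ` Y \<subseteq> ?p ` X"
      proof
        fix y assume y: "y \<in> Y"
        then obtain x where x: "x \<in> X" "y (Suc k) = x (Suc k)" using eq by blast
        have c: "x \<in> carrier ?P" "y \<in> carrier ?P" "x \<in> E (Suc k)" "y \<in> E (Suc k)"
          using x y XY YE by (auto simp: E_def)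
        let ?d = "y \<ominus>\<^bsub>?P\<^esub> x"
        have d: "?d \<in> carrier ?P" using c by (intro P.M.minus_closed)
        have "?d j = \<zero>" if "j \<in> {1..n}" "j > k" for j
        proof -
          have "x j = y j" using c(3,4) that x(2) by (cases "j = Suc k") (auto simp: E_def)
          moreover have "x j \<in> carrier R"
            using PiE_mem[of x "{1..n}" "\<lambda>_. carrier R" j] c(1) that by simp
          ultimately show ?thesis
            using power_module_minus[OF is_cring c(2,1) that(1)] by (simp add: a_minus_def r_neg)
        qed
        then have "?d \<in> X" using d EX by (auto simp: E_def)
        then have "?d \<oplus>\<^bsub>?P\<^esub> x \<in> X" using x(1) X unfolding P.submodule_iff by blast
        moreover have "?d \<oplus>\<^bsub>?P\<^esub> x = y" using c(1,2) by (metis P.M.add.inv_solve_right P.M.minus_eq d)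
        ultimately show "y \<in> X" by simp
      qed
      then show "?p ` X \<subset> ?p ` Y" using XY by blast
    qed
    then show ?thesis using finite_length by (rule order_le_less_trans)
  qed
  have "relative_length R ?P (E 0) (E k) < \<infinity>" if "k \<le> n" for k
    using that
  proof (induction k)
    case 0
    then show ?case using P.relative_length_refl[OF E] by simp
  next
    case (Suc k)
    have "E 0 \<subseteq> E k" "E k \<subseteq> E (Suc k)" by (auto simp: E_def)
    then have "relative_length R ?P (E 0) (E (Suc k)) =
        relative_length R ?P (E 0) (E k) + relative_length R ?P (E k) (E (Suc k))"
      by (intro P.relative_length_add E)
    then show ?case using Suc step[of k] by (simp add: plus_eq_infty_iff_enat less_top[symmetric])
  qed
  from this[of n] have "relative_length R ?P (E 0) (E n) < \<infinity>" by simp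
  moreover have "E n = carrier ?P" by (auto simp: E_def)
  ultimately show ?thesis unfolding E0 by simp
qed

end


section \<open>Cosets and the length of a quotient ring\<close>

lemma (in abelian_subgroup) rcoset_eqI:
  assumes "x \<in> carrier G" "y \<in> carrier G" "x \<ominus> y \<in> H"
  shows "H +> x = H +> y"
  using a_repr_independence'[OF a_rcos_module_rev[OF assms(2,1)] assms(2)] assms(3)
  by (simp add: a_minus_def)

lemma (in abelian_subgroup) mem_if_rcoset_eq:
  assumes "x \<in> carrier G" "H +> x = H"
  shows "x \<in> H"
  using a_rcos_self[OF assms(1)] assms(2) by simp

lemma (in abelian_subgroup) quotient_simps:
  "carrier (G A_Mod H) = a_rcosets H" "\<one>\<^bsub>G A_Mod H\<^esub> = H"
  by (simp_all add: A_FactGroup_def')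

context Module.module
begin

lemma submodule_abelian_subgroup: "submodule N R M \<Longrightarrow> abelian_subgroup N M"
  by (intro abelian_subgroupI3 additive_subgroupI submodule.axioms(1) M.abelian_group_axioms)

end

text \<open>The submodules of \<open>R / E\<close> are the ideals between \<open>E\<close> and \<open>R\<close>.\<close>

lemma (in cring) module_length_quotient:
  assumes E: "ideal E R"
  shows "module_length R (quotient_ring_module R E) = relative_length R (regular_module R) E (carrier R)"
proof -
  interpret E: ideal E R by (rule E)
  interpret B: cring "R Quot E" by (rule E.quotient_is_cring[OF is_cring])
  let ?B = "quotient_ring_module R E" and ?q = "\<lambda>x. E +> x"
  have simps [simp]: "carrier ?B = ?q ` carrier R" "zero ?B = E" "add ?B = add (R Quot E)"
    "smult ?B r X = mult (R Quot E) (?q r) X" for r X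
    by (auto simp: quotient_ring_module_def FactRing_def A_RCOSETS_defs a_r_coset_def)
  have cB: "carrier (R Quot E) = ?q ` carrier R" "\<one>\<^bsub>R Quot E\<^esub> = ?q \<one>" "\<zero>\<^bsub>R Quot E\<^esub> = E"
    by (auto simp: FactRing_def A_RCOSETS_defs a_r_coset_def)
  have q_add: "?q x \<oplus>\<^bsub>R Quot E\<^esub> ?q y = ?q (x \<oplus> y)"
    and q_mult: "?q x \<otimes>\<^bsub>R Quot E\<^esub> ?q y = ?q (x \<otimes> y)" if "x \<in> carrier R" "y \<in> carrier R" for x y
    using ring_hom_add[OF E.rcos_ring_hom that] ring_hom_mult[OF E.rcos_ring_hom that] by simp_all
  have qB: "?q x \<in> carrier (R Quot E)" if "x \<in> carrier R" for x using that by (simp add: cB)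
  have q0: "?q \<zero> = E" using E.a_rcos_const[of \<zero>] by simp
  interpret Q: Module.module R ?B
  proof (rule moduleI)
    show "abelian_group ?B"
    proof (rule abelian_groupI)
      fix X assume "X \<in> carrier ?B"
      then obtain x where x: "x \<in> carrier R" "X = ?q x" by auto
      then have "?q (\<ominus> x) \<oplus>\<^bsub>R Quot E\<^esub> X = E" using q_add[of "\<ominus> x" x] q0 by (simp add: l_neg)
      then show "\<exists>Y\<in>carrier ?B. Y \<oplus>\<^bsub>?B\<^esub> X = \<zero>\<^bsub>?B\<^esub>" using x(1) by auto
    qed (use B.a_closed B.a_assoc B.a_comm B.l_zero B.zero_closed in \<open>auto simp: cB q_add a_assoc a_comm\<close>)
  qed (auto simp: is_cring q_add q_mult l_distr r_distr m_assoc)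
  show ?thesis
    unfolding module_length_eq_height relative_length_def submodule_regular_module_iff
  proof (rule antisym)
    show "height {N. submodule N R ?B} \<le> height {N. ideal N R \<and> E \<subseteq> N \<and> N \<subseteq> carrier R}"
    proof (rule height_le_if_strict_mono[where f = "\<lambda>N. {x \<in> carrier R. ?q x \<in> N}"])
      fix N assume "N \<in> {N. submodule N R ?B}"
      then have N: "N \<subseteq> ?q ` carrier R" "E \<in> N"
          "\<And>X Y. \<lbrakk>X \<in> N; Y \<in> N\<rbrakk> \<Longrightarrow> X \<oplus>\<^bsub>R Quot E\<^esub> Y \<in> N"
          "\<And>r X. \<lbrakk>r \<in> carrier R; X \<in> N\<rbrakk> \<Longrightarrow> ?q r \<otimes>\<^bsub>R Quot E\<^esub> X \<in> N"
        by (auto simp: Q.submodule_iff)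
      have "ideal {x \<in> carrier R. ?q x \<in> N} R"
        unfolding ideal_iff
      proof (intro conjI ballI)
        show "\<zero> \<in> {x \<in> carrier R. ?q x \<in> N}" using N(2) q0 by simp
        show "x \<oplus> y \<in> {x \<in> carrier R. ?q x \<in> N}"
          if "x \<in> {x \<in> carrier R. ?q x \<in> N}" "y \<in> {x \<in> carrier R. ?q x \<in> N}" for x y
          using that N(3)[of "?q x" "?q y"] q_add[of x y] by simp
        show "r \<otimes> x \<in> {x \<in> carrier R. ?q x \<in> N}"
          if "r \<in> carrier R" "x \<in> {x \<in> carrier R. ?q x \<in> N}" for r x
          using that N(4)[of r "?q x"] q_mult[of r x] by simp
      qed blast
      moreover have "x \<in> carrier R \<and> ?q x \<in> N" if "x \<in> E" for x
        using E.a_rcos_const[OF that] N(2) E.a_subset that by auto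
      ultimately show "{x \<in> carrier R. ?q x \<in> N} \<in> {N. ideal N R \<and> E \<subseteq> N \<and> N \<subseteq> carrier R}" by auto
    next
      fix N N' assume "N \<in> {N. submodule N R ?B}" "N' \<in> {N. submodule N R ?B}" "N \<subset> N'"
      then have "N' \<subseteq> ?q ` carrier R" "N \<subset> N'" by (auto simp: Q.submodule_iff)
      then show "{x \<in> carrier R. ?q x \<in> N} \<subset> {x \<in> carrier R. ?q x \<in> N'}" by blast
    qed
    show "height {N. ideal N R \<and> E \<subseteq> N \<and> N \<subseteq> carrier R} \<le> height {N. submodule N R ?B}"
    proof (rule height_le_if_strict_mono[where f = "\<lambda>J. ?q ` J"])
      fix J assume "J \<in> {N. ideal N R \<and> E \<subseteq> N \<and> N \<subseteq> carrier R}"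
      then have J: "J \<subseteq> carrier R" "\<zero> \<in> J" "\<And>x y. \<lbrakk>x \<in> J; y \<in> J\<rbrakk> \<Longrightarrow> x \<oplus> y \<in> J"
          "\<And>r x. \<lbrakk>r \<in> carrier R; x \<in> J\<rbrakk> \<Longrightarrow> r \<otimes> x \<in> J"
        by (auto simp: ideal_iff)
      have "submodule (?q ` J) R ?B"
        unfolding Q.submodule_iff
      proof (intro conjI ballI)
        show "?q ` J \<subseteq> carrier ?B" using J(1) by auto
        show "\<zero>\<^bsub>?B\<^esub> \<in> ?q ` J" using J(2) q0 by force
      next
        fix X Y assume "X \<in> ?q ` J" "Y \<in> ?q ` J"
        then obtain x y where xy: "X = ?q x" "Y = ?q y" "x \<in> J" "y \<in> J" by blast
        then have "X \<oplus>\<^bsub>?B\<^esub> Y = ?q (x \<oplus> y)" using J(1) q_add[of x y] by (simp add: subset_iff)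
        then show "X \<oplus>\<^bsub>?B\<^esub> Y \<in> ?q ` J" using J(3)[OF xy(3,4)] by (rule image_eqI)
      next
        fix r X assume r: "r \<in> carrier R" and "X \<in> ?q ` J"
        then obtain x where x: "X = ?q x" "x \<in> J" by blast
        then have "r \<odot>\<^bsub>?B\<^esub> X = ?q (r \<otimes> x)" using J(1) q_mult[of r x] r by (simp add: subset_iff)
        then show "r \<odot>\<^bsub>?B\<^esub> X \<in> ?q ` J" using J(4)[OF r x(2)] by (rule image_eqI)
      qed
      then show "?q ` J \<in> {N. submodule N R ?B}" by simp
    next
      fix J J' assume "J \<in> {N. ideal N R \<and> E \<subseteq> N \<and> N \<subseteq> carrier R}"
        "J' \<in> {N. ideal N R \<and> E \<subseteq> N \<and> N \<subseteq> carrier R}" and JJ: "J \<subset> J'"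
      then have J: "ideal J R" "E \<subseteq> J" and J'R: "J' \<subseteq> carrier R" by auto
      then interpret J: ideal J R by simp
      have "J' \<subseteq> J" if sub: "?q ` J' \<subseteq> ?q ` J"
      proof
        fix x assume x: "x \<in> J'"
        then obtain y where y: "y \<in> J" "?q x = ?q y" using sub by blast
        have "x \<in> ?q y" using E.a_rcos_self[of x] x y J'R by auto
        then obtain e where "e \<in> E" "x = e \<oplus> y" by (auto simp: a_r_coset_def')
        then show "x \<in> J" using y J(2) by auto
      qed
      then show "?q ` J \<subset> ?q ` J'" using JJ by blast
    qed
  qed
qed


section \<open>Balanced maps on tensor products\<close>

definition balanced ::
    "('a, 'm) ring_scheme \<Rightarrow> ('a, 'b, 'c) module_scheme \<Rightarrow> ('a, 'd, 'e) module_scheme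
      \<Rightarrow> ('g, 'h) monoid_scheme \<Rightarrow> ('b \<Rightarrow> 'd \<Rightarrow> 'g) \<Rightarrow> bool" where
  "balanced R M N G \<beta> \<longleftrightarrow>
     (\<forall>x\<in>carrier M. \<forall>y\<in>carrier N. \<beta> x y \<in> carrier G) \<and>
     (\<forall>x\<in>carrier M. \<forall>x'\<in>carrier M. \<forall>y\<in>carrier N. \<beta> (x \<oplus>\<^bsub>M\<^esub> x') y = \<beta> x y \<otimes>\<^bsub>G\<^esub> \<beta> x' y) \<and>
     (\<forall>x\<in>carrier M. \<forall>y\<in>carrier N. \<forall>y'\<in>carrier N. \<beta> x (y \<oplus>\<^bsub>N\<^esub> y') = \<beta> x y \<otimes>\<^bsub>G\<^esub> \<beta> x y') \<and>
     (\<forall>r\<in>carrier R. \<forall>x\<in>carrier M. \<forall>y\<in>carrier N. \<beta> (r \<odot>\<^bsub>M\<^esub> x) y = \<beta> x (r \<odot>\<^bsub>N\<^esub> y))"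

text \<open>The homomorphism on the free abelian group from which \<open>tensor_lift\<close> is obtained by passing to
  cosets.\<close>

definition linear_extension ::
    "('a, 'b, 'c) module_scheme \<Rightarrow> ('a, 'd, 'e) module_scheme \<Rightarrow> ('g, 'h) monoid_scheme
      \<Rightarrow> ('b \<Rightarrow> 'd \<Rightarrow> 'g) \<Rightarrow> ('b \<times> 'd \<Rightarrow>\<^sub>0 int) \<Rightarrow> 'g" where
  "linear_extension M N G \<beta> c =
     gfinprod G (\<lambda>(x, y). \<beta> x y [^]\<^bsub>G\<^esub> Poly_Mapping.lookup c (x, y)) (carrier M \<times> carrier N)"

lemma tensor_lift_eq:
  "tensor_lift M N G \<beta> X = the_elem (linear_extension M N G \<beta> ` X)"
  by (simp add: tensor_lift_def linear_extension_def)

lemma hom_free_Abelian_group_eq: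
  assumes G: "group G"
    and g: "g \<in> hom (free_Abelian_group X) G" and h: "h \<in> hom (free_Abelian_group X) G"
    and eq: "\<And>x. x \<in> X \<Longrightarrow> g (frag_of x) = h (frag_of x)"
    and c: "c \<in> carrier (free_Abelian_group X)"
  shows "g c = h c"
proof -
  interpret g: group_hom "free_Abelian_group X" G g
    using G g by (simp add: group_hom_def group_hom_axioms_def)
  interpret h: group_hom "free_Abelian_group X" G h
    using G h by (simp add: group_hom_def group_hom_axioms_def)
  have "Poly_Mapping.keys c \<subseteq> X \<and> g c = h c"
    using c unfolding carrier_free_Abelian_group_iff
  proof (induction c rule: frag_induction)
    case zero
    show ?case using g.hom_one h.hom_one by simp
  next
    case (one x)
    then show ?case using eq by simp
  next
    case (diff a b)
    then have "g (a + - b) = h (a + - b)"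
      using g.hom_mult[of a "- b"] h.hom_mult[of a "- b"] g.hom_inv[of b] h.hom_inv[of b] by simp
    then show ?case using diff keys_diff[of a b] by auto
  qed
  then show ?thesis by simp
qed

lemma linear_extension_hom:
  fixes M :: "('a, 'b, 'c) module_scheme" and N :: "('a, 'd, 'e) module_scheme"
  assumes "comm_group G" and \<beta>: "\<And>x y. \<lbrakk>x \<in> carrier M; y \<in> carrier N\<rbrakk> \<Longrightarrow> \<beta> x y \<in> carrier G"
  shows "linear_extension M N G \<beta> \<in> hom (free_Abelian_group (carrier M \<times> carrier N)) G"
proof -
  interpret G: comm_group G by fact
  let ?X = "carrier M \<times> carrier N"
  let ?t = "\<lambda>c z. (case z of (x, y) \<Rightarrow> \<beta> x y [^]\<^bsub>G\<^esub> Poly_Mapping.lookup c (x, y))"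
  have t: "?t c \<in> ?X \<rightarrow> carrier G" for c :: "'b \<times> 'd \<Rightarrow>\<^sub>0 int"
    using \<beta> by auto
  have fin: "finite {z \<in> ?X. ?t c z \<noteq> \<one>\<^bsub>G\<^esub>}" for c :: "'b \<times> 'd \<Rightarrow>\<^sub>0 int"
  proof (rule finite_subset)
    show "{z \<in> ?X. ?t c z \<noteq> \<one>\<^bsub>G\<^esub>} \<subseteq> Poly_Mapping.keys c"
      by (auto simp: in_keys_iff)
  qed simp
  show ?thesis
  proof (rule homI)
    fix c show "linear_extension M N G \<beta> c \<in> carrier G"
      unfolding linear_extension_def using t[of c] by (intro G.gfinprod_closed)
  next
    fix c d :: "'b \<times> 'd \<Rightarrow>\<^sub>0 int"
    have "linear_extension M N G \<beta> (c + d) = gfinprod G (\<lambda>z. ?t c z \<otimes>\<^bsub>G\<^esub> ?t d z) ?X"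
      unfolding linear_extension_def
      by (intro G.gfinprod_cong)
        (use \<beta> in \<open>auto simp: simp_implies_def Poly_Mapping.lookup_add G.int_pow_mult\<close>)
    also have "\<dots> = linear_extension M N G \<beta> c \<otimes>\<^bsub>G\<^esub> linear_extension M N G \<beta> d"
      unfolding linear_extension_def using t fin by (intro G.gfinprod_distrib)
    finally show "linear_extension M N G \<beta> (c \<otimes>\<^bsub>free_Abelian_group ?X\<^esub> d) =
        linear_extension M N G \<beta> c \<otimes>\<^bsub>G\<^esub> linear_extension M N G \<beta> d" by simp
  qed
qed

lemma linear_extension_frag_of:
  assumes "comm_group G" and \<beta>: "\<And>x y. \<lbrakk>x \<in> carrier M; y \<in> carrier N\<rbrakk> \<Longrightarrow> \<beta> x y \<in> carrier G"
    and "x \<in> carrier M" "y \<in> carrier N"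
  shows "linear_extension M N G \<beta> (frag_of (x, y)) = \<beta> x y"
proof -
  interpret G: comm_group G by fact
  let ?X = "carrier M \<times> carrier N"
  let ?t = "\<lambda>c z. (case z of (x, y) \<Rightarrow> \<beta> x y [^]\<^bsub>G\<^esub> Poly_Mapping.lookup c (x, y))"
  have "gfinprod G (?t (frag_of (x, y))) ?X = gfinprod G (?t (frag_of (x, y))) {(x, y)}"
    by (rule G.gfinprod_mono_neutral_cong_right) (use assms in \<open>auto split: if_splits\<close>)
  also have "\<dots> = finprod G (?t (frag_of (x, y))) {(x, y)}"
    by (rule G.gfinprod_eq_finprod) (use assms in auto)
  also have "\<dots> = \<beta> x y"
    using assms by (subst G.finprod_singleton_swap[symmetric, of "(x, y)" "{(x, y)}"]) auto
  finally show ?thesis by (simp add: linear_extension_def)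
qed

locale tensor =
  fixes R :: "('a, 'm) ring_scheme" and M :: "('a, 'b, 'c) module_scheme"
    and N :: "('a, 'd, 'e) module_scheme"
  assumes M: "Module.module R M" and N: "Module.module R N"
begin

sublocale M: Module.module R M by (rule M)
sublocale N: Module.module R N by (rule N)

abbreviation "F \<equiv> free_Abelian_group (carrier M \<times> carrier N)"
abbreviation "K \<equiv> tensor_kernel R M N"
abbreviation "T \<equiv> tensor_product R M N"

sublocale F: comm_group F by (rule abelian_free_Abelian_group)

lemma tensor_relations_subset: "tensor_relations R M N \<subseteq> carrier F"
  unfolding tensor_relations_def carrier_free_Abelian_group_iff[abs_def]
  by (auto dest!: subsetD[OF keys_diff])

lemma kernel_subgroup: "subgroup K F"
  unfolding tensor_kernel_def by (rule F.generate_is_subgroup[OF tensor_relations_subset])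

lemma kernel_normal: "K \<lhd> F"
  by (rule F.subgroup_imp_normal[OF kernel_subgroup])

lemma T_comm_group: "comm_group T"
  unfolding tensor_product_def by (rule F.abelian_FactGroup[OF kernel_subgroup])

sublocale T: comm_group T by (rule T_comm_group)

lemma carrier_T: "carrier T = (\<lambda>c. K #>\<^bsub>F\<^esub> c) ` carrier F"
  by (simp add: tensor_product_def carrier_FactGroup)

lemma coset_hom: "(\<lambda>c. K #>\<^bsub>F\<^esub> c) \<in> hom F T"
  unfolding tensor_product_def by (rule normal.r_coset_hom_Mod[OF kernel_normal])

lemma coset_mult:
  assumes "a \<in> carrier F" "b \<in> carrier F"
  shows "(K #>\<^bsub>F\<^esub> a) \<otimes>\<^bsub>T\<^esub> (K #>\<^bsub>F\<^esub> b) = K #>\<^bsub>F\<^esub> (a + b)"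
  using hom_mult[OF coset_hom assms] by simp

lemma coset_eqI:
  assumes "a \<in> carrier F" "b \<in> carrier F" "a - b \<in> K"
  shows "K #>\<^bsub>F\<^esub> a = K #>\<^bsub>F\<^esub> b"
proof -
  have "a \<in> K #>\<^bsub>F\<^esub> b"
    unfolding r_coset_def using assms(3) by (auto intro!: bexI[of _ "a - b"])
  then show ?thesis by (metis F.repr_independence assms(2) kernel_subgroup)
qed

lemma frag_add_in: "\<lbrakk>a \<in> carrier F; b \<in> carrier F\<rbrakk> \<Longrightarrow> Poly_Mapping.keys (a + b) \<subseteq> carrier M \<times> carrier N"
  using F.m_closed[of a b] by simp

lemma pure_tensor_balanced: "balanced R M N T (pure_tensor R M N)"
proof -
  have K: "t \<in> tensor_relations R M N \<Longrightarrow> t \<in> K" for t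
    unfolding tensor_kernel_def by (rule generate.incl)
  show ?thesis
    unfolding balanced_def pure_tensor_def
  proof (intro conjI ballI)
    fix x y assume "x \<in> carrier M" "y \<in> carrier N"
    then show "K #>\<^bsub>F\<^esub> frag_of (x, y) \<in> carrier T" by (auto simp: carrier_T)
  next
    fix x x' y assume *: "x \<in> carrier M" "x' \<in> carrier M" "y \<in> carrier N"
    have "frag_of (x \<oplus>\<^bsub>M\<^esub> x', y) - (frag_of (x, y) + frag_of (x', y)) \<in> K"
      unfolding diff_diff_eq[symmetric] by (rule K) (use * in \<open>auto simp: tensor_relations_def\<close>)
    then show "K #>\<^bsub>F\<^esub> frag_of (x \<oplus>\<^bsub>M\<^esub> x', y) =
        (K #>\<^bsub>F\<^esub> frag_of (x, y)) \<otimes>\<^bsub>T\<^esub> (K #>\<^bsub>F\<^esub> frag_of (x', y))"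
      using * by (subst coset_mult) (simp_all add: coset_eqI frag_add_in)
  next
    fix x y y' assume *: "x \<in> carrier M" "y \<in> carrier N" "y' \<in> carrier N"
    have "frag_of (x, y \<oplus>\<^bsub>N\<^esub> y') - (frag_of (x, y) + frag_of (x, y')) \<in> K"
      unfolding diff_diff_eq[symmetric] by (rule K) (use * in \<open>auto simp: tensor_relations_def\<close>)
    then show "K #>\<^bsub>F\<^esub> frag_of (x, y \<oplus>\<^bsub>N\<^esub> y') =
        (K #>\<^bsub>F\<^esub> frag_of (x, y)) \<otimes>\<^bsub>T\<^esub> (K #>\<^bsub>F\<^esub> frag_of (x, y'))"
      using * by (subst coset_mult) (simp_all add: coset_eqI frag_add_in)
  next
    fix r x y assume *: "r \<in> carrier R" "x \<in> carrier M" "y \<in> carrier N"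
    have "frag_of (r \<odot>\<^bsub>M\<^esub> x, y) - frag_of (x, r \<odot>\<^bsub>N\<^esub> y) \<in> K"
      by (rule K) (use * in \<open>auto simp: tensor_relations_def\<close>)
    then show "K #>\<^bsub>F\<^esub> frag_of (r \<odot>\<^bsub>M\<^esub> x, y) = K #>\<^bsub>F\<^esub> frag_of (x, r \<odot>\<^bsub>N\<^esub> y)"
      using * by (intro coset_eqI) auto
  qed
qed

text \<open>A balanced map sends each generating relation to the neutral element.\<close>

lemma linear_extension_kernel:
  assumes G: "comm_group G" and \<beta>: "balanced R M N G \<beta>" and c: "c \<in> K"
  shows "linear_extension M N G \<beta> c = \<one>\<^bsub>G\<^esub>"
proof -
  interpret G: comm_group G by fact
  let ?l = "linear_extension M N G \<beta>"
  have \<beta>c: "\<And>x y. \<lbrakk>x \<in> carrier M; y \<in> carrier N\<rbrakk> \<Longrightarrow> \<beta> x y \<in> carrier G"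
    using \<beta> by (auto simp: balanced_def)
  interpret l: group_hom F G ?l
    using linear_extension_hom[OF G \<beta>c] by (simp add: group_hom_def group_hom_axioms_def F.is_group)
  note frag = linear_extension_frag_of[OF G \<beta>c]
  have diff: "?l (a - b) = ?l a \<otimes>\<^bsub>G\<^esub> inv\<^bsub>G\<^esub> ?l b" if "a \<in> carrier F" "b \<in> carrier F" for a b
    using l.hom_mult[of a "- b"] l.hom_inv[of b] that by simp
  have "?l t = \<one>\<^bsub>G\<^esub>" if t: "t \<in> tensor_relations R M N" for t
  proof -
    consider (left) x x' y where "t = frag_of (x \<oplus>\<^bsub>M\<^esub> x', y) - frag_of (x, y) - frag_of (x', y)"
        "x \<in> carrier M" "x' \<in> carrier M" "y \<in> carrier N"
      | (right) x y y' where "t = frag_of (x, y \<oplus>\<^bsub>N\<^esub> y') - frag_of (x, y) - frag_of (x, y')"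
        "x \<in> carrier M" "y \<in> carrier N" "y' \<in> carrier N"
      | (scalar) r x y where "t = frag_of (r \<odot>\<^bsub>M\<^esub> x, y) - frag_of (x, r \<odot>\<^bsub>N\<^esub> y)"
        "r \<in> carrier R" "x \<in> carrier M" "y \<in> carrier N"
      using t unfolding tensor_relations_def by blast
    then show ?thesis
    proof cases
      case left
      have "frag_of (x \<oplus>\<^bsub>M\<^esub> x', y) - frag_of (x, y) \<in> carrier F"
        using left keys_diff[of "frag_of (x \<oplus>\<^bsub>M\<^esub> x', y)" "frag_of (x, y)"] by auto
      then show ?thesis
        using left \<beta> \<beta>c by (simp add: diff frag balanced_def G.m_ac G.inv_solve_right')
    next
      case right
      have "frag_of (x, y \<oplus>\<^bsub>N\<^esub> y') - frag_of (x, y) \<in> carrier F"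
        using right keys_diff[of "frag_of (x, y \<oplus>\<^bsub>N\<^esub> y')" "frag_of (x, y)"] by auto
      then show ?thesis
        using right \<beta> \<beta>c by (simp add: diff frag balanced_def G.m_ac G.inv_solve_right')
    next
      case scalar
      then show ?thesis using \<beta> \<beta>c by (simp add: diff frag balanced_def)
    qed
  qed
  then have "tensor_relations R M N \<subseteq> kernel F G ?l"
    using tensor_relations_subset unfolding kernel_def by blast
  then have "K \<subseteq> kernel F G ?l"
    unfolding tensor_kernel_def by (rule F.generate_subgroup_incl[OF _ l.subgroup_kernel])
  then show ?thesis using c by (auto simp: kernel_def)
qed

text \<open>The linear extension is constant on cosets of \<open>K\<close>, so \<open>the_elem\<close> selects its only value there.\<close>

lemma tensor_lift_coset:
  assumes G: "comm_group G" and \<beta>: "balanced R M N G \<beta>" and c: "c \<in> carrier F"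
  shows "tensor_lift M N G \<beta> (K #>\<^bsub>F\<^esub> c) = linear_extension M N G \<beta> c"
proof -
  interpret G: comm_group G by fact
  let ?l = "linear_extension M N G \<beta>"
  have l: "?l \<in> hom F G"
    by (rule linear_extension_hom[OF G]) (use \<beta> in \<open>auto simp: balanced_def\<close>)
  have "?l (k + c) = ?l c" if k: "k \<in> K" for k
    using hom_mult[OF l subgroup.mem_carrier[OF kernel_subgroup k] c]
      linear_extension_kernel[OF G \<beta> k] hom_in_carrier[OF l c] by simp
  then have "?l ` (K #>\<^bsub>F\<^esub> c) = {?l c}"
    using subgroup.one_closed[OF kernel_subgroup] by (auto simp: r_coset_def image_iff)
  then show ?thesis by (simp add: tensor_lift_eq)
qed

end


section \<open>Extension of scalars inside powers of the rings\<close>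

text \<open>From here on vectors are manipulated through the module laws rather than coordinatewise.\<close>

declare power_module_simps [simp del]

locale flat_algebra =
  fixes R :: "('r, 'e) ring_scheme" and S :: "('r, 's, 't) module_scheme" and n :: nat
  assumes algebra: "algebra R S" and flat: "flat_module R S"
begin

sublocale R: cring R by (rule algebra.R_cring[OF algebra])
sublocale S: cring S by (rule algebra.M_cring[OF algebra])
sublocale RS: Module.module R S by (rule algebra.module[OF algebra])
sublocale RP: Module.module R "power_module R n" by (rule R.power_module)
sublocale SP: Module.module S "power_module S n" by (rule S.power_module)

abbreviation "P \<equiv> power_module R n"
abbreviation "Q \<equiv> power_module S n"

text \<open>The image in \<open>S\<^sup>n\<close> of the pure tensor of \<open>c \<in> R\<^sup>n\<close> and \<open>s \<in> S\<close>.\<close>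

definition scale :: "(nat \<Rightarrow> 'r) \<Rightarrow> 's \<Rightarrow> nat \<Rightarrow> 's" where
  "scale c s = (\<lambda>j\<in>{1..n}. c j \<odot>\<^bsub>S\<^esub> s)"

lemma entry_closed [simp]:
  "\<lbrakk>c \<in> {1..n} \<rightarrow>\<^sub>E X; Suc 0 \<le> j; j \<le> n\<rbrakk> \<Longrightarrow> c j \<in> X"
  using PiE_mem[of c "{1..n}" "\<lambda>_. X" j] by simp

lemma scale_closed [simp]:
  "\<lbrakk>c \<in> carrier P; s \<in> carrier S\<rbrakk> \<Longrightarrow> scale c s \<in> carrier Q"
  by (auto simp: power_module_simps scale_def)

lemma scale_add_left:
  "\<lbrakk>c \<in> carrier P; d \<in> carrier P; s \<in> carrier S\<rbrakk>
    \<Longrightarrow> scale (c \<oplus>\<^bsub>P\<^esub> d) s = scale c s \<oplus>\<^bsub>Q\<^esub> scale d s"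
  by (auto simp: power_module_simps scale_def RS.smult_l_distr intro!: restrict_ext)

lemma scale_add_right:
  "\<lbrakk>c \<in> carrier P; s \<in> carrier S; t \<in> carrier S\<rbrakk>
    \<Longrightarrow> scale c (s \<oplus>\<^bsub>S\<^esub> t) = scale c s \<oplus>\<^bsub>Q\<^esub> scale c t"
  by (auto simp: power_module_simps scale_def RS.smult_r_distr intro!: restrict_ext)

lemma scale_smult:
  "\<lbrakk>r \<in> carrier R; c \<in> carrier P; s \<in> carrier S\<rbrakk>
    \<Longrightarrow> scale (r \<odot>\<^bsub>P\<^esub> c) s = scale c (r \<odot>\<^bsub>S\<^esub> s)"
proof -
  assume *: "r \<in> carrier R" "c \<in> carrier P" "s \<in> carrier S"
  have "(r \<otimes>\<^bsub>R\<^esub> c j) \<odot>\<^bsub>S\<^esub> s = c j \<odot>\<^bsub>S\<^esub> (r \<odot>\<^bsub>S\<^esub> s)" if "Suc 0 \<le> j" "j \<le> n" for j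
    using * that by (simp add: power_module_simps R.m_comm[of r "c j"] RS.smult_assoc1)
  then show ?thesis by (auto simp: power_module_simps scale_def intro!: restrict_ext)
qed

lemma smult_mult_right:
  assumes "r \<in> carrier R" "s \<in> carrier S" "t \<in> carrier S"
  shows "t \<otimes>\<^bsub>S\<^esub> (r \<odot>\<^bsub>S\<^esub> s) = r \<odot>\<^bsub>S\<^esub> (s \<otimes>\<^bsub>S\<^esub> t)"
  using assms algebra.smult_assoc2[OF algebra, of r s t] by (simp add: S.m_comm[of t])

lemma smult_scale:
  "\<lbrakk>t \<in> carrier S; c \<in> carrier P; s \<in> carrier S\<rbrakk>
    \<Longrightarrow> t \<odot>\<^bsub>Q\<^esub> scale c s = scale c (s \<otimes>\<^bsub>S\<^esub> t)"
  by (auto simp: power_module_simps scale_def smult_mult_right intro!: restrict_ext)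

text \<open>The additive group generated by the vectors \<open>d s\<close>.  Negatives and \<open>S\<close>-multiples are covered,
  because they can be absorbed into the factor \<open>s\<close>.\<close>

inductive_set span :: "(nat \<Rightarrow> 'r) set \<Rightarrow> (nat \<Rightarrow> 's) set" for D where
  zero: "\<zero>\<^bsub>Q\<^esub> \<in> span D"
| scale: "\<lbrakk>d \<in> D; s \<in> carrier S\<rbrakk> \<Longrightarrow> scale d s \<in> span D"
| add: "\<lbrakk>v \<in> span D; w \<in> span D\<rbrakk> \<Longrightarrow> v \<oplus>\<^bsub>Q\<^esub> w \<in> span D"

lemma span_mono: "D \<subseteq> D' \<Longrightarrow> span D \<subseteq> span D'"
proof
  fix v assume "v \<in> span D" "D \<subseteq> D'"
  then show "v \<in> span D'" by (induction) (auto intro: span.intros)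
qed

lemma span_subset: "D \<subseteq> carrier P \<Longrightarrow> span D \<subseteq> carrier Q"
proof
  fix v assume "v \<in> span D" "D \<subseteq> carrier P"
  then show "v \<in> carrier Q"
  proof induction
    case (scale d s)
    then show ?case by (intro scale_closed) auto
  next
    case (add v w)
    then show ?case by (intro SP.M.a_closed)
  qed simp
qed

lemma span_submodule:
  assumes D: "D \<subseteq> carrier P"
  shows "submodule (span D) S Q"
  unfolding SP.submodule_iff
proof (intro conjI ballI)
  show "span D \<subseteq> carrier Q" by (rule span_subset[OF D])
  show "\<zero>\<^bsub>Q\<^esub> \<in> span D" by (rule span.zero)
  show "v \<oplus>\<^bsub>Q\<^esub> w \<in> span D" if "v \<in> span D" "w \<in> span D" for v w using that by (rule span.add)
  show "t \<odot>\<^bsub>Q\<^esub> v \<in> span D" if t: "t \<in> carrier S" and v: "v \<in> span D" for t v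
    using v
  proof induction
    case zero
    then show ?case using SP.smult_r_null[OF t] by (simp only: span.zero)
  next
    case (scale d s)
    then show ?case using t D by (subst smult_scale) (auto intro: span.scale)
  next
    case (add v w)
    then have "v \<in> carrier Q" "w \<in> carrier Q" using span_subset[OF D] by blast+
    then show ?case using add.IH by (simp add: SP.smult_r_distr[OF t] span.add)
  qed
qed

text \<open>Formulated with a parametrization \<open>\<iota>\<close> of \<open>D\<close>, because it is needed for \<open>D\<close> itself and for its
  copy made of singletons.\<close>

lemma linear_extension_image:
  assumes D: "D \<subseteq> carrier P" and \<iota>: "\<iota> ` carrier M = D"
  shows "linear_extension M S (add_monoid Q) (\<lambda>x s. scale (\<iota> x) s) `
    carrier (free_Abelian_group (carrier M \<times> carrier S)) = span D" (is "?l ` carrier ?F = _")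
proof -
  have G: "comm_group (add_monoid Q)" by (rule SP.M.a_comm_group)
  have closed: "scale (\<iota> x) s \<in> carrier (add_monoid Q)" if "x \<in> carrier M" "s \<in> carrier S" for x s
    using that D \<iota> scale_closed[of "\<iota> x" s] by auto
  have hom: "?l \<in> hom ?F (add_monoid Q)"
    using closed by (intro linear_extension_hom[OF G])
  interpret l: group_hom ?F "add_monoid Q" ?l
    using hom G by (simp add: group_hom_def group_hom_axioms_def comm_group_def)
  have frag: "?l (frag_of (x, s)) = scale (\<iota> x) s" if "x \<in> carrier M" "s \<in> carrier S" for x s
    using closed that by (intro linear_extension_frag_of[OF G])
  note sub = span_submodule[OF D]
  show ?thesis
  proof
    show "?l ` carrier ?F \<subseteq> span D"
    proof clarify
      fix c assume "c \<in> carrier ?F"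
      then have "Poly_Mapping.keys c \<subseteq> carrier M \<times> carrier S" by simp
      then have "c \<in> carrier ?F \<and> ?l c \<in> span D"
      proof (induction c rule: frag_induction)
        case zero
        then show ?case using l.hom_one span.zero by simp
      next
        case (one z)
        then show ?case using \<iota> frag by (auto intro!: span.scale)
      next
        case (diff a b)
        then have ab: "a \<in> carrier ?F" "b \<in> carrier ?F" "?l a \<in> span D" "?l b \<in> span D" by auto
        have "?l (a \<otimes>\<^bsub>?F\<^esub> inv\<^bsub>?F\<^esub> b) = ?l a \<oplus>\<^bsub>Q\<^esub> (\<ominus>\<^bsub>Q\<^esub> ?l b)"
          using ab(1,2) by (simp only: l.hom_mult l.hom_inv l.G.inv_closed) (simp add: a_inv_def)
        moreover have "?l a \<oplus>\<^bsub>Q\<^esub> (\<ominus>\<^bsub>Q\<^esub> ?l b) \<in> span D"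
          using ab SP.submoduleE(3)[OF sub] by (intro span.add)
        moreover have "a \<otimes>\<^bsub>?F\<^esub> inv\<^bsub>?F\<^esub> b \<in> carrier ?F" using ab by (intro l.G.m_closed l.G.inv_closed)
        ultimately show ?case using ab(2) by simp
      qed
      then show "?l c \<in> span D" by simp
    qed
    show "span D \<subseteq> ?l ` carrier ?F"
    proof
      fix v assume "v \<in> span D"
      then show "v \<in> ?l ` carrier ?F"
      proof induction
        case zero
        have "\<zero>\<^bsub>Q\<^esub> = ?l \<one>\<^bsub>?F\<^esub>" unfolding l.hom_one by simp
        then show ?case using l.G.one_closed by (rule image_eqI)
      next
        case (scale d s)
        then obtain x where "x \<in> carrier M" "d = \<iota> x" using \<iota> by auto
        then have "scale d s = ?l (frag_of (x, s))" "frag_of (x, s) \<in> carrier ?F"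
          using frag[of x s] scale by auto
        then show ?case by (rule image_eqI)
      next
        case (add v w)
        then obtain a b where ab: "a \<in> carrier ?F" "b \<in> carrier ?F" and vw: "v = ?l a" "w = ?l b"
          by blast
        have "v \<oplus>\<^bsub>Q\<^esub> w = ?l (a \<otimes>\<^bsub>?F\<^esub> b)" unfolding l.hom_mult[OF ab] vw by simp
        then show ?case using l.G.m_closed[OF ab] by (rule image_eqI)
      qed
    qed
  qed
qed

lemma balanced_scale:
  assumes "\<And>x. x \<in> carrier M \<Longrightarrow> \<iota> x \<in> carrier P"
    and "\<And>x y. \<lbrakk>x \<in> carrier M; y \<in> carrier M\<rbrakk> \<Longrightarrow> \<iota> (x \<oplus>\<^bsub>M\<^esub> y) = \<iota> x \<oplus>\<^bsub>P\<^esub> \<iota> y"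
    and "\<And>r x. \<lbrakk>r \<in> carrier R; x \<in> carrier M\<rbrakk> \<Longrightarrow> \<iota> (r \<odot>\<^bsub>M\<^esub> x) = r \<odot>\<^bsub>P\<^esub> \<iota> x"
  shows "balanced R M S (add_monoid Q) (\<lambda>x s. scale (\<iota> x) s)"
  unfolding balanced_def using assms
  by (simp add: scale_add_left scale_add_right scale_smult)

lemma extended_code_eq_span:
  assumes C: "submodule C R P"
  shows "extended_code R S n C = span C"
proof -
  have CP: "C \<subseteq> carrier P" using C unfolding RP.submodule_iff by blast
  have "Module.module R (submod R n C)"
    unfolding submod_def by (rule submodule.submodule_is_module[OF C]) (rule RP.module_axioms)
  then interpret tensor R "submod R n C" S
    using RS.module_axioms by (rule tensor.intro)
  have [simp]: "carrier (submod R n C) = C" "add (submod R n C) = add P" "smult (submod R n C) = smult P"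
    by (simp_all add: submod_def)
  have \<beta>: "(\<lambda>c s. \<lambda>j\<in>{1..n}. c j \<odot>\<^bsub>S\<^esub> s) = (\<lambda>c s. scale c s)" by (simp add: scale_def)
  have bal: "balanced R (submod R n C) S (add_monoid Q) (\<lambda>c s. scale c s)"
    by (rule balanced_scale) (use CP in \<open>auto\<close>)
  have "extended_code R S n C =
      (\<lambda>c. tensor_lift (submod R n C) S (add_monoid Q) (\<lambda>c s. scale c s) (K #>\<^bsub>F\<^esub> c)) ` carrier F"
    unfolding extended_code_def carrier_T \<beta> by (simp add: image_image)
  also have "\<dots> = linear_extension (submod R n C) S (add_monoid Q) (\<lambda>c s. scale c s) ` carrier F"
    using tensor_lift_coset[OF SP.M.a_comm_group bal] by (intro image_cong refl)
  also have "\<dots> = span C"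
    by (rule linear_extension_image[OF CP]) simp
  finally show ?thesis .
qed

text \<open>A copy of the module \<open>D\<close> whose elements are sets of vectors: flatness is formulated for modules
  with elements of this type.\<close>

definition singletons :: "(nat \<Rightarrow> 'r) set \<Rightarrow> ('r, (nat \<Rightarrow> 'r) set) module" where
  "singletons D =
    \<lparr>carrier = (\<lambda>v. {v}) ` D, mult = (\<lambda>X Y. X), one = {\<zero>\<^bsub>P\<^esub>}, zero = {\<zero>\<^bsub>P\<^esub>},
     add = (\<lambda>X Y. {the_elem X \<oplus>\<^bsub>P\<^esub> the_elem Y}), smult = (\<lambda>r X. {r \<odot>\<^bsub>P\<^esub> the_elem X})\<rparr>"

lemma singletons_simps [simp]:
  "carrier (singletons D) = (\<lambda>v. {v}) ` D"
  "zero (singletons D) = {\<zero>\<^bsub>P\<^esub>}"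
  "add (singletons D) X Y = {the_elem X \<oplus>\<^bsub>P\<^esub> the_elem Y}"
  "smult (singletons D) r X = {r \<odot>\<^bsub>P\<^esub> the_elem X}"
  by (simp_all add: singletons_def)

lemma singletons_module:
  assumes D: "submodule D R P"
  shows "Module.module R (singletons D)"
proof -
  have c: "D \<subseteq> carrier P" "\<zero>\<^bsub>P\<^esub> \<in> D" "\<And>x y. \<lbrakk>x \<in> D; y \<in> D\<rbrakk> \<Longrightarrow> x \<oplus>\<^bsub>P\<^esub> y \<in> D"
      "\<And>r x. \<lbrakk>r \<in> carrier R; x \<in> D\<rbrakk> \<Longrightarrow> r \<odot>\<^bsub>P\<^esub> x \<in> D"
    using D unfolding RP.submodule_iff by blast+
  have neg: "\<exists>y\<in>D. y \<oplus>\<^bsub>P\<^esub> x = \<zero>\<^bsub>P\<^esub>" if "x \<in> D" for x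
    using RP.submoduleE(3)[OF D that] that c(1) RP.M.l_neg by blast
  have cP: "x \<in> carrier P" if "x \<in> D" for x using that c(1) by blast
  show ?thesis
  proof (rule moduleI)
    show "abelian_group (singletons D)"
    proof (rule abelian_groupI)
      fix X assume "X \<in> carrier (singletons D)"
      then obtain x where x: "X = {x}" "x \<in> D" by auto
      with neg[of x] obtain y where "y \<in> D" "y \<oplus>\<^bsub>P\<^esub> x = \<zero>\<^bsub>P\<^esub>" by blast
      then show "\<exists>Y\<in>carrier (singletons D). Y \<oplus>\<^bsub>singletons D\<^esub> X = \<zero>\<^bsub>singletons D\<^esub>"
        using x by (auto)
    next
      fix X Y Z
      assume "X \<in> carrier (singletons D)" "Y \<in> carrier (singletons D)" "Z \<in> carrier (singletons D)"
      then show "X \<oplus>\<^bsub>singletons D\<^esub> Y \<oplus>\<^bsub>singletons D\<^esub> Z =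
          X \<oplus>\<^bsub>singletons D\<^esub> (Y \<oplus>\<^bsub>singletons D\<^esub> Z)"
        using cP by (auto simp: RP.M.a_assoc)
    next
      fix X Y assume "X \<in> carrier (singletons D)" "Y \<in> carrier (singletons D)"
      then show "X \<oplus>\<^bsub>singletons D\<^esub> Y = Y \<oplus>\<^bsub>singletons D\<^esub> X"
        using cP by (auto intro: RP.M.a_comm)
    qed (use c cP in \<open>auto\<close>)
  qed (use c cP in \<open>auto
         simp add: R.is_cring RP.smult_l_distr RP.smult_r_distr RP.smult_assoc1\<close>)
qed

end


section \<open>Flatness as a universal property of spans\<close>

context flat_algebra
begin

definition unit_vector :: "nat \<Rightarrow> nat \<Rightarrow> 'r" where
  "unit_vector i = (\<lambda>j\<in>{1..n}. if j = i then \<one>\<^bsub>R\<^esub> else \<zero>\<^bsub>R\<^esub>)"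

lemma unit_vector_closed [simp]: "unit_vector i \<in> carrier P"
  by (auto simp: unit_vector_def power_module_simps)

abbreviation pure :: "(nat \<Rightarrow> 'r) \<Rightarrow> 's \<Rightarrow> ((nat \<Rightarrow> 'r) set \<times> 's \<Rightarrow>\<^sub>0 int) set" where
  "pure v s \<equiv> pure_tensor R (singletons (carrier P)) S {v} s"

text \<open>The inverse \<open>S\<^sup>n \<rightarrow> R\<^sup>n \<otimes> S\<close> of the identification, which sends \<open>w\<close> to the sum of the tensors
  \<open>e\<^sub>i \<otimes> w\<^sub>i\<close>.  The group of the tensor product is written multiplicatively.\<close>

definition recombine :: "(nat \<Rightarrow> 's) \<Rightarrow> ((nat \<Rightarrow> 'r) set \<times> 's \<Rightarrow>\<^sub>0 int) set" where
  "recombine w = finprod (tensor_product R (singletons (carrier P)) S)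
     (\<lambda>i. pure (unit_vector i) (w i)) {1..n}"

sublocale PS: tensor R "singletons (carrier P)" S
  using singletons_module[OF RP.carrier_is_submodule] RS.module_axioms by (rule tensor.intro)

lemma pure_closed [simp]: "\<lbrakk>v \<in> carrier P; s \<in> carrier S\<rbrakk> \<Longrightarrow> pure v s \<in> carrier PS.T"
  using PS.pure_tensor_balanced unfolding balanced_def by auto

lemma pure_add_left:
  "\<lbrakk>v \<in> carrier P; w \<in> carrier P; s \<in> carrier S\<rbrakk>
    \<Longrightarrow> pure (v \<oplus>\<^bsub>P\<^esub> w) s = pure v s \<otimes>\<^bsub>PS.T\<^esub> pure w s"
  using PS.pure_tensor_balanced unfolding balanced_def by auto

lemma pure_add_right:
  "\<lbrakk>v \<in> carrier P; s \<in> carrier S; t \<in> carrier S\<rbrakk>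
    \<Longrightarrow> pure v (s \<oplus>\<^bsub>S\<^esub> t) = pure v s \<otimes>\<^bsub>PS.T\<^esub> pure v t"
  using PS.pure_tensor_balanced unfolding balanced_def by auto

lemma pure_smult:
  "\<lbrakk>r \<in> carrier R; v \<in> carrier P; s \<in> carrier S\<rbrakk>
    \<Longrightarrow> pure (r \<odot>\<^bsub>P\<^esub> v) s = pure v (r \<odot>\<^bsub>S\<^esub> s)"
  using PS.pure_tensor_balanced unfolding balanced_def by auto

lemma pure_zero: "s \<in> carrier S \<Longrightarrow> pure \<zero>\<^bsub>P\<^esub> s = \<one>\<^bsub>PS.T\<^esub>"
  using pure_add_left[of "\<zero>\<^bsub>P\<^esub>" "\<zero>\<^bsub>P\<^esub>" s] PS.T.l_cancel_one[of "pure \<zero>\<^bsub>P\<^esub> s" "pure \<zero>\<^bsub>P\<^esub> s"]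
  by simp

lemma recombine_hom: "recombine \<in> hom (add_monoid Q) PS.T"
proof (rule homI)
  fix w assume "w \<in> carrier (add_monoid Q)"
  then have "w i \<in> carrier S" if "i \<in> {1..n}" for i using that by (auto simp: power_module_simps)
  then show "recombine w \<in> carrier PS.T"
    unfolding recombine_def by (intro PS.T.finprod_closed) (auto intro!: pure_closed)
next
  fix w w' assume "w \<in> carrier (add_monoid Q)" "w' \<in> carrier (add_monoid Q)"
  then have c: "w i \<in> carrier S" "w' i \<in> carrier S" if "i \<in> {1..n}" for i
    using that by (auto simp: power_module_simps)
  have "recombine (w \<oplus>\<^bsub>Q\<^esub> w') = finprod PS.T
      (\<lambda>i. pure (unit_vector i) (w i) \<otimes>\<^bsub>PS.T\<^esub> pure (unit_vector i) (w' i)) {1..n}"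
    unfolding recombine_def
    by (rule PS.T.finprod_cong') (use c in \<open>auto simp: power_module_simps(3) pure_add_right intro!: pure_closed\<close>)
  also have "\<dots> = recombine w \<otimes>\<^bsub>PS.T\<^esub> recombine w'"
    unfolding recombine_def by (intro PS.T.finprod_multf) (use c in \<open>auto intro!: pure_closed\<close>)
  finally show "recombine (w \<otimes>\<^bsub>add_monoid Q\<^esub> w') = recombine w \<otimes>\<^bsub>PS.T\<^esub> recombine w'" by simp
qed

text \<open>The decomposition \<open>v = \<Sum> v\<^sub>i e\<^sub>i\<close>, proved by induction for the truncations of \<open>v\<close> to the first
  \<open>k\<close> coordinates.\<close>

lemma recombine_scale:
  assumes v: "v \<in> carrier P" and s: "s \<in> carrier S"
  shows "recombine (scale v s) = pure v s"
proof -
  define tr where "tr k = (\<lambda>j\<in>{1..n}. if j \<le> k then v j else \<zero>\<^bsub>R\<^esub>)" for k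
  have vj: "v j \<in> carrier R" if "j \<in> {1..n}" for j using that v by (auto simp: power_module_simps)
  have tr: "tr k \<in> carrier P" for k using vj by (auto simp: tr_def power_module_simps)
  have "pure (tr k) s = finprod PS.T (\<lambda>i. pure (unit_vector i) (v i \<odot>\<^bsub>S\<^esub> s)) {1..k}" if "k \<le> n" for k
    using that
  proof (induction k)
    case 0
    have "tr 0 = \<zero>\<^bsub>P\<^esub>" by (auto simp: tr_def power_module_simps intro!: restrict_ext)
    then show ?case using pure_zero[OF s] by simp
  next
    case (Suc k)
    then have vk: "v (Suc k) \<in> carrier R" by (intro vj) simp
    have "tr (Suc k) = tr k \<oplus>\<^bsub>P\<^esub> (v (Suc k) \<odot>\<^bsub>P\<^esub> unit_vector (Suc k))"
      using vj vk by (auto simp: tr_def unit_vector_def power_module_simps fun_eq_iff restrict_def le_Suc_eq)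
    then have "pure (tr (Suc k)) s = pure (tr k) s \<otimes>\<^bsub>PS.T\<^esub> pure (unit_vector (Suc k)) (v (Suc k) \<odot>\<^bsub>S\<^esub> s)"
      using vk s tr by (simp add: pure_add_left pure_smult)
    also have "\<dots> = pure (unit_vector (Suc k)) (v (Suc k) \<odot>\<^bsub>S\<^esub> s) \<otimes>\<^bsub>PS.T\<^esub> pure (tr k) s"
      using vk s tr by (intro PS.T.m_comm pure_closed unit_vector_closed RS.smult_closed)
    also have "pure (tr k) s = finprod PS.T (\<lambda>i. pure (unit_vector i) (v i \<odot>\<^bsub>S\<^esub> s)) {1..k}"
      using Suc by simp
    also have "pure (unit_vector (Suc k)) (v (Suc k) \<odot>\<^bsub>S\<^esub> s) \<otimes>\<^bsub>PS.T\<^esub> \<dots> =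
        finprod PS.T (\<lambda>i. pure (unit_vector i) (v i \<odot>\<^bsub>S\<^esub> s)) (insert (Suc k) {1..k})"
      using vj vk s Suc.prems by (subst PS.T.finprod_insert) auto
    also have "insert (Suc k) {1..k} = {1..Suc k}" by auto
    finally show ?case .
  qed
  from this[of n] have "pure (tr n) s = finprod PS.T (\<lambda>i. pure (unit_vector i) (v i \<odot>\<^bsub>S\<^esub> s)) {1..n}"
    by simp
  also have "\<dots> = recombine (scale v s)"
    unfolding recombine_def using vj s
    by (intro PS.T.finprod_cong') (auto simp: scale_def)
  also have "tr n = v"
    using v by (intro vector_eqI[of _ n "carrier R" _ "carrier R"])
      (auto simp: tr_def power_module_simps)
  finally show ?thesis by simp
qed

text \<open>Here flatness enters.  If \<open>\<Sum> d s = 0\<close> in \<open>S\<^sup>n\<close>, then \<open>\<Sum> d \<otimes> s = 0\<close> in \<open>R\<^sup>n \<otimes> S\<close>, because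
  \<open>recombine\<close> maps the first sum to the second.  The inclusion of \<open>D\<close> in \<open>R\<^sup>n\<close> stays injective after
  tensoring with \<open>S\<close>, so already \<open>\<Sum> d \<otimes> s = 0\<close> in \<open>D \<otimes> S\<close>.\<close>

lemma linear_extension_scale_kernel:
  assumes D: "submodule D R P"
    and c: "c \<in> carrier (free_Abelian_group (carrier (singletons D) \<times> carrier S))"
    and zero: "linear_extension (singletons D) S (add_monoid Q) (\<lambda>X s. scale (the_elem X) s) c = \<zero>\<^bsub>Q\<^esub>"
  shows "c \<in> tensor_kernel R (singletons D) S"
proof -
  let ?M = "singletons D" and ?N = "singletons (carrier P)"
  have DP: "D \<subseteq> carrier P" using D unfolding RP.submodule_iff by blast
  interpret DS: tensor R ?M S
    using singletons_module[OF D] RS.module_axioms by (rule tensor.intro)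
  let ?b = "\<lambda>X s. pure_tensor R ?N S X s"
  let ?lp = "linear_extension ?M S PS.T ?b"
  let ?ls = "linear_extension ?M S (add_monoid Q) (\<lambda>X s. scale (the_elem X) s)"
  have bal: "balanced R ?M S PS.T ?b"
    using PS.pure_tensor_balanced DP unfolding balanced_def by (auto simp: subset_iff)
  have lp: "?lp \<in> hom DS.F PS.T"
    by (rule linear_extension_hom[OF PS.T_comm_group]) (use bal in \<open>auto simp: balanced_def\<close>)
  have G: "comm_group (add_monoid Q)" by (rule SP.M.a_comm_group)
  have sc: "scale (the_elem X) s \<in> carrier (add_monoid Q)" if "X \<in> carrier ?M" "s \<in> carrier S" for X s
    using that DP scale_closed[of "the_elem X" s] by auto
  have ls: "?ls \<in> hom DS.F (add_monoid Q)"
    using sc by (intro linear_extension_hom[OF G])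
  have comp: "?lp a = recombine (?ls a)" if a: "a \<in> carrier DS.F" for a
  proof -
    have "?lp a = (recombine \<circ> ?ls) a"
    proof (rule hom_free_Abelian_group_eq[OF PS.T.is_group lp _ _ a])
      show "recombine \<circ> ?ls \<in> hom DS.F PS.T" by (rule hom_compose[OF ls recombine_hom])
      fix z assume "z \<in> carrier ?M \<times> carrier S"
      then obtain d s where z: "z = ({d}, s)" "d \<in> D" "s \<in> carrier S" by auto
      have "?lp (frag_of z) = pure d s"
        unfolding z(1) by (rule linear_extension_frag_of[OF PS.T_comm_group])
          (use bal z in \<open>auto simp: balanced_def\<close>)
      moreover have "?ls (frag_of z) = scale d s"
        unfolding z(1) using linear_extension_frag_of[OF G, where x = "{d}" and y = s
          and M = ?M and N = S and \<beta> = "\<lambda>X s. scale (the_elem X) s"] sc z by auto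
      ultimately show "?lp (frag_of z) = (recombine \<circ> ?ls) (frag_of z)"
        using recombine_scale[of d s] z DP by auto
    qed
    then show ?thesis by simp
  qed
  have id: "(\<lambda>X. X) \<in> module_homs R ?M ?N"
    using DP by (auto simp: module_homs_def)
  have inj: "inj_on (tensor_lift ?M S PS.T ?b) (carrier DS.T)"
    using flat[unfolded flat_module_def, THEN conjunct2, rule_format, OF id DS.M PS.M] by simp
  have zero_F: "0 \<in> carrier DS.F" by simp
  have rz: "recombine \<zero>\<^bsub>Q\<^esub> = \<one>\<^bsub>PS.T\<^esub>"
    using hom_one[OF recombine_hom] SP.M.a_group PS.T.is_group by simp
  have "?ls 0 = \<zero>\<^bsub>Q\<^esub>"
    using hom_one[OF ls DS.F.is_group] SP.M.a_group by simp
  then have "tensor_lift ?M S PS.T ?b (DS.K #>\<^bsub>DS.F\<^esub> c) = tensor_lift ?M S PS.T ?b (DS.K #>\<^bsub>DS.F\<^esub> 0)"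
    using comp[OF c] comp[OF zero_F] zero
    by (simp only: DS.tensor_lift_coset[OF PS.T_comm_group bal c] DS.tensor_lift_coset[OF PS.T_comm_group bal zero_F])
  then have "DS.K #>\<^bsub>DS.F\<^esub> c = DS.K #>\<^bsub>DS.F\<^esub> 0"
    by (rule inj_onD[OF inj]) (use c zero_F in \<open>simp_all only: DS.carrier_T imageI\<close>)
  also have "\<dots> = DS.K"
    using DS.F.coset_mult_one[of DS.K] subgroup.subset[OF DS.kernel_subgroup] by simp
  finally show ?thesis
    using DS.F.rcos_self[OF c DS.kernel_subgroup] by simp
qed

text \<open>The universal property of \<open>D \<otimes> S\<close>, carried over to the submodule \<open>D S\<close> of \<open>S\<^sup>n\<close>.\<close>

lemma span_lift:
  fixes G :: "('g, 'h) monoid_scheme"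
  assumes D: "submodule D R P" and G: "comm_group G" and \<beta>: "balanced R (submod R n D) S G \<beta>"
  obtains h where "\<And>d s. \<lbrakk>d \<in> D; s \<in> carrier S\<rbrakk> \<Longrightarrow> h (scale d s) = \<beta> d s"
    and "\<And>v w. \<lbrakk>v \<in> span D; w \<in> span D\<rbrakk> \<Longrightarrow> h (v \<oplus>\<^bsub>Q\<^esub> w) = h v \<otimes>\<^bsub>G\<^esub> h w"
    and "h \<zero>\<^bsub>Q\<^esub> = \<one>\<^bsub>G\<^esub>"
proof -
  let ?M = "singletons D"
  have DP: "D \<subseteq> carrier P" using D unfolding RP.submodule_iff by blast
  interpret DS: tensor R ?M S
    using singletons_module[OF D] RS.module_axioms by (rule tensor.intro)
  interpret G: comm_group G by fact
  let ?b = "\<lambda>X s. \<beta> (the_elem X) s"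
  let ?l = "linear_extension ?M S G ?b"
  let ?ls = "linear_extension ?M S (add_monoid Q) (\<lambda>X s. scale (the_elem X) s)"
  have bal: "balanced R ?M S G ?b"
    using \<beta> by (auto simp: balanced_def submod_def)
  have GQ: "comm_group (add_monoid Q)" by (rule SP.M.a_comm_group)
  have bc: "?b X s \<in> carrier G" if "X \<in> carrier ?M" "s \<in> carrier S" for X s
    using bal that by (auto simp: balanced_def)
  have sc: "scale (the_elem X) s \<in> carrier (add_monoid Q)" if "X \<in> carrier ?M" "s \<in> carrier S" for X s
    using that DP scale_closed[of "the_elem X" s] by auto
  interpret l: group_hom DS.F G ?l
    using linear_extension_hom[OF G, where M = ?M and N = S and \<beta> = ?b] bc
    by (simp add: group_hom_def group_hom_axioms_def DS.F.is_group)
  interpret ls: group_hom DS.F "add_monoid Q" ?ls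
    using linear_extension_hom[OF GQ, where M = ?M and N = S
      and \<beta> = "\<lambda>X s. scale (the_elem X) s"] sc SP.M.a_group
    by (simp add: group_hom_def group_hom_axioms_def DS.F.is_group)
  have img: "?ls ` carrier DS.F = span D"
    by (rule linear_extension_image[OF DP]) (auto simp: image_iff)
  have well: "?l a = ?l b" if a: "a \<in> carrier DS.F" and b: "b \<in> carrier DS.F" and eq: "?ls a = ?ls b" for a b
  proof -
    have inv: "inv\<^bsub>DS.F\<^esub> b \<in> carrier DS.F" using b by (rule DS.F.inv_closed)
    let ?c = "a \<otimes>\<^bsub>DS.F\<^esub> inv\<^bsub>DS.F\<^esub> b"
    have c: "?c \<in> carrier DS.F" using a inv by (rule DS.F.m_closed)
    have "?ls ?c = ?ls b \<otimes>\<^bsub>add_monoid Q\<^esub> inv\<^bsub>add_monoid Q\<^esub> ?ls b"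
      unfolding ls.hom_mult[OF a inv] ls.hom_inv[OF b] eq ..
    also have "\<dots> = \<zero>\<^bsub>Q\<^esub>"
      using group.r_inv[OF SP.M.a_group ls.hom_closed[OF b]] by simp
    finally have "?c \<in> DS.K" by (rule linear_extension_scale_kernel[OF D c])
    then have "?l ?c = \<one>\<^bsub>G\<^esub>" by (rule DS.linear_extension_kernel[OF G bal])
    then have "?l a \<otimes>\<^bsub>G\<^esub> inv\<^bsub>G\<^esub> ?l b = \<one>\<^bsub>G\<^esub>"
      unfolding l.hom_mult[OF a inv] l.hom_inv[OF b] .
    then show ?thesis using l.hom_closed[OF a] l.hom_closed[OF b] by (metis G.inv_equality G.inv_inv G.inv_closed)
  qed
  \<comment> \<open>Any representation of \<open>v\<close> as a sum of vectors \<open>d s\<close> will do: \<open>well\<close> says that the value does not depend on it.\<close>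
  define h where "h v = ?l (SOME a. a \<in> carrier DS.F \<and> ?ls a = v)" for v
  have h: "h (?ls a) = ?l a" if a: "a \<in> carrier DS.F" for a
  proof -
    have "(SOME b. b \<in> carrier DS.F \<and> ?ls b = ?ls a) \<in> carrier DS.F \<and>
        ?ls (SOME b. b \<in> carrier DS.F \<and> ?ls b = ?ls a) = ?ls a"
      by (rule someI[of "\<lambda>b. b \<in> carrier DS.F \<and> ?ls b = ?ls a" a]) (use a in blast)
    then show ?thesis unfolding h_def using a by (intro well) blast+
  qed
  show thesis
  proof (rule that[of h])
    fix d s assume ds: "d \<in> D" "s \<in> carrier S"
    then have "frag_of ({d}, s) \<in> carrier DS.F" by simp
    from h[OF this] show "h (scale d s) = \<beta> d s"
      using linear_extension_frag_of[OF G, where x = "{d}" and y = s and M = ?M and N = S and \<beta> = ?b] bc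
        linear_extension_frag_of[OF GQ, where x = "{d}" and y = s and M = ?M and N = S
          and \<beta> = "\<lambda>X s. scale (the_elem X) s"] sc ds by simp
  next
    fix v w assume "v \<in> span D" "w \<in> span D"
    then obtain a b where ab: "a \<in> carrier DS.F" "b \<in> carrier DS.F" and vw: "v = ?ls a" "w = ?ls b"
      unfolding img[symmetric] by blast
    have "v \<oplus>\<^bsub>Q\<^esub> w = ?ls (a \<otimes>\<^bsub>DS.F\<^esub> b)" unfolding ls.hom_mult[OF ab] vw by simp
    then show "h (v \<oplus>\<^bsub>Q\<^esub> w) = h v \<otimes>\<^bsub>G\<^esub> h w"
      unfolding vw h[OF ab(1)] h[OF ab(2)] l.hom_mult[OF ab, symmetric]
      using h[OF DS.F.m_closed[OF ab]] by simp
  next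
    have "\<zero>\<^bsub>Q\<^esub> = ?ls \<one>\<^bsub>DS.F\<^esub>" unfolding ls.hom_one by simp
    then show "h \<zero>\<^bsub>Q\<^esub> = \<one>\<^bsub>G\<^esub>" using h[OF DS.F.one_closed] l.hom_one by simp
  qed
qed

end


section \<open>Supports and extension of scalars\<close>

lemma supported_in_iff:
  "v \<in> supported_in R n D A \<longleftrightarrow> v \<in> D \<and> (\<forall>j\<in>{1..n}. j \<notin> A \<longrightarrow> v j = \<zero>\<^bsub>R\<^esub>)"
  by (auto simp: supported_in_def supp_def)

lemma (in cring) submodule_supported_in:
  assumes "submodule D R (power_module R n)"
  shows "submodule (supported_in R n D A) R (power_module R n)"
proof -
  interpret P: Module.module R "power_module R n" by (rule power_module)
  show ?thesis
    using assms unfolding P.submodule_iff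
    by (simp add: subset_iff supported_in_iff power_module_simps)
qed

text \<open>The linear map whose kernel on a code \<open>D\<close> is the subcode \<open>D(A)\<close>.\<close>

definition puncture :: "('a, 'm) ring_scheme \<Rightarrow> nat \<Rightarrow> nat set \<Rightarrow> (nat \<Rightarrow> 'a) \<Rightarrow> nat \<Rightarrow> 'a" where
  "puncture R n A v = (\<lambda>j\<in>{1..n}. if j \<in> A then \<zero>\<^bsub>R\<^esub> else v j)"

lemma (in cring) puncture_closed: "v \<in> carrier (power_module R n) \<Longrightarrow> puncture R n A v \<in> carrier (power_module R n)"
  by (auto simp: puncture_def power_module_simps)

lemma (in cring) puncture_add:
  "\<lbrakk>v \<in> carrier (power_module R n); w \<in> carrier (power_module R n)\<rbrakk> \<Longrightarrow>
    puncture R n A (v \<oplus>\<^bsub>power_module R n\<^esub> w) =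
    puncture R n A v \<oplus>\<^bsub>power_module R n\<^esub> puncture R n A w"
  by (auto simp: puncture_def power_module_simps intro!: restrict_ext)

lemma (in cring) puncture_smult:
  "\<lbrakk>r \<in> carrier R; v \<in> carrier (power_module R n)\<rbrakk> \<Longrightarrow>
    puncture R n A (r \<odot>\<^bsub>power_module R n\<^esub> v) = r \<odot>\<^bsub>power_module R n\<^esub> puncture R n A v"
  by (auto simp: puncture_def power_module_simps intro!: restrict_ext)

lemma puncture_zero: "puncture R n A \<zero>\<^bsub>power_module R n\<^esub> = \<zero>\<^bsub>power_module R n\<^esub>"
  by (auto simp: puncture_def power_module_simps intro!: restrict_ext)

lemma (in cring) puncture_eq_zero_iff:
  "puncture R n A v = \<zero>\<^bsub>power_module R n\<^esub> \<longleftrightarrow> (\<forall>j\<in>{1..n}. j \<notin> A \<longrightarrow> v j = \<zero>)"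
  by (auto simp: puncture_def power_module_simps fun_eq_iff restrict_def)

lemma (in cring) submodule_puncture_image:
  assumes "submodule D R (power_module R n)"
  shows "submodule (puncture R n A ` D) R (power_module R n)"
proof -
  interpret P: Module.module R "power_module R n" by (rule power_module)
  have D: "D \<subseteq> carrier (power_module R n)" "\<zero>\<^bsub>power_module R n\<^esub> \<in> D"
    "\<And>v w. \<lbrakk>v \<in> D; w \<in> D\<rbrakk> \<Longrightarrow> v \<oplus>\<^bsub>power_module R n\<^esub> w \<in> D"
    "\<And>r v. \<lbrakk>r \<in> carrier R; v \<in> D\<rbrakk> \<Longrightarrow> r \<odot>\<^bsub>power_module R n\<^esub> v \<in> D"
    using assms unfolding P.submodule_iff by blast+
  show ?thesis
    unfolding P.submodule_iff
  proof (intro conjI ballI)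
    show "puncture R n A ` D \<subseteq> carrier (power_module R n)" using D(1) puncture_closed by blast
    show "\<zero>\<^bsub>power_module R n\<^esub> \<in> puncture R n A ` D"
      using puncture_zero[of R n A, symmetric] D(2) by (rule image_eqI)
  next
    fix x y assume "x \<in> puncture R n A ` D" "y \<in> puncture R n A ` D"
    then obtain v w where "x = puncture R n A v" "y = puncture R n A w" "v \<in> D" "w \<in> D" by blast
    then show "x \<oplus>\<^bsub>power_module R n\<^esub> y \<in> puncture R n A ` D"
      using puncture_add[of v n w A] D(1,3) by (metis image_eqI subsetD)
  next
    fix r x assume r: "r \<in> carrier R" and "x \<in> puncture R n A ` D"
    then obtain v where "x = puncture R n A v" "v \<in> D" by blast
    then show "r \<odot>\<^bsub>power_module R n\<^esub> x \<in> puncture R n A ` D"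
      using puncture_smult[OF r, of v n A] D(1,4) r by (metis image_eqI subsetD)
  qed
qed

context flat_algebra
begin

lemma puncture_scale:
  assumes c: "c \<in> carrier P" and s: "s \<in> carrier S"
  shows "puncture S n A (scale c s) = scale (puncture R n A c) s"
  using assms by (auto simp: puncture_def scale_def power_module_simps intro!: restrict_ext)

lemma scale_minus:
  assumes "c \<in> carrier P" "d \<in> carrier P" "s \<in> carrier S"
  shows "scale c s \<ominus>\<^bsub>Q\<^esub> scale d s = scale (c \<ominus>\<^bsub>P\<^esub> d) s"
proof -
  have cd: "c \<ominus>\<^bsub>P\<^esub> d \<in> carrier P" using assms by (intro RP.M.minus_closed)
  have "(c \<ominus>\<^bsub>P\<^esub> d) \<oplus>\<^bsub>P\<^esub> d = c"
    using assms cd by (metis RP.M.add.inv_solve_right RP.M.minus_eq)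
  then have "scale c s = scale (c \<ominus>\<^bsub>P\<^esub> d) s \<oplus>\<^bsub>Q\<^esub> scale d s"
    using scale_add_left[OF cd assms(2,3)] by simp
  moreover have "scale c s \<in> carrier Q" "scale d s \<in> carrier Q" "scale (c \<ominus>\<^bsub>P\<^esub> d) s \<in> carrier Q"
    using assms cd by simp_all
  ultimately show ?thesis by (metis SP.M.add.inv_solve_right SP.M.minus_eq)
qed

text \<open>The nontrivial inclusion says that the sequence \<open>0 \<rightarrow> C(A) \<rightarrow> C \<rightarrow> f C \<rightarrow> 0\<close>, where \<open>f\<close> is
  puncturing, stays exact at \<open>C\<close> after extension of scalars.  The homomorphism \<open>h\<close> from \<open>(f C) S\<close>
  to \<open>S\<^sup>n / C(A) S\<close> recovers the class of \<open>v \<in> C S\<close> from \<open>f v\<close>.\<close>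

lemma supported_in_span:
  assumes C: "submodule C R P"
  shows "supported_in S n (span C) A = span (supported_in R n C A)" (is "_ = span ?CA")
proof
  have CP: "C \<subseteq> carrier P" using C unfolding RP.submodule_iff by blast
  have CA: "submodule ?CA R P" by (rule R.submodule_supported_in[OF C])
  have CAC: "?CA \<subseteq> C" by (auto simp: supported_in_def)
  have CAP: "?CA \<subseteq> carrier P" using CAC CP by blast
  show "span ?CA \<subseteq> supported_in S n (span C) A"
  proof
    fix v assume v: "v \<in> span ?CA"
    then have "\<forall>j\<in>{1..n}. j \<notin> A \<longrightarrow> v j = \<zero>\<^bsub>S\<^esub>"
    proof induction
      case (scale d s)
      then show ?case by (auto simp: supported_in_iff scale_def)
    qed (auto simp: power_module_simps)
    then show "v \<in> supported_in S n (span C) A"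
      using span_mono[OF CAC] v by (auto simp: supported_in_iff)
  qed
  let ?N = "span ?CA" and ?f = "puncture R n A" and ?fS = "puncture S n A"
  interpret N: abelian_subgroup ?N Q
    by (rule SP.submodule_abelian_subgroup[OF span_submodule[OF CAP]])
  let ?q = "\<lambda>v. ?N +>\<^bsub>Q\<^esub> v"
  \<comment> \<open>A preimage under puncturing; by \<open>wd\<close> its choice does not matter modulo \<open>C(A) S\<close>.\<close>
  define lift where "lift d = (SOME c. c \<in> C \<and> ?f c = d)" for d
  have lift: "lift (?f c) \<in> C \<and> ?f (lift (?f c)) = ?f c" if "c \<in> C" for c
    unfolding lift_def by (rule someI[of "\<lambda>b. b \<in> C \<and> ?f b = ?f c" c]) (use that in blast)
  have wd: "?q (scale c s) = ?q (scale c' s)"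
    if "c \<in> C" "c' \<in> C" "?f c = ?f c'" "s \<in> carrier S" for c c' s
  proof (rule N.rcoset_eqI)
    have cP: "c \<in> carrier P" "c' \<in> carrier P" using that CP by blast+
    show "scale c s \<in> carrier Q" "scale c' s \<in> carrier Q" using cP that by simp_all
    have "c \<ominus>\<^bsub>P\<^esub> c' \<in> C" using RP.submodule_minus_closed[OF C] that by blast
    moreover have "(c \<ominus>\<^bsub>P\<^esub> c') j = \<zero>\<^bsub>R\<^esub>" if j: "j \<in> {1..n}" "j \<notin> A" for j
    proof -
      have "c j = c' j" using fun_cong[OF \<open>?f c = ?f c'\<close>, of j] j by (simp add: puncture_def)
      moreover have "c' j \<in> carrier R" using cP(2) j by (auto simp: power_module_simps)
      ultimately show ?thesis
        using power_module_minus[OF R.is_cring cP j(1)] by (simp add: R.minus_eq R.r_neg)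
    qed
    ultimately have "c \<ominus>\<^bsub>P\<^esub> c' \<in> ?CA" by (simp add: supported_in_iff)
    then show "scale c s \<ominus>\<^bsub>Q\<^esub> scale c' s \<in> ?N"
      unfolding scale_minus[OF cP that(4)] using that(4) by (rule span.scale)
  qed
  define \<beta> where "\<beta> d s = ?q (scale (lift d) s)" for d s
  have \<beta>: "\<beta> (?f c) s = ?q (scale c s)" if "c \<in> C" "s \<in> carrier S" for c s
    unfolding \<beta>_def using lift[OF that(1)] that by (intro wd) auto
  have D: "submodule (?f ` C) R P" by (rule R.submodule_puncture_image[OF C])
  have q_add: "?q v \<otimes>\<^bsub>Q A_Mod ?N\<^esub> ?q w = ?q (v \<oplus>\<^bsub>Q\<^esub> w)" if "v \<in> carrier Q" "w \<in> carrier Q" for v w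
    using N.a_rcos_sum[OF that] by simp
  have bal: "balanced R (submod R n (?f ` C)) S (Q A_Mod ?N) \<beta>"
  proof -
    have clC: "c \<oplus>\<^bsub>P\<^esub> d \<in> C" "r \<odot>\<^bsub>P\<^esub> c \<in> C" if "c \<in> C" "d \<in> C" "r \<in> carrier R" for c d r
      using C that unfolding RP.submodule_iff by blast+
    have 1: "\<beta> (?f c) s \<in> carrier (Q A_Mod ?N)" if "c \<in> C" "s \<in> carrier S" for c s
      using \<beta>[OF that] that CP by (auto simp: N.quotient_simps intro!: SP.M.a_rcosetsI[OF N.a_subset])
    have 2: "\<beta> (?f c \<oplus>\<^bsub>P\<^esub> ?f d) s = \<beta> (?f c) s \<otimes>\<^bsub>Q A_Mod ?N\<^esub> \<beta> (?f d) s"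
      if "c \<in> C" "d \<in> C" "s \<in> carrier S" for c d s
    proof -
      have cd: "c \<in> carrier P" "d \<in> carrier P" "c \<oplus>\<^bsub>P\<^esub> d \<in> C" using that CP clC by blast+
      then have "\<beta> (?f c \<oplus>\<^bsub>P\<^esub> ?f d) s = ?q (scale (c \<oplus>\<^bsub>P\<^esub> d) s)"
        using \<beta>[OF cd(3) that(3)] R.puncture_add[OF cd(1,2)] by simp
      then show ?thesis
        using q_add[of "scale c s" "scale d s"] \<beta> that cd by (simp add: scale_add_left)
    qed
    have 3: "\<beta> (?f c) (s \<oplus>\<^bsub>S\<^esub> t) = \<beta> (?f c) s \<otimes>\<^bsub>Q A_Mod ?N\<^esub> \<beta> (?f c) t"
      if "c \<in> C" "s \<in> carrier S" "t \<in> carrier S" for c s t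
    proof -
      have "c \<in> carrier P" using that CP by blast
      then show ?thesis
        using q_add[of "scale c s" "scale c t"] \<beta> that by (simp add: scale_add_right)
    qed
    have 4: "\<beta> (r \<odot>\<^bsub>P\<^esub> ?f c) s = \<beta> (?f c) (r \<odot>\<^bsub>S\<^esub> s)"
      if "c \<in> C" "r \<in> carrier R" "s \<in> carrier S" for c r s
    proof -
      have c: "c \<in> carrier P" "r \<odot>\<^bsub>P\<^esub> c \<in> C" using that CP clC by blast+
      then show ?thesis
        using \<beta>[OF c(2) that(3)] R.puncture_smult[OF that(2) c(1), of A] \<beta> that
        by (simp add: scale_smult)
    qed
    show ?thesis
      unfolding balanced_def submod_def using 1 2 3 4 by auto
  qed
  obtain h where h_scale: "\<And>d s. \<lbrakk>d \<in> ?f ` C; s \<in> carrier S\<rbrakk> \<Longrightarrow> h (scale d s) = \<beta> d s"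
    and h_add: "\<And>v w. \<lbrakk>v \<in> span (?f ` C); w \<in> span (?f ` C)\<rbrakk> \<Longrightarrow>
        h (v \<oplus>\<^bsub>Q\<^esub> w) = h v \<otimes>\<^bsub>Q A_Mod ?N\<^esub> h w"
    and h_zero: "h \<zero>\<^bsub>Q\<^esub> = \<one>\<^bsub>Q A_Mod ?N\<^esub>"
    by (rule span_lift[OF D N.a_factorgroup_is_comm_group bal]) blast
  have factor: "?fS v \<in> span (?f ` C) \<and> h (?fS v) = ?q v" if "v \<in> span C" for v
    using that
  proof induction
    case zero
    have "?q \<zero>\<^bsub>Q\<^esub> = ?N" by (rule N.a_rcos_const[OF span.zero])
    then show ?case using h_zero span.zero by (simp add: puncture_zero N.quotient_simps)
  next
    case (scale c s)
    then have "c \<in> carrier P" using CP by blast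
    then show ?case using scale h_scale[of "?f c" s] \<beta>[of c s]
      by (simp add: puncture_scale span.scale)
  next
    case (add v w)
    then have vw: "v \<in> carrier Q" "w \<in> carrier Q" using span_subset[OF CP] by blast+
    have "?fS (v \<oplus>\<^bsub>Q\<^esub> w) = ?fS v \<oplus>\<^bsub>Q\<^esub> ?fS w" by (rule S.puncture_add[OF vw])
    then show ?case using add.IH h_add[of "?fS v" "?fS w"] q_add[OF vw] by (simp add: span.add)
  qed
  show "supported_in S n (span C) A \<subseteq> ?N"
  proof
    fix v assume "v \<in> supported_in S n (span C) A"
    then have v: "v \<in> span C" "?fS v = \<zero>\<^bsub>Q\<^esub>"
      by (auto simp: supported_in_iff S.puncture_eq_zero_iff)
    then have "?q v = ?N" using factor[OF v(1)] h_zero by (simp add: N.quotient_simps)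
    then show "v \<in> ?N" using N.mem_if_rcoset_eq span_subset[OF CP] v(1) by blast
  qed
qed

end


section \<open>Adjoining one element to a submodule\<close>

definition adjoin :: "('a, 'm) ring_scheme \<Rightarrow> ('a, 'b, 'c) module_scheme \<Rightarrow> 'b set \<Rightarrow> 'a set \<Rightarrow> 'b \<Rightarrow> 'b set" where
  "adjoin R M N I x = {u \<oplus>\<^bsub>M\<^esub> r \<odot>\<^bsub>M\<^esub> x |u r. u \<in> N \<and> r \<in> I}"

definition colon :: "('a, 'm) ring_scheme \<Rightarrow> ('a, 'b, 'c) module_scheme \<Rightarrow> 'b set \<Rightarrow> 'b \<Rightarrow> 'a set" where
  "colon R M N x = {r \<in> carrier R. r \<odot>\<^bsub>M\<^esub> x \<in> N}"

lemma adjoin_mono: "I \<subseteq> J \<Longrightarrow> adjoin R M N I x \<subseteq> adjoin R M N J x"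
  unfolding adjoin_def by blast

context Module.module
begin

lemma adjoin_submodule:
  assumes N: "submodule N R M" and I: "ideal I R" and x: "x \<in> carrier M"
  shows "submodule (adjoin R M N I x) R M"
  unfolding submodule_iff
proof (intro conjI ballI)
  have N': "N \<subseteq> carrier M" "\<zero>\<^bsub>M\<^esub> \<in> N" "\<And>u v. \<lbrakk>u \<in> N; v \<in> N\<rbrakk> \<Longrightarrow> u \<oplus>\<^bsub>M\<^esub> v \<in> N"
      "\<And>r u. \<lbrakk>r \<in> carrier R; u \<in> N\<rbrakk> \<Longrightarrow> r \<odot>\<^bsub>M\<^esub> u \<in> N"
    using N unfolding submodule_iff by blast+
  have I': "I \<subseteq> carrier R" "\<zero> \<in> I" "\<And>r s. \<lbrakk>r \<in> I; s \<in> I\<rbrakk> \<Longrightarrow> r \<oplus> s \<in> I"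
      "\<And>t r. \<lbrakk>t \<in> carrier R; r \<in> I\<rbrakk> \<Longrightarrow> t \<otimes> r \<in> I"
    using I unfolding R.ideal_iff by blast+
  show "adjoin R M N I x \<subseteq> carrier M" using N'(1) I'(1) x by (auto simp: adjoin_def)
  have "\<zero>\<^bsub>M\<^esub> = \<zero>\<^bsub>M\<^esub> \<oplus>\<^bsub>M\<^esub> \<zero> \<odot>\<^bsub>M\<^esub> x" using x by simp
  then show "\<zero>\<^bsub>M\<^esub> \<in> adjoin R M N I x" using N'(2) I'(2) unfolding adjoin_def by blast
  show "a \<oplus>\<^bsub>M\<^esub> b \<in> adjoin R M N I x" if ab: "a \<in> adjoin R M N I x" "b \<in> adjoin R M N I x" for a b
  proof -
    obtain u r v s where *: "a = u \<oplus>\<^bsub>M\<^esub> r \<odot>\<^bsub>M\<^esub> x" "b = v \<oplus>\<^bsub>M\<^esub> s \<odot>\<^bsub>M\<^esub> x"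
        "u \<in> N" "v \<in> N" "r \<in> I" "s \<in> I"
      using ab unfolding adjoin_def by blast
    then have "u \<in> carrier M" "v \<in> carrier M" "r \<in> carrier R" "s \<in> carrier R" using N'(1) I'(1) by blast+
    then have "a \<oplus>\<^bsub>M\<^esub> b = (u \<oplus>\<^bsub>M\<^esub> v) \<oplus>\<^bsub>M\<^esub> (r \<oplus> s) \<odot>\<^bsub>M\<^esub> x"
      using * x by (simp add: smult_l_distr M.a_ac)
    then show ?thesis using N'(3)[OF *(3,4)] I'(3)[OF *(5,6)] unfolding adjoin_def by blast
  qed
  show "t \<odot>\<^bsub>M\<^esub> a \<in> adjoin R M N I x" if t: "t \<in> carrier R" and a: "a \<in> adjoin R M N I x" for t a
  proof -
    obtain u r where *: "a = u \<oplus>\<^bsub>M\<^esub> r \<odot>\<^bsub>M\<^esub> x" "u \<in> N" "r \<in> I"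
      using a unfolding adjoin_def by blast
    then have "u \<in> carrier M" "r \<in> carrier R" using N'(1) I'(1) by blast+
    then have "t \<odot>\<^bsub>M\<^esub> a = t \<odot>\<^bsub>M\<^esub> u \<oplus>\<^bsub>M\<^esub> (t \<otimes> r) \<odot>\<^bsub>M\<^esub> x"
      using * x t by (simp add: smult_r_distr smult_assoc1)
    then show ?thesis using N'(4)[OF t *(2)] I'(4)[OF t *(3)] unfolding adjoin_def by blast
  qed
qed

lemma adjoin_upper:
  assumes "submodule N R M" "ideal I R" "x \<in> carrier M"
  shows "N \<subseteq> adjoin R M N I x"
proof
  fix u assume u: "u \<in> N"
  then have "u = u \<oplus>\<^bsub>M\<^esub> \<zero> \<odot>\<^bsub>M\<^esub> x" using assms unfolding submodule_iff by auto
  moreover have "\<zero> \<in> I" using assms(2) unfolding R.ideal_iff by blast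
  ultimately show "u \<in> adjoin R M N I x" using u unfolding adjoin_def by blast
qed

lemma smult_mem_adjoin:
  assumes "submodule N R M" "r \<in> I" "x \<in> carrier M" "r \<in> carrier R"
  shows "r \<odot>\<^bsub>M\<^esub> x \<in> adjoin R M N I x"
proof -
  have "r \<odot>\<^bsub>M\<^esub> x = \<zero>\<^bsub>M\<^esub> \<oplus>\<^bsub>M\<^esub> r \<odot>\<^bsub>M\<^esub> x" using assms by simp
  moreover have "\<zero>\<^bsub>M\<^esub> \<in> N" using assms(1) unfolding submodule_iff by blast
  ultimately show ?thesis using assms(2) unfolding adjoin_def by blast
qed

lemma adjoin_least:
  assumes "submodule D R M" "N \<subseteq> D" "x \<in> D" "I \<subseteq> carrier R"
  shows "adjoin R M N I x \<subseteq> D"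
  using assms submoduleE(4,5)[OF assms(1)] by (auto simp: adjoin_def subset_iff)

lemma colon_ideal:
  assumes N: "submodule N R M" and x: "x \<in> carrier M"
  shows "ideal (colon R M N x) R"
  using N x unfolding R.ideal_iff submodule_iff
  by (auto simp: colon_def smult_l_distr smult_assoc1)

text \<open>The isomorphism \<open>R / (N : x) \<cong> (N + R x) / N\<close> that is induced by \<open>r \<mapsto> r x\<close>, on the level of
  intermediate submodules: \<open>L \<mapsto> (L : x)\<close> and \<open>J \<mapsto> N + J x\<close> are strictly monotone.\<close>

lemma relative_length_adjoin:
  assumes N: "submodule N R M" and x: "x \<in> carrier M"
  shows "relative_length R M N (adjoin R M N (carrier R) x) =
    relative_length R (regular_module R) (colon R M N x) (carrier R)"
proof (rule antisym)
  let ?D = "adjoin R M N (carrier R) x" and ?E = "colon R M N x"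
  show "relative_length R M N ?D \<le> relative_length R (regular_module R) ?E (carrier R)"
    unfolding relative_length_def R.submodule_regular_module_iff
  proof (rule height_le_if_strict_mono[where f = "\<lambda>L. colon R M L x"])
    fix L assume "L \<in> {L. submodule L R M \<and> N \<subseteq> L \<and> L \<subseteq> ?D}"
    then show "colon R M L x \<in> {J. ideal J R \<and> ?E \<subseteq> J \<and> J \<subseteq> carrier R}"
      using colon_ideal[of L x] x by (auto simp: colon_def)
  next
    fix L L' assume "L \<in> {L. submodule L R M \<and> N \<subseteq> L \<and> L \<subseteq> ?D}"
      "L' \<in> {L. submodule L R M \<and> N \<subseteq> L \<and> L \<subseteq> ?D}" and LL: "L \<subset> L'"
    then have L: "submodule L R M" "N \<subseteq> L" and L': "submodule L' R M" "L' \<subseteq> ?D" by auto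
    have "L' \<subseteq> L" if sub: "colon R M L' x \<subseteq> colon R M L x"
    proof
      fix m assume m: "m \<in> L'"
      then obtain u r where ur: "m = u \<oplus>\<^bsub>M\<^esub> r \<odot>\<^bsub>M\<^esub> x" "u \<in> N" "r \<in> carrier R"
        using L'(2) unfolding adjoin_def by blast
      have uM: "u \<in> carrier M" using ur N unfolding submodule_iff by blast
      have "m \<ominus>\<^bsub>M\<^esub> u = r \<odot>\<^bsub>M\<^esub> x"
        using ur uM x by (simp add: M.minus_eq M.a_ac M.r_neg1 M.r_neg2)
      moreover have "m \<ominus>\<^bsub>M\<^esub> u \<in> L'" using submodule_minus_closed[OF L'(1) m] ur L LL by blast
      ultimately have "r \<in> colon R M L' x" using ur by (simp add: colon_def)
      then have "r \<odot>\<^bsub>M\<^esub> x \<in> L" using sub by (auto simp: colon_def)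
      then show "m \<in> L" using ur L submoduleE(5)[OF L(1)] by blast
    qed
    then show "colon R M L x \<subset> colon R M L' x" using LL by (auto simp: colon_def)
  qed
  show "relative_length R (regular_module R) ?E (carrier R) \<le> relative_length R M N ?D"
    unfolding relative_length_def R.submodule_regular_module_iff
  proof (rule height_le_if_strict_mono[where f = "\<lambda>J. adjoin R M N J x"])
    fix J assume "J \<in> {J. ideal J R \<and> ?E \<subseteq> J \<and> J \<subseteq> carrier R}"
    then show "adjoin R M N J x \<in> {L. submodule L R M \<and> N \<subseteq> L \<and> L \<subseteq> ?D}"
      using adjoin_submodule[OF N _ x] adjoin_upper[OF N _ x] adjoin_mono[of J "carrier R"] by simp
  next
    fix J J' assume "J \<in> {J. ideal J R \<and> ?E \<subseteq> J \<and> J \<subseteq> carrier R}"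
      "J' \<in> {J. ideal J R \<and> ?E \<subseteq> J \<and> J \<subseteq> carrier R}" and JJ: "J \<subset> J'"
    then have J: "ideal J R" "?E \<subseteq> J" and J': "J' \<subseteq> carrier R" by auto
    interpret J: ideal J R by (rule J(1))
    have "J' \<subseteq> J" if sub: "adjoin R M N J' x \<subseteq> adjoin R M N J x"
    proof
      fix s assume s: "s \<in> J'"
      then have sR: "s \<in> carrier R" using J' by blast
      have "s \<odot>\<^bsub>M\<^esub> x \<in> adjoin R M N J x" using smult_mem_adjoin[OF N s x sR] sub by blast
      then obtain u t where ut: "s \<odot>\<^bsub>M\<^esub> x = u \<oplus>\<^bsub>M\<^esub> t \<odot>\<^bsub>M\<^esub> x" "u \<in> N" "t \<in> J"
        unfolding adjoin_def by blast
      have tR: "t \<in> carrier R" and uM: "u \<in> carrier M"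
        using ut N unfolding submodule_iff by auto
      have "(s \<oplus> \<ominus> t) \<odot>\<^bsub>M\<^esub> x = s \<odot>\<^bsub>M\<^esub> x \<oplus>\<^bsub>M\<^esub> \<ominus>\<^bsub>M\<^esub> (t \<odot>\<^bsub>M\<^esub> x)"
        using sR tR x by (simp add: smult_l_distr smult_l_minus)
      also have "\<dots> = u" using ut tR uM x by (simp add: M.a_assoc M.r_neg)
      finally have "s \<oplus> \<ominus> t \<in> J" using J(2) ut sR tR by (auto simp: colon_def)
      then have "(s \<oplus> \<ominus> t) \<oplus> t \<in> J" using ut by simp
      then show "s \<in> J" using sR tR by (simp add: R.a_assoc R.l_neg)
    qed
    moreover have "adjoin R M N J x \<subseteq> adjoin R M N J' x" using JJ by (intro adjoin_mono) blast
    ultimately show "adjoin R M N J x \<subset> adjoin R M N J' x" using JJ by blast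
  qed
qed

text \<open>A module \<open>D / N\<close> of length one is generated by any nonzero class \<open>x\<close>, and its annihilator is
  maximal.  For the latter, if \<open>a x \<notin> N\<close> then \<open>a x\<close> generates too, so \<open>x = u + r a x\<close> with \<open>u \<in> N\<close>,
  and \<open>1 - r a\<close> annihilates \<open>x\<close>.\<close>

lemma simple_quotient:
  assumes N: "submodule N R M" and D: "submodule D R M" and "N \<subset> D"
    and len: "relative_length R M N D = 1"
  obtains x where "x \<in> D" "x \<notin> N" "D = adjoin R M N (carrier R) x" "maximalideal (colon R M N x) R"
proof -
  have full: "L = D" if "submodule L R M" "N \<subset> L" "L \<subseteq> D" for L
  proof (rule ccontr)
    assume "L \<noteq> D"
    then have "1 \<le> relative_length R M N L" "1 \<le> relative_length R M L D"
      using one_le_relative_length[OF N, of L] one_le_relative_length[OF _ D, of L] that by auto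
    from add_mono[OF this] have "1 + 1 \<le> relative_length R M N D"
      using relative_length_add[OF N that(1) D] that by (simp only: psubset_imp_subset)
    then show False using len by (simp add: one_enat_def)
  qed
  obtain x where x: "x \<in> D" "x \<notin> N" using \<open>N \<subset> D\<close> by blast
  have xM: "x \<in> carrier M" using x D unfolding submodule_iff by blast
  have gen: "D = adjoin R M N (carrier R) y" if y: "y \<in> D" "y \<notin> N" for y
  proof -
    have yM: "y \<in> carrier M" using y D unfolding submodule_iff by blast
    have "y \<in> adjoin R M N (carrier R) y"
      using smult_mem_adjoin[OF N R.one_closed yM R.one_closed] yM by simp
    then have "N \<subset> adjoin R M N (carrier R) y"
      using adjoin_upper[OF N R.oneideal yM] y by blast
    then show ?thesis
      using full[OF adjoin_submodule[OF N R.oneideal yM]] adjoin_least[OF D _ y(1) subset_refl] \<open>N \<subset> D\<close>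
      by blast
  qed
  let ?I = "colon R M N x"
  have I: "ideal ?I R" by (rule colon_ideal[OF N xM])
  have "maximalideal ?I R"
  proof (rule maximalidealI[OF I])
    have "\<one> \<notin> ?I" using x xM by (simp add: colon_def)
    then show "carrier R \<noteq> ?I" using R.one_closed by blast
  next
    fix J assume J: "ideal J R" "?I \<subseteq> J" "J \<subseteq> carrier R"
    interpret J: ideal J R by (rule J(1))
    show "J = ?I \<or> J = carrier R"
    proof (rule disjCI)
      assume "J \<noteq> carrier R"
      show "J = ?I"
      proof (rule ccontr)
        assume "J \<noteq> ?I"
        then obtain a where a: "a \<in> J" "a \<notin> ?I" using J by blast
        have aR: "a \<in> carrier R" using a J by blast
        have "a \<odot>\<^bsub>M\<^esub> x \<in> D" "a \<odot>\<^bsub>M\<^esub> x \<notin> N"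
          using a aR submoduleE(4)[OF D aR x(1)] by (auto simp: colon_def)
        then have "x \<in> adjoin R M N (carrier R) (a \<odot>\<^bsub>M\<^esub> x)" using gen x by blast
        then obtain u r where ur: "x = u \<oplus>\<^bsub>M\<^esub> r \<odot>\<^bsub>M\<^esub> (a \<odot>\<^bsub>M\<^esub> x)" "u \<in> N" "r \<in> carrier R"
          unfolding adjoin_def by blast
        have uM: "u \<in> carrier M" using ur N unfolding submodule_iff by blast
        have "(\<one> \<oplus> \<ominus> (r \<otimes> a)) \<odot>\<^bsub>M\<^esub> x = x \<oplus>\<^bsub>M\<^esub> \<ominus>\<^bsub>M\<^esub> (r \<odot>\<^bsub>M\<^esub> (a \<odot>\<^bsub>M\<^esub> x))"
          using ur(3) aR xM by (simp add: smult_l_distr smult_l_minus smult_assoc1)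
        also have "\<dots> = u"
          using arg_cong[OF ur(1), of "\<lambda>z. z \<oplus>\<^bsub>M\<^esub> \<ominus>\<^bsub>M\<^esub> (r \<odot>\<^bsub>M\<^esub> (a \<odot>\<^bsub>M\<^esub> x))"] uM ur(3) aR xM
          by (simp add: M.a_assoc M.r_neg)
        finally have "\<one> \<oplus> \<ominus> (r \<otimes> a) \<in> J" using J(2) ur aR by (auto simp: colon_def)
        moreover have "r \<otimes> a \<in> J" using J.I_l_closed a(1) ur(3) .
        ultimately have "(\<one> \<oplus> \<ominus> (r \<otimes> a)) \<oplus> r \<otimes> a \<in> J" by (rule J.a_closed)
        then have "\<one> \<in> J" using ur(3) aR by (simp add: R.a_assoc R.l_neg)
        then show False using J.one_imp_carrier \<open>J \<noteq> carrier R\<close> by blast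
      qed
    qed
  qed
  then show thesis using that x gen[OF x] by blast
qed

end


section \<open>Lengths under extension of scalars\<close>

context flat_algebra
begin

lemma smult_scale_one:
  "\<lbrakk>x \<in> carrier P; t \<in> carrier S\<rbrakk> \<Longrightarrow> t \<odot>\<^bsub>Q\<^esub> scale x \<one>\<^bsub>S\<^esub> = scale x t"
  by (simp add: smult_scale)

lemma span_adjoin:
  assumes D: "submodule D R P" and x: "x \<in> carrier P"
  shows "span (adjoin R P D (carrier R) x) = adjoin S Q (span D) (carrier S) (scale x \<one>\<^bsub>S\<^esub>)"
proof
  have DP: "D \<subseteq> carrier P" using D unfolding RP.submodule_iff by blast
  let ?A = "adjoin R P D (carrier R) x" and ?B = "adjoin S Q (span D) (carrier S) (scale x \<one>\<^bsub>S\<^esub>)"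
  have xS: "scale x \<one>\<^bsub>S\<^esub> \<in> carrier Q" using x by simp
  have A: "submodule ?A R P" by (rule RP.adjoin_submodule[OF D R.oneideal x])
  have AP: "?A \<subseteq> carrier P" using A unfolding RP.submodule_iff by blast
  have B: "submodule ?B S Q" by (rule SP.adjoin_submodule[OF span_submodule[OF DP] S.oneideal xS])
  show "span ?A \<subseteq> ?B"
  proof
    fix v assume "v \<in> span ?A"
    then show "v \<in> ?B"
    proof induction
      case zero
      show ?case using B unfolding SP.submodule_iff by blast
    next
      case (scale d s)
      then obtain u r where d: "d = u \<oplus>\<^bsub>P\<^esub> r \<odot>\<^bsub>P\<^esub> x" "u \<in> D" "r \<in> carrier R"
        unfolding adjoin_def by blast
      have uP: "u \<in> carrier P" using d DP by blast
      have rs: "r \<odot>\<^bsub>S\<^esub> s \<in> carrier S" using d scale by simp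
      have "scale d s = scale u s \<oplus>\<^bsub>Q\<^esub> (r \<odot>\<^bsub>S\<^esub> s) \<odot>\<^bsub>Q\<^esub> scale x \<one>\<^bsub>S\<^esub>"
        using d uP x scale rs by (simp add: scale_add_left scale_smult smult_scale_one)
      then show ?case using span.scale[OF d(2) scale(2)] rs unfolding adjoin_def by blast
    next
      case (add v w)
      then show ?case using B unfolding SP.submodule_iff by blast
    qed
  qed
  show "?B \<subseteq> span ?A"
  proof (rule SP.adjoin_least[OF span_submodule[OF AP]])
    show "span D \<subseteq> span ?A" by (rule span_mono[OF RP.adjoin_upper[OF D R.oneideal x]])
    have "x \<in> ?A" using RP.smult_mem_adjoin[OF D R.one_closed x R.one_closed] x by simp
    then show "scale x \<one>\<^bsub>S\<^esub> \<in> span ?A" by (intro span.scale) simp_all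
  qed simp
qed

text \<open>Extension of scalars commutes with colon ideals.  That \<open>x s \<in> D S\<close> forces \<open>s \<in> (D : x) S\<close> follows
  from the homomorphism on \<open>(D + R x) S\<close> that sends \<open>(u + a x) s\<close> to the class of \<open>a s\<close>: it vanishes
  on \<open>D S\<close> and sends \<open>x s\<close> to the class of \<open>s\<close>.\<close>

lemma colon_span:
  assumes D: "submodule D R P" and x: "x \<in> carrier P"
  shows "colon S Q (span D) (scale x \<one>\<^bsub>S\<^esub>) = extended_ideal (colon R P D x) S"
proof
  have DP: "D \<subseteq> carrier P" using D unfolding RP.submodule_iff by blast
  have xS: "scale x \<one>\<^bsub>S\<^esub> \<in> carrier Q" using x by simp
  let ?I = "colon R P D x" and ?E = "extended_ideal (colon R P D x) S"
  have IR: "?I \<subseteq> carrier R" by (auto simp: colon_def)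
  have gens: "(\<lambda>r. r \<odot>\<^bsub>S\<^esub> \<one>\<^bsub>S\<^esub>) ` ?I \<subseteq> carrier S" using IR by auto
  have E: "ideal ?E S" unfolding extended_ideal_def by (rule S.genideal_ideal[OF gens])
  have IE: "r \<odot>\<^bsub>S\<^esub> \<one>\<^bsub>S\<^esub> \<in> ?E" if "r \<in> ?I" for r
    unfolding extended_ideal_def using S.genideal_self[OF gens] that by blast
  show "?E \<subseteq> colon S Q (span D) (scale x \<one>\<^bsub>S\<^esub>)"
    unfolding extended_ideal_def
  proof (rule S.genideal_minimal)
    show "ideal (colon S Q (span D) (scale x \<one>\<^bsub>S\<^esub>)) S"
      by (rule SP.colon_ideal[OF span_submodule[OF DP] xS])
    show "(\<lambda>r. r \<odot>\<^bsub>S\<^esub> \<one>\<^bsub>S\<^esub>) ` ?I \<subseteq> colon S Q (span D) (scale x \<one>\<^bsub>S\<^esub>)"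
    proof clarify
      fix r assume r: "r \<in> ?I"
      then have rR: "r \<in> carrier R" and rx: "r \<odot>\<^bsub>P\<^esub> x \<in> D" by (auto simp: colon_def)
      have "(r \<odot>\<^bsub>S\<^esub> \<one>\<^bsub>S\<^esub>) \<odot>\<^bsub>Q\<^esub> scale x \<one>\<^bsub>S\<^esub> = scale (r \<odot>\<^bsub>P\<^esub> x) \<one>\<^bsub>S\<^esub>"
        using rR x by (simp add: smult_scale_one scale_smult)
      then show "r \<odot>\<^bsub>S\<^esub> \<one>\<^bsub>S\<^esub> \<in> colon S Q (span D) (scale x \<one>\<^bsub>S\<^esub>)"
        using span.scale[OF rx S.one_closed] rR by (simp add: colon_def)
    qed
  qed
  interpret E: ideal ?E S by (rule E)
  let ?A = "adjoin R P D (carrier R) x" and ?q = "\<lambda>s. ?E +>\<^bsub>S\<^esub> s"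
  have A: "submodule ?A R P" by (rule RP.adjoin_submodule[OF D R.oneideal x])
  have wd: "?q (a \<odot>\<^bsub>S\<^esub> s) = ?q (b \<odot>\<^bsub>S\<^esub> s)"
    if eq: "u \<oplus>\<^bsub>P\<^esub> a \<odot>\<^bsub>P\<^esub> x = v \<oplus>\<^bsub>P\<^esub> b \<odot>\<^bsub>P\<^esub> x" and uv: "u \<in> D" "v \<in> D"
      and ab: "a \<in> carrier R" "b \<in> carrier R" and s: "s \<in> carrier S" for u v a b s
  proof (rule E.rcoset_eqI)
    have P: "u \<in> carrier P" "v \<in> carrier P" "a \<odot>\<^bsub>P\<^esub> x \<in> carrier P" "b \<odot>\<^bsub>P\<^esub> x \<in> carrier P"
      using uv DP ab x by (auto intro: RP.smult_closed)
    have "a \<odot>\<^bsub>P\<^esub> x = \<ominus>\<^bsub>P\<^esub> u \<oplus>\<^bsub>P\<^esub> (v \<oplus>\<^bsub>P\<^esub> b \<odot>\<^bsub>P\<^esub> x)"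
      using RP.M.a_transpose_inv[OF eq P(1,3)] P by simp
    then have "(a \<oplus>\<^bsub>R\<^esub> \<ominus>\<^bsub>R\<^esub> b) \<odot>\<^bsub>P\<^esub> x = \<ominus>\<^bsub>P\<^esub> u \<oplus>\<^bsub>P\<^esub> (v \<oplus>\<^bsub>P\<^esub> b \<odot>\<^bsub>P\<^esub> x) \<oplus>\<^bsub>P\<^esub> \<ominus>\<^bsub>P\<^esub> (b \<odot>\<^bsub>P\<^esub> x)"
      using ab x by (simp add: RP.smult_l_distr RP.smult_l_minus)
    also have "\<dots> = \<ominus>\<^bsub>P\<^esub> u \<oplus>\<^bsub>P\<^esub> v" using P by (simp add: RP.M.a_assoc RP.M.r_neg)
    also have "\<dots> \<in> D" using RP.submoduleE(3,5)[OF D] uv by blast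
    finally have "a \<oplus>\<^bsub>R\<^esub> \<ominus>\<^bsub>R\<^esub> b \<in> ?I" using ab by (simp add: colon_def)
    from E.I_r_closed[OF IE[OF this] s]
    have "((a \<oplus>\<^bsub>R\<^esub> \<ominus>\<^bsub>R\<^esub> b) \<odot>\<^bsub>S\<^esub> \<one>\<^bsub>S\<^esub>) \<otimes>\<^bsub>S\<^esub> s \<in> ?E" .
    also have "((a \<oplus>\<^bsub>R\<^esub> \<ominus>\<^bsub>R\<^esub> b) \<odot>\<^bsub>S\<^esub> \<one>\<^bsub>S\<^esub>) \<otimes>\<^bsub>S\<^esub> s = (a \<oplus>\<^bsub>R\<^esub> \<ominus>\<^bsub>R\<^esub> b) \<odot>\<^bsub>S\<^esub> s"
      using algebra.smult_assoc2[OF algebra, of "a \<oplus>\<^bsub>R\<^esub> \<ominus>\<^bsub>R\<^esub> b" "\<one>\<^bsub>S\<^esub>" s] ab s by simp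
    also have "\<dots> = a \<odot>\<^bsub>S\<^esub> s \<ominus>\<^bsub>S\<^esub> b \<odot>\<^bsub>S\<^esub> s"
      using ab s by (simp add: RS.smult_l_distr RS.smult_l_minus S.minus_eq)
    finally show "a \<odot>\<^bsub>S\<^esub> s \<ominus>\<^bsub>S\<^esub> b \<odot>\<^bsub>S\<^esub> s \<in> ?E" .
  qed (use ab s in simp_all)
  \<comment> \<open>An element of \<open>D + R x\<close> may have several coefficients at \<open>x\<close>; by \<open>wd\<close> they agree modulo \<open>(D : x)\<close>.\<close>
  define coef where "coef d = (SOME a. a \<in> carrier R \<and> (\<exists>u\<in>D. d = u \<oplus>\<^bsub>P\<^esub> a \<odot>\<^bsub>P\<^esub> x))" for d
  define \<beta> where "\<beta> d s = ?q (coef d \<odot>\<^bsub>S\<^esub> s)" for d s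
  have \<beta>: "\<beta> (u \<oplus>\<^bsub>P\<^esub> a \<odot>\<^bsub>P\<^esub> x) s = ?q (a \<odot>\<^bsub>S\<^esub> s)"
    if "u \<in> D" "a \<in> carrier R" "s \<in> carrier S" for u a s
  proof -
    let ?d = "u \<oplus>\<^bsub>P\<^esub> a \<odot>\<^bsub>P\<^esub> x"
    have "coef ?d \<in> carrier R \<and> (\<exists>v\<in>D. ?d = v \<oplus>\<^bsub>P\<^esub> coef ?d \<odot>\<^bsub>P\<^esub> x)"
      unfolding coef_def
      by (rule someI[of "\<lambda>b. b \<in> carrier R \<and> (\<exists>v\<in>D. ?d = v \<oplus>\<^bsub>P\<^esub> b \<odot>\<^bsub>P\<^esub> x)" a]) (use that in blast)
    then obtain v where "coef ?d \<in> carrier R" "v \<in> D" "?d = v \<oplus>\<^bsub>P\<^esub> coef ?d \<odot>\<^bsub>P\<^esub> x" by blast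
    then show ?thesis unfolding \<beta>_def using wd[of u a v "coef ?d" s] that by simp
  qed
  have q_add: "?q s \<otimes>\<^bsub>S A_Mod ?E\<^esub> ?q t = ?q (s \<oplus>\<^bsub>S\<^esub> t)" if "s \<in> carrier S" "t \<in> carrier S" for s t
    using E.a_rcos_sum[OF that] by simp
  have bal: "balanced R (submod R n ?A) S (S A_Mod ?E) \<beta>"
  proof -
    have 1: "\<beta> d s \<in> carrier (S A_Mod ?E)" if ds: "d \<in> ?A" "s \<in> carrier S" for d s
    proof -
      obtain u a where d: "d = u \<oplus>\<^bsub>P\<^esub> a \<odot>\<^bsub>P\<^esub> x" "u \<in> D" "a \<in> carrier R"
        using ds unfolding adjoin_def by blast
      then show ?thesis using \<beta>[OF d(2,3) that(2)] that
        by (simp add: E.quotient_simps S.a_rcosetsI[OF E.a_subset])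
    qed
    have 2: "\<beta> (d \<oplus>\<^bsub>P\<^esub> e) s = \<beta> d s \<otimes>\<^bsub>S A_Mod ?E\<^esub> \<beta> e s"
      if ds: "d \<in> ?A" "e \<in> ?A" "s \<in> carrier S" for d e s
    proof -
      obtain u a v b where d: "d = u \<oplus>\<^bsub>P\<^esub> a \<odot>\<^bsub>P\<^esub> x" "u \<in> D" "a \<in> carrier R"
        and e: "e = v \<oplus>\<^bsub>P\<^esub> b \<odot>\<^bsub>P\<^esub> x" "v \<in> D" "b \<in> carrier R"
        using ds unfolding adjoin_def by blast
      have uv: "u \<oplus>\<^bsub>P\<^esub> v \<in> D" using RP.submoduleE(5)[OF D d(2) e(2)] .
      have "u \<in> carrier P" "v \<in> carrier P" using d e DP by blast+
      then have "d \<oplus>\<^bsub>P\<^esub> e = (u \<oplus>\<^bsub>P\<^esub> v) \<oplus>\<^bsub>P\<^esub> (a \<oplus>\<^bsub>R\<^esub> b) \<odot>\<^bsub>P\<^esub> x"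
        using d e x by (simp add: RP.smult_l_distr RP.M.a_ac)
      then have "\<beta> (d \<oplus>\<^bsub>P\<^esub> e) s = ?q ((a \<oplus>\<^bsub>R\<^esub> b) \<odot>\<^bsub>S\<^esub> s)"
        using \<beta>[OF uv _ that(3)] d e by simp
      then show ?thesis
        using \<beta>[OF d(2,3) that(3)] \<beta>[OF e(2,3) that(3)] q_add[of "a \<odot>\<^bsub>S\<^esub> s" "b \<odot>\<^bsub>S\<^esub> s"] d e that(3)
        by (simp add: RS.smult_l_distr)
    qed
    have 3: "\<beta> d (s \<oplus>\<^bsub>S\<^esub> t) = \<beta> d s \<otimes>\<^bsub>S A_Mod ?E\<^esub> \<beta> d t"
      if ds: "d \<in> ?A" "s \<in> carrier S" "t \<in> carrier S" for d s t
    proof -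
      obtain u a where d: "d = u \<oplus>\<^bsub>P\<^esub> a \<odot>\<^bsub>P\<^esub> x" "u \<in> D" "a \<in> carrier R"
        using ds unfolding adjoin_def by blast
      show ?thesis
        using \<beta>[OF d(2,3)] that q_add[of "a \<odot>\<^bsub>S\<^esub> s" "a \<odot>\<^bsub>S\<^esub> t"] d by (simp add: RS.smult_r_distr)
    qed
    have 4: "\<beta> (r \<odot>\<^bsub>P\<^esub> d) s = \<beta> d (r \<odot>\<^bsub>S\<^esub> s)"
      if ds: "d \<in> ?A" "r \<in> carrier R" "s \<in> carrier S" for d r s
    proof -
      obtain u a where d: "d = u \<oplus>\<^bsub>P\<^esub> a \<odot>\<^bsub>P\<^esub> x" "u \<in> D" "a \<in> carrier R"
        using ds unfolding adjoin_def by blast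
      have ru: "r \<odot>\<^bsub>P\<^esub> u \<in> D" using RP.submoduleE(4)[OF D that(2) d(2)] .
      have "u \<in> carrier P" using d DP by blast
      then have "r \<odot>\<^bsub>P\<^esub> d = r \<odot>\<^bsub>P\<^esub> u \<oplus>\<^bsub>P\<^esub> (r \<otimes>\<^bsub>R\<^esub> a) \<odot>\<^bsub>P\<^esub> x"
        using d x that by (simp add: RP.smult_r_distr RP.smult_assoc1)
      then have "\<beta> (r \<odot>\<^bsub>P\<^esub> d) s = ?q ((r \<otimes>\<^bsub>R\<^esub> a) \<odot>\<^bsub>S\<^esub> s)"
        using \<beta>[OF ru _ that(3)] d that by simp
      moreover have "(r \<otimes>\<^bsub>R\<^esub> a) \<odot>\<^bsub>S\<^esub> s = a \<odot>\<^bsub>S\<^esub> (r \<odot>\<^bsub>S\<^esub> s)"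
        using d that by (simp add: R.m_comm[of r a] RS.smult_assoc1)
      ultimately show ?thesis using \<beta>[OF d(2,3), of "r \<odot>\<^bsub>S\<^esub> s"] d that by simp
    qed
    show ?thesis unfolding balanced_def submod_def using 1 2 3 4 by simp
  qed
  obtain h where h_scale: "\<And>d s. \<lbrakk>d \<in> ?A; s \<in> carrier S\<rbrakk> \<Longrightarrow> h (scale d s) = \<beta> d s"
    and h_add: "\<And>v w. \<lbrakk>v \<in> span ?A; w \<in> span ?A\<rbrakk> \<Longrightarrow> h (v \<oplus>\<^bsub>Q\<^esub> w) = h v \<otimes>\<^bsub>S A_Mod ?E\<^esub> h w"
    and h_zero: "h \<zero>\<^bsub>Q\<^esub> = \<one>\<^bsub>S A_Mod ?E\<^esub>"
    by (rule span_lift[OF A E.a_factorgroup_is_comm_group bal]) blast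
  have DA: "D \<subseteq> ?A" by (rule RP.adjoin_upper[OF D R.oneideal x])
  have vanish: "h v = ?E" if "v \<in> span D" for v
    using that
  proof induction
    case zero
    then show ?case using h_zero by (simp add: E.quotient_simps)
  next
    case (scale d s)
    have "d = d \<oplus>\<^bsub>P\<^esub> \<zero>\<^bsub>R\<^esub> \<odot>\<^bsub>P\<^esub> x" using scale DP x by auto
    then have "h (scale d s) = ?q (\<zero>\<^bsub>R\<^esub> \<odot>\<^bsub>S\<^esub> s)"
      using h_scale[of d s] \<beta>[of d "\<zero>\<^bsub>R\<^esub>" s] scale DA by auto
    then show ?case using scale E.a_rcos_const[OF E.zero_closed] by simp
  next
    case (add v w)
    then have "v \<in> span ?A" "w \<in> span ?A" using span_mono[OF DA] by blast+
    then have "h (v \<oplus>\<^bsub>Q\<^esub> w) = ?q \<zero>\<^bsub>S\<^esub> \<otimes>\<^bsub>S A_Mod ?E\<^esub> ?q \<zero>\<^bsub>S\<^esub>"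
      using h_add[of v w] add.IH E.a_rcos_const[OF E.zero_closed] by simp
    then show ?case using q_add[of "\<zero>\<^bsub>S\<^esub>" "\<zero>\<^bsub>S\<^esub>"] E.a_rcos_const[OF E.zero_closed] by simp
  qed
  show "colon S Q (span D) (scale x \<one>\<^bsub>S\<^esub>) \<subseteq> ?E"
  proof
    fix s assume "s \<in> colon S Q (span D) (scale x \<one>\<^bsub>S\<^esub>)"
    then have s: "s \<in> carrier S" "scale x s \<in> span D"
      using x by (auto simp: colon_def smult_scale_one)
    have D0: "\<zero>\<^bsub>P\<^esub> \<in> D" using D unfolding RP.submodule_iff by blast
    have x1: "x = \<zero>\<^bsub>P\<^esub> \<oplus>\<^bsub>P\<^esub> \<one>\<^bsub>R\<^esub> \<odot>\<^bsub>P\<^esub> x" using x by simp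
    have "x \<in> ?A" using RP.smult_mem_adjoin[OF D R.one_closed x R.one_closed] x by simp
    then have "h (scale x s) = ?q (\<one>\<^bsub>R\<^esub> \<odot>\<^bsub>S\<^esub> s)"
      using h_scale[of x s] \<beta>[OF D0 R.one_closed s(1)] x1 s by simp
    then have "?q s = ?E" using vanish[OF s(2)] s by simp
    then show "s \<in> ?E" by (rule E.mem_if_rcoset_eq[OF s(1)])
  qed
qed

lemma span_zero: "span {\<zero>\<^bsub>P\<^esub>} = {\<zero>\<^bsub>Q\<^esub>}"
proof
  show "span {\<zero>\<^bsub>P\<^esub>} \<subseteq> {\<zero>\<^bsub>Q\<^esub>}"
  proof
    fix v assume "v \<in> span {\<zero>\<^bsub>P\<^esub>}"
    then show "v \<in> {\<zero>\<^bsub>Q\<^esub>}"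
    proof induction
      case (scale d s)
      then show ?case by (auto simp: scale_def power_module_simps intro!: restrict_ext)
    qed auto
  qed
qed (auto intro: span.zero)

text \<open>Induction along a composition series.  In its last step \<open>D = D' + R x\<close> the annihilator of \<open>x\<close>
  modulo \<open>D'\<close> is \<open>\<mm>\<close>, the only maximal ideal, so passing from \<open>D' S\<close> to \<open>D S\<close> adds the length of
  \<open>S / \<mm> S\<close>.\<close>

lemma relative_length_span:
  assumes R: "local_ring R \<mm>" and D: "submodule D R P"
    and "relative_length R P {\<zero>\<^bsub>P\<^esub>} D = enat k"
  shows "relative_length S Q {\<zero>\<^bsub>Q\<^esub>} (span D) =
    enat k * relative_length S (regular_module S) (extended_ideal \<mm> S) (carrier S)"
  using D assms(3)
proof (induction k arbitrary: D)
  case 0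
  have "{\<zero>\<^bsub>P\<^esub>} \<subseteq> D" using 0(1) unfolding RP.submodule_iff by blast
  moreover have "\<not> {\<zero>\<^bsub>P\<^esub>} \<subset> D"
    using RP.one_le_relative_length[OF RP.zero_submodule 0(1)] 0(2) by (auto simp: enat_0)
  ultimately have "D = {\<zero>\<^bsub>P\<^esub>}" by blast
  then show ?case using SP.relative_length_refl[OF SP.zero_submodule] by (simp add: span_zero enat_0)
next
  case (Suc k)
  note D = Suc.prems(1)
  have zD: "{\<zero>\<^bsub>P\<^esub>} \<subseteq> D" using D unfolding RP.submodule_iff by blast
  have "chain_of_length {N. submodule N R P \<and> {\<zero>\<^bsub>P\<^esub>} \<subseteq> N \<and> N \<subseteq> D} (Suc k)"
    using RP.enat_le_relative_length_iff[OF RP.zero_submodule zD, of "Suc k"] Suc.prems(2) by simp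
  then obtain N where N: "\<And>i. i \<le> Suc k \<Longrightarrow> submodule (N i) R P \<and> {\<zero>\<^bsub>P\<^esub>} \<subseteq> N i \<and> N i \<subseteq> D"
      "\<And>i. i < Suc k \<Longrightarrow> N i \<subset> N (Suc i)"
    unfolding chain_of_length_def by auto
  \<comment> \<open>The last proper submodule of a longest chain up to \<open>D\<close>.\<close>
  let ?D' = "N k"
  have D': "submodule ?D' R P" "{\<zero>\<^bsub>P\<^esub>} \<subseteq> ?D'" "?D' \<subset> D"
    using N(1)[of k] N(1)[of "Suc k"] N(2)[of k] by auto
  have "chain_of_length {L. submodule L R P \<and> {\<zero>\<^bsub>P\<^esub>} \<subseteq> L \<and> L \<subseteq> ?D'} k"
    unfolding chain_of_length_def
  proof (intro exI[of _ N] conjI allI impI)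
    fix i assume i: "i \<le> k"
    have "N i \<subseteq> N k"
      using i N(2) by (induction k rule: dec_induct) (use less_Suc_eq in \<open>blast+\<close>)
    then show "N i \<in> {L. submodule L R P \<and> {\<zero>\<^bsub>P\<^esub>} \<subseteq> L \<and> L \<subseteq> ?D'}" using N(1)[of i] i by auto
  next
    fix i assume "i < k" then show "N i \<subset> N (Suc i)" using N(2)[of i] by simp
  qed
  then have ge_k: "enat k \<le> relative_length R P {\<zero>\<^bsub>P\<^esub>} ?D'"
    using RP.enat_le_relative_length_iff[OF RP.zero_submodule D'(2)] by simp
  have ge_1: "1 \<le> relative_length R P ?D' D" by (rule RP.one_le_relative_length[OF D'(1) D D'(3)])
  have "enat (Suc k) = relative_length R P {\<zero>\<^bsub>P\<^esub>} ?D' + relative_length R P ?D' D"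
    using RP.relative_length_add[OF RP.zero_submodule D'(1) D D'(2)] D'(3) Suc.prems(2) by simp
  then have len: "relative_length R P {\<zero>\<^bsub>P\<^esub>} ?D' = enat k" "relative_length R P ?D' D = 1"
    using ge_k ge_1
    by (cases "relative_length R P {\<zero>\<^bsub>P\<^esub>} ?D'"; cases "relative_length R P ?D' D"; simp add: one_enat_def)+
  obtain x where x: "x \<in> D" "D = adjoin R P ?D' (carrier R) x" "maximalideal (colon R P ?D' x) R"
    using RP.simple_quotient[OF D'(1) D D'(3) len(2)] by blast
  have xP: "x \<in> carrier P" using x(1) D unfolding RP.submodule_iff by blast
  have colon: "colon R P ?D' x = \<mm>" using local_ring.maximalideal_iff[OF R] x(3) by blast
  have D'P: "?D' \<subseteq> carrier P" and DP: "D \<subseteq> carrier P" using D' D unfolding RP.submodule_iff by blast+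
  let ?\<theta> = "relative_length S (regular_module S) (extended_ideal \<mm> S) (carrier S)"
  have "relative_length S Q (span ?D') (span D) = ?\<theta>"
    using SP.relative_length_adjoin[OF span_submodule[OF D'P], of "scale x \<one>\<^bsub>S\<^esub>"] xP
    by (simp add: x(2)[symmetric] span_adjoin[OF D'(1) xP, symmetric] colon_span[OF D'(1) xP] colon)
  moreover have "relative_length S Q {\<zero>\<^bsub>Q\<^esub>} (span D) =
      relative_length S Q {\<zero>\<^bsub>Q\<^esub>} (span ?D') + relative_length S Q (span ?D') (span D)"
    using span.zero[of ?D'] span_mono[of ?D' D] D'(3)
    by (intro SP.relative_length_add SP.zero_submodule span_submodule D'P DP) auto
  ultimately have "relative_length S Q {\<zero>\<^bsub>Q\<^esub>} (span D) = enat k * ?\<theta> + ?\<theta>"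
    using Suc.IH[OF D'(1) len(1)] by simp
  also have "\<dots> = enat (Suc k) * ?\<theta>"
    by (simp add: distrib_right[symmetric] eSuc_enat[symmetric] mult_eSuc add.commute)
  finally show ?case .
qed

end


section \<open>Weight polynomials\<close>

lemma pcompose_monom_monom:
  "pcompose (monom c k) (monom 1 m) = (monom c (m * k) :: 'a :: comm_semiring_1 poly)"
  by (induction k) (simp_all add: monom_0 monom_Suc pcompose_pCons mult_monom)

theorem corollary5p6:
  fixes R :: "('r, 'e) ring_scheme"
    and S :: "('r, 's) module"
    and \<mm> :: "'r set" and \<nn> :: "'s set"
    and C :: "(nat \<Rightarrow> 'r) set"
    and n i \<theta> :: nat
  assumes "local_artinian_ring R \<mm>"
    and "n \<ge> 1"
    and "is_code R n C"
    and "algebra R S"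
    and "flat_module R S"
    and "local_artinian_ring S \<nn>"
    and "\<theta> = the_enat (module_length S (quotient_ring_module S (extended_ideal \<mm> S)))"
    and "i \<le> n"
  shows "weight_poly S n (extended_code R S n C) i
       = pcompose (weight_poly R n C i) (monom 1 \<theta>)"
proof -
  interpret R: local_artinian_ring R \<mm> by fact
  interpret flat_algebra R S n using assms(4,5) by (rule flat_algebra.intro)
  let ?E = "extended_ideal \<mm> S"
  let ?\<theta> = "relative_length S (regular_module S) ?E (carrier S)"
  have C: "submodule C R P" using assms(3) by (simp add: is_code_def)
  have "maximalideal \<mm> R" using R.maximalideal_iff by blast
  then have "\<mm> \<subseteq> carrier R"
    using ideal.axioms(1)[OF maximalideal.axioms(1)] additive_subgroup.a_subset by blast
  then have "(\<lambda>r. r \<odot>\<^bsub>S\<^esub> \<one>\<^bsub>S\<^esub>) ` \<mm> \<subseteq> carrier S" by auto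
  then have E: "ideal ?E S" unfolding extended_ideal_def by (rule S.genideal_ideal)
  interpret regS: Module.module S "regular_module S" by (rule S.regular_module)
  have "?\<theta> \<le> relative_length S (regular_module S) {\<zero>\<^bsub>S\<^esub>} (carrier S)"
    using E unfolding S.ideal_iff by (intro regS.relative_length_mono) auto
  also have "\<dots> < \<infinity>" by (rule local_artinian_ring.finite_length[OF assms(6)])
  finally have \<theta>: "?\<theta> = enat \<theta>"
    unfolding assms(7) S.module_length_quotient[OF E] by (auto simp: less_infinityE)
  have length: "the_enat (module_length S (submod S n (supported_in S n (extended_code R S n C) A))) =
      \<theta> * the_enat (module_length R (submod R n (supported_in R n C A)))" for A
  proof -
    let ?CA = "supported_in R n C A"
    have CA: "submodule ?CA R P" by (rule R.submodule_supported_in[OF C])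
    then have CAP: "?CA \<subseteq> carrier P" unfolding RP.submodule_iff by blast
    have "relative_length R P {\<zero>\<^bsub>P\<^esub>} ?CA \<le> relative_length R P {\<zero>\<^bsub>P\<^esub>} (carrier P)"
      using CAP by (intro RP.relative_length_mono) auto
    also have "\<dots> < \<infinity>" by (rule R.finite_length_power_module)
    finally obtain k where k: "relative_length R P {\<zero>\<^bsub>P\<^esub>} ?CA = enat k" by (auto elim: less_infinityE)
    have "relative_length S Q {\<zero>\<^bsub>Q\<^esub>} (span ?CA) = enat k * enat \<theta>"
      using relative_length_span[OF R.local_ring_axioms CA k] \<theta> by simp
    then show ?thesis
      unfolding extended_code_eq_span[OF C] supported_in_span[OF C] submod_def
        SP.module_length_submodule[OF span_submodule[OF CAP]] RP.module_length_submodule[OF CA] k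
      by simp
  qed
  show ?thesis
    unfolding weight_poly_def length
    by (simp add: pcompose_sum pcompose_monom_monom)
qed

end
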